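(* Let $\mathbb{T}$ be a geometric theory and let $s\colon G^{\mathbb{T}}_1\to G^{\mathbb{T}}_0$ be the source morphism of the localic groupoid $G^{\mathbb{T}}$ described in the context. The frame map $s^*\colon\mathcal{O}G^{\mathbb{T}}_0\to\mathcal{O}G^{\mathbb{T}}_1$ has a left adjoint $s_!\colon\mathcal{O}G^{\mathbb{T}}_1\to\mathcal{O}G^{\mathbb{T}}_0$, which is the join-preserving map determined on basic opens (finite meets of generators, with $I,J,K$ finite) by $$s_!\left(\bigwedge_{i\in I}[\vec a^i\in R^i_1]\wedge\bigwedge_{j\in J}[\vec b^j\in R^j_2]\wedge\bigwedge_{k\in K}[\alpha^{X^k}(c^k)=d^k]\right)=\bigwedge_{i\in I}[\vec a^i\in R^i]\wedge\bigvee_{\vec y\in\mathbb{N}^V}\left(\bigwedge_{j\in J}[\vec\pi^j(\vec y)\in R^j]\wedge\bigwedge_{k\in K}[c^k\sim^{X^k}\pi^k(\vec y)]\right).$$ Here $V$ is the set of `distinct variables' represented by the entries $b^j_\ell$ and the values $d^k$: its elements are the pairs $(n,X)$ where $n$ is a natural number occurring as some entry $b^j_\ell$ of a tuple $\vec b^j$ or as some $d^k$, and $X$ is the sort of $\mathbb{T}$ that is the type of that occurrence (the sort of the $\ell$-th argument of $R^j$, respectively $X^k$). The maps $\vec\pi^j$ and $\pi^k$ project out the values indexed by the appropriate variables: $\vec\pi^j(\vec y)$ is the tuple whose $\ell$-th entry is the component of $\vec y$ at $(b^j_\ell,X)$ with $X$ the sort of the $\ell$-th argument of $R^j$, and $\pi^k(\vec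 y)$ is the component of $\vec y$ at $(d^k,X^k)$.
   Context: **Geometric theories.** A (first-order) geometric theory $\mathbb{T}$ consists of a set of sorts, a set of relation symbols $R \subseteq X^1 \times \dots \times X^k$ ($k \ge 0$; there are no function symbols, functions being treated as relations), and a set of axioms, which are sequents $\phi \vdash_{x_1\colon X^1,\dots,x_k\colon X^k} \psi$ between geometric formulae, i.e. formulae built from relation symbols and equality using finite conjunctions, arbitrary (set-indexed) disjunctions and $\exists$. It is propositional if it has no sorts. The classifying locale of a propositional geometric theory is the locale whose frame is presented by the basic propositions as generators and a relation $\phi\le\psi$ for each axiom $\phi\vdash\psi$. $\mathcal{O}X$ denotes the frame of a locale $X$ and $f^*\colon \mathcal{O}Y\to\mathcal{O}X$ the frame homomorphism of a locale map $f\colon X\to Y$. **The propositional theory $P[\mathbb{T}]$.** It has the following basic propositions and axioms. (1) For each sort $X$ of $\mathbb{T}$: a basic proposition $[n\sim^X m]$ for all $n,m\in\mathbb{N}$, and axioms $[n\sim^X m]\vdash[m\sim^X n]$ and $[n\sim^X m]\wedge[m\sim^X \ell]\vdash[n\sim^X\ell]$ for all $n,m,\ell\in\mathbb{N}$. (2) For each relation symbol $R\subseteq X^1\times\dots\times X^k$ of $\mathbb{T}$ (not including equality) and all $n_1,\dots,n_k,m_1,\dots,m_k\in\mathbb{N}$: a basic proposition $[(n_1,\dots,n_k)\in R]$ and axioms $[(n_1,\dots,n_k)\in R]\wedge[n_1\sim^{X^1}m_1]\wedge\dots\wedge[n_k\sim^{X^k}m_k]\vdash[(m_1,\dots,m_k)\in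 R]$ and $[(n_1,\dots,n_k)\in R]\vdash[n_1\sim^{X^1}n_1]\wedge\dots\wedge[n_k\sim^{X^k}n_k]$. (3) For each axiom $\phi\vdash_{x_1\colon X^1,\dots,x_k\colon X^k}\psi$ of $\mathbb{T}$ and all $n_1,\dots,n_k\in\mathbb{N}$: the axiom $\bigwedge_{i=1}^k[n_i\sim^{X^i}n_i]\wedge\phi_{n_1,\dots,n_k}\vdash\psi_{n_1,\dots,n_k}$, where $\phi_{n_1,\dots,n_k},\psi_{n_1,\dots,n_k}$ are obtained from $\phi,\psi$ by replacing each free variable $x_i$ by $n_i$, each quantifier $\exists x\colon X.\ \chi(x,\dots)$ by $\bigvee_{n_x\in\mathbb{N}}\big([n_x\sim^X n_x]\wedge\chi(n_x,\dots)\big)$, each subformula $(y_1,\dots,y_\ell)\in R$ by $[(y_1,\dots,y_\ell)\in R]$, and each subformula $x=_X y$ by $[x\sim^X y]$. **The theory $\mathbb{T}_{\cong}$** of isomorphisms of $\mathbb{T}$-models. It has: two copies of $\mathbb{T}$ (sorts $X_1,X_2$, relation symbols $R_1,R_2$, and both copies of each axiom, the subscript-$i$ copy being over the subscript-$i$ sorts); for each sort $X$ of $\mathbb{T}$ a relation symbol $\alpha^X\subseteq X_1\times X_2$ with the axioms $(x,y)\in\alpha^X\wedge(x',y')\in\alpha^X\wedge x=_{X_1}x'\ \dashv\vdash_{x,x'\colon X_1,\,y,y'\colon X_2}\ (x,y)\in\alpha^X\wedge(x',y')\in\alpha^X\wedge y=_{X_2}y'$, $\ \vdash_{y\colon X_2}\exists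 x\colon X_1.\,(x,y)\in\alpha^X$, and $\ \vdash_{x\colon X_1}\exists y\colon X_2.\,(x,y)\in\alpha^X$; and for each relation symbol $R\subseteq X^1\times\dots\times X^k$ of $\mathbb{T}$ the axioms $\bigwedge_{i=1}^k(x_i,y_i)\in\alpha^{X^i}\wedge(x_1,\dots,x_k)\in R_1\ \dashv\vdash_{\vec x,\vec y}\ \bigwedge_{i=1}^k(x_i,y_i)\in\alpha^{X^i}\wedge(y_1,\dots,y_k)\in R_2$. ($\dashv\vdash$ denotes a sequent in both directions.) **The locales and the source map.** $G^{\mathbb{T}}_0$ is the classifying locale of $P[\mathbb{T}]$ and $G^{\mathbb{T}}_1$ is the classifying locale of $P[\mathbb{T}_{\cong}]$ (the construction $P$ applied to $\mathbb{T}_{\cong}$). We write $[\alpha^X(n)=m]$ for the generator $[(n,m)\in\alpha^X]$ of $\mathcal{O}G^{\mathbb{T}}_1$. Throughout, a relation $R$ in a generator $[\vec n\in R]$ may also be the equality relation $=_X$ of a sort, in which case $[(n,m)\in{=_X}]$ means $[n\sim^X m]$ (and similarly with $R_1,R_2$ and $\sim^{X_1},\sim^{X_2}$). The source map $s\colon G^{\mathbb{T}}_1\to G^{\mathbb{T}}_0$ is given by the frame homomorphism with $s^*[\vec n\in R]=[\vec n\in R_1]$. *)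

theory Defs
  imports "HOL-Algebra.Galois_Connection"
begin

section \<open>Geometric theories\<close>

datatype ('s, 'r) grel = Eq 's | Sym 'r

text \<open>
  Variables are de Bruijn indices into a context, which is a list of sorts; \<open>Exists X \<phi>\<close> binds
  index 0 of \<open>\<phi>\<close>. The disjunction \<open>Disj I f\<close> ranges over \<open>i \<in> I\<close> only. The index type \<open>'i\<close>
  is arbitrary, so that every set of formulae can be formed into a disjunction.
\<close>

datatype ('s, 'r, 'i) fm =
    Atom "('s, 'r) grel" "nat list"
  | Top
  | And "('s, 'r, 'i) fm" "('s, 'r, 'i) fm"
  | Disj "'i set" "'i \<Rightarrow> ('s, 'r, 'i) fm"
  | Exists 's "('s, 'r, 'i) fm"

datatype ('s, 'r, 'i) sequent =
  Sequent "('s, 'r, 'i) fm" "'s list" "('s, 'r, 'i) fm" (\<open>(_ \<turnstile>\<^bsub>_\<^esub> _)\<close> [56, 0, 56] 55)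

record ('s, 'r, 'i) geo_theory =
  sorts :: "'s set"
  rels :: "'r set"
  arity :: "'r \<Rightarrow> 's list"
  axioms :: "('s, 'r, 'i) sequent set"

primrec rel_in :: "('s, 'r, 'i) geo_theory \<Rightarrow> ('s, 'r) grel \<Rightarrow> bool" where
  "rel_in T (Eq X) \<longleftrightarrow> X \<in> sorts T"
| "rel_in T (Sym R) \<longleftrightarrow> R \<in> rels T"

primrec rel_arity :: "('s, 'r, 'i) geo_theory \<Rightarrow> ('s, 'r) grel \<Rightarrow> 's list" where
  "rel_arity T (Eq X) = [X, X]"
| "rel_arity T (Sym R) = arity T R"

primrec wf_fm :: "('s, 'r, 'i) geo_theory \<Rightarrow> ('s, 'r, 'i) fm \<Rightarrow> 's list \<Rightarrow> bool" where
  "wf_fm T (Atom R xs) \<Gamma> \<longleftrightarrow>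
     rel_in T R \<and> list_all2 (\<lambda>x X. x < length \<Gamma> \<and> \<Gamma> ! x = X) xs (rel_arity T R)"
| "wf_fm T Top \<Gamma> \<longleftrightarrow> True"
| "wf_fm T (And \<phi> \<psi>) \<Gamma> \<longleftrightarrow> wf_fm T \<phi> \<Gamma> \<and> wf_fm T \<psi> \<Gamma>"
| "wf_fm T (Disj I f) \<Gamma> \<longleftrightarrow> (\<forall>i\<in>I. wf_fm T (f i) \<Gamma>)"
| "wf_fm T (Exists X \<phi>) \<Gamma> \<longleftrightarrow> X \<in> sorts T \<and> wf_fm T \<phi> (X # \<Gamma>)"

primrec wf_sequent :: "('s, 'r, 'i) geo_theory \<Rightarrow> ('s, 'r, 'i) sequent \<Rightarrow> bool" where
  "wf_sequent T (\<phi> \<turnstile>\<^bsub>\<Gamma>\<^esub> \<psi>) \<longleftrightarrow> set \<Gamma> \<subseteq> sorts T \<and> wf_fm T \<phi> \<Gamma> \<and> wf_fm T \<psi> \<Gamma>"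

definition geometric_theory :: "('s, 'r, 'i) geo_theory \<Rightarrow> bool" where
  "geometric_theory T \<longleftrightarrow>
     (\<forall>R\<in>rels T. set (arity T R) \<subseteq> sorts T) \<and> (\<forall>\<sigma>\<in>axioms T. wf_sequent T \<sigma>)"

definition propositional :: "('s, 'r, 'i) geo_theory \<Rightarrow> bool" where
  "propositional T \<longleftrightarrow> geometric_theory T \<and> sorts T = {}"

definition conjs :: "('s, 'r, 'i) fm list \<Rightarrow> ('s, 'r, 'i) fm" where
  "conjs \<phi>s = foldr And \<phi>s Top"


section \<open>Frames and classifying locales\<close>

locale frame = complete_lattice +
  assumes meet_Sup_distrib:
    "\<lbrakk>x \<in> carrier L; A \<subseteq> carrier L\<rbrakk> \<Longrightarrow> x \<sqinter> \<Squnion>A = \<Squnion>((\<lambda>a. x \<sqinter> a) ` A)"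

definition frame_hom :: "('a, 'c) gorder_scheme \<Rightarrow> ('b, 'd) gorder_scheme \<Rightarrow> ('a \<Rightarrow> 'b) \<Rightarrow> bool" where
  "frame_hom L M h \<longleftrightarrow> h \<in> carrier L \<rightarrow> carrier M \<and> h \<top>\<^bsub>L\<^esub> = \<top>\<^bsub>M\<^esub> \<and>
     (\<forall>x\<in>carrier L. \<forall>y\<in>carrier L. h (x \<sqinter>\<^bsub>L\<^esub> y) = h x \<sqinter>\<^bsub>M\<^esub> h y) \<and>
     (\<forall>A\<subseteq>carrier L. h (\<Squnion>\<^bsub>L\<^esub>A) = \<Squnion>\<^bsub>M\<^esub>(h ` A))"

text \<open>
  The value in \<open>L\<close> of a formula over a propositional theory, given values of the basic propositions.
  Equality and quantifiers do not occur in such formulae.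
\<close>

primrec eval :: "('a, 'c) gorder_scheme \<Rightarrow> ('p \<Rightarrow> 'a) \<Rightarrow> ('s, 'p, 'i) fm \<Rightarrow> 'a" where
  "eval L v (Atom R xs) = (case R of Sym p \<Rightarrow> v p | Eq X \<Rightarrow> undefined)"
| "eval L v Top = \<top>\<^bsub>L\<^esub>"
| "eval L v (And \<phi> \<psi>) = eval L v \<phi> \<sqinter>\<^bsub>L\<^esub> eval L v \<psi>"
| "eval L v (Disj I f) = \<Squnion>\<^bsub>L\<^esub>((\<lambda>i. eval L v (f i)) ` I)"
| "eval L v (Exists X \<phi>) = undefined"

definition model :: "('s, 'p, 'i) geo_theory \<Rightarrow> ('a, 'c) gorder_scheme \<Rightarrow> ('p \<Rightarrow> 'a) \<Rightarrow> bool" where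
  "model T L v \<longleftrightarrow> v ` rels T \<subseteq> carrier L \<and>
     (\<forall>\<phi> \<Gamma> \<psi>. (\<phi> \<turnstile>\<^bsub>\<Gamma>\<^esub> \<psi>) \<in> axioms T \<longrightarrow> eval L v \<phi> \<sqsubseteq>\<^bsub>L\<^esub> eval L v \<psi>)"

text \<open>
  The free frame on \<open>G\<close>: a finite set \<open>F\<close> of generators stands for their meet, and an element
  is a set of such meets, closed under passing to smaller meets (that is, larger \<open>F\<close>), standing
  for their join.
\<close>

definition free_frame :: "'p set \<Rightarrow> 'p set set gorder" where
  "free_frame G =
     \<lparr>carrier = {U. U \<subseteq> Fpow G \<and> (\<forall>F\<in>U. \<forall>F'\<in>Fpow G. F \<subseteq> F' \<longrightarrow> F' \<in> U)},
      eq = (=), le = (\<subseteq>)\<rparr>"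

definition free_gen :: "'p set \<Rightarrow> 'p \<Rightarrow> 'p set set" where
  "free_gen G p = {F \<in> Fpow G. p \<in> F}"

text \<open>
  The frame presented by the basic propositions and a relation \<open>\<phi> \<le> \<psi>\<close> for each axiom, realised
  as the quotient of the free frame whose elements are the \<open>U\<close> with \<open>(\<psi> \<rightarrow> U) \<le> (\<phi> \<rightarrow> U)\<close> for
  all axioms. Its universal property is proved below.
\<close>

definition classifying_frame :: "('s, 'p, 'i) geo_theory \<Rightarrow> 'p set set gorder" where
  "classifying_frame T =
     (let L = free_frame (rels T); v = free_gen (rels T) in
      \<lparr>carrier = {U \<in> carrier L. \<forall>\<phi> \<Gamma> \<psi>. (\<phi> \<turnstile>\<^bsub>\<Gamma>\<^esub> \<psi>) \<in> axioms T \<longrightarrow>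
           (\<forall>W\<in>carrier L. W \<sqinter>\<^bsub>L\<^esub> eval L v \<psi> \<sqsubseteq>\<^bsub>L\<^esub> U \<longrightarrow> W \<sqinter>\<^bsub>L\<^esub> eval L v \<phi> \<sqsubseteq>\<^bsub>L\<^esub> U)},
       eq = (=), le = (\<subseteq>)\<rparr>)"

definition gen :: "('s, 'p, 'i) geo_theory \<Rightarrow> 'p \<Rightarrow> 'p set set" where
  "gen T p = \<Inter>{U \<in> carrier (classifying_frame T). {p} \<in> U}"

text \<open>The frame homomorphism on a presented frame induced by values of the generators.\<close>

definition induced_hom :: "('a, 'c) gorder_scheme \<Rightarrow> ('p \<Rightarrow> 'a) \<Rightarrow> 'p set set \<Rightarrow> 'a" where
  "induced_hom L v U = \<Squnion>\<^bsub>L\<^esub>((\<lambda>F. \<Sqinter>\<^bsub>L\<^esub>(v ` F)) ` U)"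


section \<open>The propositional theory of partially enumerated models\<close>

text \<open>The pair \<open>(R, ns)\<close> is the proposition \<open>[ns \<in> R]\<close>; in particular \<open>(Eq X, [n, m])\<close> is \<open>[n \<sim>\<^sup>X m]\<close>.\<close>

type_synonym ('s, 'r) bprop = "('s, 'r) grel \<times> nat list"

abbreviation bp :: "('s, 'r) grel \<Rightarrow> nat list \<Rightarrow> (unit, ('s, 'r) bprop, 'j) fm" where
  "bp R ns \<equiv> Atom (Sym (R, ns)) []"

definition sims :: "'s list \<Rightarrow> nat list \<Rightarrow> nat list \<Rightarrow> (unit, ('s, 'r) bprop, 'j) fm" where
  "sims Xs ns ms = conjs (map (\<lambda>(X, n, m). bp (Eq X) [n, m]) (zip Xs (zip ns ms)))"

text \<open>The countable disjunctions replacing quantifiers are indexed by the right summand of \<open>'i + nat\<close>.\<close>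

primrec ground :: "('s, 'r, 'i) fm \<Rightarrow> nat list \<Rightarrow> (unit, ('s, 'r) bprop, 'i + nat) fm" where
  "ground (Atom R xs) ns = bp R (map (\<lambda>x. ns ! x) xs)"
| "ground Top ns = Top"
| "ground (And \<phi> \<psi>) ns = And (ground \<phi> ns) (ground \<psi> ns)"
| "ground (Disj I f) ns = Disj (Inl ` I) (case_sum (\<lambda>i. ground (f i) ns) (\<lambda>_. Top))"
| "ground (Exists X \<phi>) ns =
     Disj (range Inr) (case_sum (\<lambda>_. Top) (\<lambda>n. And (bp (Eq X) [n, n]) (ground \<phi> (n # ns))))"

definition prop_theory ::
  "('s, 'r, 'i) geo_theory \<Rightarrow> (unit, ('s, 'r) bprop, 'i + nat) geo_theory" where
  "prop_theory T = \<lparr>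
     sorts = {},
     rels = {(R, ns). rel_in T R \<and> length ns = length (rel_arity T R)},
     arity = (\<lambda>_. []),
     axioms =
       {bp (Eq X) [n, m] \<turnstile>\<^bsub>[]\<^esub> bp (Eq X) [m, n] | X n m. X \<in> sorts T} \<union>
       {And (bp (Eq X) [n, m]) (bp (Eq X) [m, l]) \<turnstile>\<^bsub>[]\<^esub> bp (Eq X) [n, l] | X n m l.
          X \<in> sorts T} \<union>
       {And (bp (Sym R) ns) (sims (arity T R) ns ms) \<turnstile>\<^bsub>[]\<^esub> bp (Sym R) ms | R ns ms.
          R \<in> rels T \<and> length ns = length (arity T R) \<and> length ms = length (arity T R)} \<union>
       {bp (Sym R) ns \<turnstile>\<^bsub>[]\<^esub> sims (arity T R) ns ns | R ns.
          R \<in> rels T \<and> length ns = length (arity T R)} \<union>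
       {And (sims \<Gamma> ns ns) (ground \<phi> ns) \<turnstile>\<^bsub>[]\<^esub> ground \<psi> ns | \<phi> \<Gamma> \<psi> ns.
          (\<phi> \<turnstile>\<^bsub>\<Gamma>\<^esub> \<psi>) \<in> axioms T \<and> length ns = length \<Gamma>}\<rparr>"


section \<open>The theory of isomorphisms\<close>

datatype 's iso_sort = S1 's | S2 's
datatype ('s, 'r) iso_rel = R1 'r | R2 'r | Alpha 's

definition biseq :: "('s, 'r, 'i) fm \<Rightarrow> 's list \<Rightarrow> ('s, 'r, 'i) fm \<Rightarrow> ('s, 'r, 'i) sequent set" where
  "biseq \<phi> \<Gamma> \<psi> = {\<phi> \<turnstile>\<^bsub>\<Gamma>\<^esub> \<psi>, \<psi> \<turnstile>\<^bsub>\<Gamma>\<^esub> \<phi>}"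

abbreviation alpha :: "'s \<Rightarrow> nat \<Rightarrow> nat \<Rightarrow> ('s iso_sort, ('s, 'r) iso_rel, 'i) fm" where
  "alpha X x y \<equiv> Atom (Sym (Alpha X)) [x, y]"

definition bij_axioms :: "'s \<Rightarrow> ('s iso_sort, ('s, 'r) iso_rel, 'i) sequent set" where
  "bij_axioms X =
     biseq (conjs [alpha X 0 2, alpha X 1 3, Atom (Eq (S1 X)) [0, 1]]) [S1 X, S1 X, S2 X, S2 X]
           (conjs [alpha X 0 2, alpha X 1 3, Atom (Eq (S2 X)) [2, 3]]) \<union>
     {Top \<turnstile>\<^bsub>[S2 X]\<^esub> Exists (S1 X) (alpha X 0 1),
      Top \<turnstile>\<^bsub>[S1 X]\<^esub> Exists (S2 X) (alpha X 1 0)}"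

text \<open>Here the variables \<open>x\<^sub>i\<close> are numbered \<open>0, \<dots>, k - 1\<close> and the \<open>y\<^sub>i\<close> are numbered \<open>k, \<dots>, 2 k - 1\<close>.\<close>

definition rel_axioms :: "'r \<Rightarrow> 's list \<Rightarrow> ('s iso_sort, ('s, 'r) iso_rel, 'i) sequent set" where
  "rel_axioms R Xs =
     (let k = length Xs; \<alpha>s = conjs (map (\<lambda>i. alpha (Xs ! i) i (k + i)) [0..<k]) in
      biseq (And \<alpha>s (Atom (Sym (R1 R)) [0..<k])) (map S1 Xs @ map S2 Xs)
            (And \<alpha>s (Atom (Sym (R2 R)) [k..<2 * k])))"

definition iso_theory ::
  "('s, 'r, 'i) geo_theory \<Rightarrow> ('s iso_sort, ('s, 'r) iso_rel, 'i) geo_theory" where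
  "iso_theory T = \<lparr>
     sorts = S1 ` sorts T \<union> S2 ` sorts T,
     rels = R1 ` rels T \<union> R2 ` rels T \<union> Alpha ` sorts T,
     arity = (\<lambda>R. case R of R1 r \<Rightarrow> map S1 (arity T r) | R2 r \<Rightarrow> map S2 (arity T r)
                          | Alpha X \<Rightarrow> [S1 X, S2 X]),
     axioms =
       map_sequent S1 R1 ` axioms T \<union> map_sequent S2 R2 ` axioms T \<union>
       (\<Union>X\<in>sorts T. bij_axioms X) \<union> (\<Union>R\<in>rels T. rel_axioms R (arity T R))\<rparr>"


section \<open>The frames of objects and arrows and the source map\<close>

definition OG0 :: "('s, 'r, 'i) geo_theory \<Rightarrow> ('s, 'r) bprop set set gorder" where
  "OG0 T = classifying_frame (prop_theory T)"

definition OG1 :: "('s, 'r, 'i) geo_theory \<Rightarrow> ('s iso_sort, ('s, 'r) iso_rel) bprop set set gorder" where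
  "OG1 T = classifying_frame (prop_theory (iso_theory T))"

definition gen0 :: "('s, 'r, 'i) geo_theory \<Rightarrow> ('s, 'r) grel \<Rightarrow> nat list \<Rightarrow> ('s, 'r) bprop set set" where
  "gen0 T R ns = gen (prop_theory T) (R, ns)"

definition gen1 :: "('s, 'r, 'i) geo_theory \<Rightarrow> ('s iso_sort, ('s, 'r) iso_rel) grel \<Rightarrow> nat list \<Rightarrow>
    ('s iso_sort, ('s, 'r) iso_rel) bprop set set" where
  "gen1 T R ns = gen (prop_theory (iso_theory T)) (R, ns)"

definition source_inv :: "('s, 'r, 'i) geo_theory \<Rightarrow> ('s, 'r) bprop set set \<Rightarrow>
    ('s iso_sort, ('s, 'r) iso_rel) bprop set set" where
  "source_inv T = induced_hom (OG1 T) (\<lambda>(R, ns). gen1 T (map_grel S1 R1 R) ns)"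


section \<open>The formula for the left adjoint of the source map\<close>

text \<open>
  The finite families are lists: \<open>(R, as)\<close> in \<open>I\<close> stands for \<open>[as \<in> R\<^sub>1]\<close>, \<open>(R, bs)\<close> in \<open>J\<close> for
  \<open>[bs \<in> R\<^sub>2]\<close>, and \<open>(X, c, d)\<close> in \<open>K\<close> for \<open>[\<alpha>\<^sup>X(c) = d]\<close>.
\<close>

definition typed_vars ::
  "('s, 'r, 'i) geo_theory \<Rightarrow> ('s, 'r) bprop list \<Rightarrow> ('s \<times> nat \<times> nat) list \<Rightarrow> (nat \<times> 's) set" where
  "typed_vars T J K =
     (\<Union>(R, bs)\<in>set J. set (zip bs (rel_arity T R))) \<union> (\<lambda>(X, c, d). (d, X)) ` set K"

definition basic_open :: "('s, 'r, 'i) geo_theory \<Rightarrow>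
    ('s, 'r) bprop list \<Rightarrow> ('s, 'r) bprop list \<Rightarrow> ('s \<times> nat \<times> nat) list \<Rightarrow>
    ('s iso_sort, ('s, 'r) iso_rel) bprop set set" where
  "basic_open T I J K =
     \<Sqinter>\<^bsub>OG1 T\<^esub>((\<lambda>(R, as). gen1 T (map_grel S1 R1 R) as) ` set I) \<sqinter>\<^bsub>OG1 T\<^esub>
     \<Sqinter>\<^bsub>OG1 T\<^esub>((\<lambda>(R, bs). gen1 T (map_grel S2 R2 R) bs) ` set J) \<sqinter>\<^bsub>OG1 T\<^esub>
     \<Sqinter>\<^bsub>OG1 T\<^esub>((\<lambda>(X, c, d). gen1 T (Sym (Alpha X)) [c, d]) ` set K)"

definition basic_image :: "('s, 'r, 'i) geo_theory \<Rightarrow>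
    ('s, 'r) bprop list \<Rightarrow> ('s, 'r) bprop list \<Rightarrow> ('s \<times> nat \<times> nat) list \<Rightarrow> ('s, 'r) bprop set set" where
  "basic_image T I J K =
     \<Sqinter>\<^bsub>OG0 T\<^esub>((\<lambda>(R, as). gen0 T R as) ` set I) \<sqinter>\<^bsub>OG0 T\<^esub>
     \<Squnion>\<^bsub>OG0 T\<^esub>((\<lambda>y.
        \<Sqinter>\<^bsub>OG0 T\<^esub>((\<lambda>(R, bs). gen0 T R (map y (zip bs (rel_arity T R)))) ` set J) \<sqinter>\<^bsub>OG0 T\<^esub>
        \<Sqinter>\<^bsub>OG0 T\<^esub>((\<lambda>(X, c, d). gen0 T (Eq X) [c, y (d, X)]) ` set K))
       ` (typed_vars T J K \<rightarrow>\<^sub>E UNIV))"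

definition shriek_formula :: "('s, 'r, 'i) geo_theory \<Rightarrow>
    (('s iso_sort, ('s, 'r) iso_rel) bprop set set \<Rightarrow> ('s, 'r) bprop set set) \<Rightarrow> bool" where
  "shriek_formula T f \<longleftrightarrow>
     (\<forall>I J K. set I \<subseteq> rels (prop_theory T) \<longrightarrow> set J \<subseteq> rels (prop_theory T) \<longrightarrow>
        fst ` set K \<subseteq> sorts T \<longrightarrow> f (basic_open T I J K) = basic_image T I J K)"


section \<open>Well-formedness of the two theories\<close>

lemma geometric_prop_theory:
  fixes T :: "('s, 'r, 'i) geo_theory"
  assumes "geometric_theory T"
  shows "propositional (prop_theory T)"
proof -
  let ?P = "prop_theory T"
  have conjs: "wf_fm ?P (conjs \<phi>s) \<Gamma> \<longleftrightarrow> (\<forall>\<phi>\<in>set \<phi>s. wf_fm ?P \<phi> \<Gamma>)" for \<phi>s \<Gamma>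
    by (induction \<phi>s) (auto simp: conjs_def)
  have bp: "wf_fm ?P (bp R ns) \<Gamma> \<longleftrightarrow> rel_in T R \<and> length ns = length (rel_arity T R)" for R ns \<Gamma>
    by (auto simp: prop_theory_def)
  have sims: "wf_fm ?P (sims Xs ns ms) \<Gamma>" if "set Xs \<subseteq> sorts T" for Xs ns ms \<Gamma>
    using that by (auto simp: sims_def conjs bp dest: set_zip_leftD simp del: wf_fm.simps(1))
  have ground: "wf_fm ?P (ground \<phi> ns) []" if "wf_fm T \<phi> \<Gamma>" for \<phi> ns \<Gamma>
    using that
    by (induction \<phi> arbitrary: ns \<Gamma>) (auto simp: bp list_all2_lengthD simp del: wf_fm.simps(1), auto dest: list_all2_lengthD)
  have "wf_sequent ?P \<sigma>" if "\<sigma> \<in> axioms ?P" for \<sigma>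
    using that assms ground
    by (subst (asm) prop_theory_def) (fastforce simp: bp sims geometric_theory_def simp del: wf_fm.simps(1))
  then show ?thesis
    by (auto simp: propositional_def geometric_theory_def) (auto simp: prop_theory_def)
qed

lemma geometric_iso_theory:
  fixes T :: "('s, 'r, 'i) geo_theory"
  assumes "geometric_theory T"
  shows "geometric_theory (iso_theory T)"
proof -
  let ?I = "iso_theory T"
  have conjs: "wf_fm ?I (conjs \<phi>s) \<Gamma> \<longleftrightarrow> (\<forall>\<phi>\<in>set \<phi>s. wf_fm ?I \<phi> \<Gamma>)" for \<phi>s \<Gamma>
    by (induction \<phi>s) (auto simp: conjs_def)
  have ar: "rel_arity ?I (map_grel S1 R1 R) = map S1 (rel_arity T R)"
    "rel_arity ?I (map_grel S2 R2 R) = map S2 (rel_arity T R)" for R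
    by (cases R; simp add: iso_theory_def)+
  have ri: "rel_in T R \<Longrightarrow> rel_in ?I (map_grel S1 R1 R)" "rel_in T R \<Longrightarrow> rel_in ?I (map_grel S2 R2 R)" for R
    by (cases R; auto simp: iso_theory_def)+
  have sub: "X \<in> sorts T \<Longrightarrow> S1 X \<in> sorts ?I" "X \<in> sorts T \<Longrightarrow> S2 X \<in> sorts ?I" for X
    by (auto simp: iso_theory_def)
  have m1: "wf_fm T \<phi> \<Gamma> \<Longrightarrow> wf_fm ?I (map_fm S1 R1 \<phi>) (map S1 \<Gamma>)" for \<phi> \<Gamma>
    by (induction \<phi> arbitrary: \<Gamma>) (auto simp: ri ar list_all2_conv_all_nth sub, fastforce)
  have m2: "wf_fm T \<phi> \<Gamma> \<Longrightarrow> wf_fm ?I (map_fm S2 R2 \<phi>) (map S2 \<Gamma>)" for \<phi> \<Gamma>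
    by (induction \<phi> arbitrary: \<Gamma>) (auto simp: ri ar list_all2_conv_all_nth sub, fastforce)
  have w1: "wf_sequent ?I (map_sequent S1 R1 \<sigma>)" if "wf_sequent T \<sigma>" for \<sigma>
    using that by (cases \<sigma>) (auto simp: m1 sub)
  have w2: "wf_sequent ?I (map_sequent S2 R2 \<sigma>)" if "wf_sequent T \<sigma>" for \<sigma>
    using that by (cases \<sigma>) (auto simp: m2 sub)
  have w3: "wf_sequent ?I \<sigma>" if "\<sigma> \<in> bij_axioms X" "X \<in> sorts T" for \<sigma> X
    using that unfolding bij_axioms_def biseq_def by (auto simp: conjs sub) (auto simp: iso_theory_def nth_Cons numeral_eq_Suc split: nat.splits)
  have w4: "wf_sequent ?I \<sigma>" if "\<sigma> \<in> rel_axioms R (arity T R)" "R \<in> rels T" for \<sigma> R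
  proof -
    have "set (arity T R) \<subseteq> sorts T" using assms that by (auto simp: geometric_theory_def)
    then have "S1 ` set (arity T R) \<subseteq> sorts ?I" "S2 ` set (arity T R) \<subseteq> sorts ?I"
      by (auto simp: sub)
    moreover have "arity T R ! i \<in> sorts T" if "i < length (arity T R)" for i
      using that \<open>set (arity T R) \<subseteq> sorts T\<close> by auto
    moreover have "wf_fm ?I (alpha X x y) \<Gamma> \<longleftrightarrow>
        X \<in> sorts T \<and> x < length \<Gamma> \<and> \<Gamma> ! x = S1 X \<and> y < length \<Gamma> \<and> \<Gamma> ! y = S2 X" for X x y \<Gamma>
      by (auto simp: iso_theory_def)
    moreover have "wf_fm ?I (Atom (Sym (R1 R)) [0..<k]) (map S1 (arity T R) @ map S2 (arity T R))"
      "wf_fm ?I (Atom (Sym (R2 R)) [k..<2 * k]) (map S1 (arity T R) @ map S2 (arity T R))"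
      if "k = length (arity T R)" for k
      using that \<open>R \<in> rels T\<close>
      by (auto simp: iso_theory_def list_all2_conv_all_nth nth_append)
    ultimately show ?thesis
      using that unfolding rel_axioms_def biseq_def Let_def
      by (auto simp: conjs nth_append simp del: wf_fm.simps(1))
  qed
  have "wf_sequent ?I \<sigma>" if "\<sigma> \<in> axioms ?I" for \<sigma>
    using that assms by (subst (asm) iso_theory_def) (auto simp: geometric_theory_def intro: w1 w2 w3 w4)
  moreover have "set (arity ?I R) \<subseteq> sorts ?I" if "R \<in> rels ?I" for R
    using that assms by (fastforce simp: iso_theory_def geometric_theory_def)
  ultimately show ?thesis by (simp add: geometric_theory_def)
qed


section \<open>Universal property of the presented frame\<close>

definition subset_order :: "'a set set \<Rightarrow> 'a set gorder" where
  "subset_order C = \<lparr>carrier = C, eq = (=), le = (\<subseteq>)\<rparr>"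

lemma subset_order:
  assumes M: "\<forall>U\<in>C. U \<subseteq> M" and Int: "\<forall>A\<subseteq>C. M \<inter> \<Inter>A \<in> C"
  defines "L \<equiv> subset_order C"
  shows "complete_lattice L" and "\<top>\<^bsub>L\<^esub> = M"
    and "A \<subseteq> C \<Longrightarrow> \<Sqinter>\<^bsub>L\<^esub>A = M \<inter> \<Inter>A"
    and "A \<subseteq> C \<Longrightarrow> \<Squnion>\<^bsub>L\<^esub>A = \<Inter>{U \<in> C. \<Union>A \<subseteq> U}"
    and "U \<in> C \<Longrightarrow> V \<in> C \<Longrightarrow> U \<sqinter>\<^bsub>L\<^esub> V = U \<inter> V"
proof -
  interpret partial_order L
    by unfold_locales (auto simp: L_def subset_order_def)
  have MC: "M \<in> C" using Int[rule_format, of "{}"] by simp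
  have g: "greatest L (M \<inter> \<Inter>A) (Lower L A)" if "A \<subseteq> C" for A
  proof -
    have "Lower L A = {U \<in> C. U \<subseteq> M \<inter> \<Inter>A}"
      using that M by (simp add: Lower_def L_def subset_order_def) blast
    then show ?thesis
      using Int[rule_format, OF that] by (simp add: greatest_def L_def subset_order_def)
  qed
  have l: "least L (\<Inter>{U \<in> C. \<Union>A \<subseteq> U}) (Upper L A)" if "A \<subseteq> C" for A
  proof -
    let ?S = "{U \<in> C. \<Union>A \<subseteq> U}"
    have "M \<in> ?S" using MC M that by blast
    then have eq: "M \<inter> \<Inter>?S = \<Inter>?S" by blast
    have "?S \<subseteq> C" by blast
    then have "\<Inter>?S \<in> C" using Int[rule_format, of ?S] unfolding eq by blast
    moreover have "Upper L A = ?S"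
      using that by (auto simp: Upper_def L_def subset_order_def)
    ultimately show ?thesis
      by (auto simp: least_def L_def subset_order_def)
  qed
  show "complete_lattice L"
    using g l by unfold_locales (auto simp: L_def subset_order_def)
  show inf: "\<Sqinter>\<^bsub>L\<^esub>A = M \<inter> \<Inter>A" if "A \<subseteq> C" for A
    unfolding inf_def using g[OF that] by (metis (mono_tags, lifting) greatest_unique someI_ex)
  show "\<Squnion>\<^bsub>L\<^esub>A = \<Inter>{U \<in> C. \<Union>A \<subseteq> U}" if "A \<subseteq> C"
    unfolding sup_def using l[OF that] by (metis (mono_tags, lifting) least_unique someI_ex)
  have "greatest L M (carrier L)"
    using MC M by (auto simp: greatest_def L_def subset_order_def)
  then show "\<top>\<^bsub>L\<^esub> = M"
    unfolding top_def by (metis (mono_tags, lifting) greatest_unique someI_ex)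
  show "U \<sqinter>\<^bsub>L\<^esub> V = U \<inter> V" if "U \<in> C" "V \<in> C"
  proof -
    have "M \<inter> \<Inter>{U, V} = U \<inter> V" using that M by blast
    then show ?thesis unfolding meet_def using inf[of "{U, V}"] that by simp
  qed
qed


lemma carrier_subset_order [simp]: "carrier (subset_order C) = C"
  and le_subset_order [simp]: "U \<sqsubseteq>\<^bsub>subset_order C\<^esub> V \<longleftrightarrow> U \<subseteq> V"
  by (simp_all add: subset_order_def)

lemma free_frame:
  fixes G :: "'p set"
  defines "L \<equiv> free_frame G"
  shows "U \<in> carrier L \<longleftrightarrow> U \<subseteq> Fpow G \<and> (\<forall>F\<in>U. \<forall>F'\<in>Fpow G. F \<subseteq> F' \<longrightarrow> F' \<in> U)"
    and "U \<sqsubseteq>\<^bsub>L\<^esub> V \<longleftrightarrow> U \<subseteq> V"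
    and "\<top>\<^bsub>L\<^esub> = Fpow G"
    and "U \<in> carrier L \<Longrightarrow> V \<in> carrier L \<Longrightarrow> U \<sqinter>\<^bsub>L\<^esub> V = U \<inter> V"
    and "A \<subseteq> carrier L \<Longrightarrow> \<Squnion>\<^bsub>L\<^esub>A = \<Union>A"
    and "U \<in> carrier L \<Longrightarrow> V \<in> carrier L \<Longrightarrow> U \<inter> V \<in> carrier L"
    and "A \<subseteq> carrier L \<Longrightarrow> \<Union>A \<in> carrier L"
    and "Fpow G \<in> carrier L"
    and "free_gen G p \<in> carrier L"
proof -
  let ?C = "carrier L"
  have L: "L = subset_order ?C"
    by (simp add: L_def free_frame_def subset_order_def)
  show C: "U \<in> ?C \<longleftrightarrow> U \<subseteq> Fpow G \<and> (\<forall>F\<in>U. \<forall>F'\<in>Fpow G. F \<subseteq> F' \<longrightarrow> F' \<in> U)" for U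
    by (simp add: L_def free_frame_def)
  show "U \<sqsubseteq>\<^bsub>L\<^esub> V \<longleftrightarrow> U \<subseteq> V" by (subst L) simp
  have M: "\<forall>U\<in>?C. U \<subseteq> Fpow G" using C by blast
  have Int: "\<forall>A\<subseteq>?C. Fpow G \<inter> \<Inter>A \<in> ?C"
    unfolding C subset_iff[of _ ?C] by blast
  note so = subset_order[of ?C "Fpow G", OF M Int, folded L]
  show "\<top>\<^bsub>L\<^esub> = Fpow G" "U \<in> ?C \<Longrightarrow> V \<in> ?C \<Longrightarrow> U \<sqinter>\<^bsub>L\<^esub> V = U \<inter> V"
    by (rule so; assumption)+
  show un: "\<Union>A \<in> ?C" if "A \<subseteq> ?C" for A
    using that unfolding C subset_iff[of _ ?C] by blast
  show "\<Squnion>\<^bsub>L\<^esub>A = \<Union>A" if "A \<subseteq> ?C"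
    using so(4)[OF that] un[OF that] by blast
  show "U \<in> ?C \<Longrightarrow> V \<in> ?C \<Longrightarrow> U \<inter> V \<in> ?C" "Fpow G \<in> ?C" "free_gen G p \<in> ?C"
    unfolding C by (auto simp: free_gen_def)
qed

lemma eval_free_closed:
  assumes "wf_fm T \<phi> \<Gamma>" "sorts T = {}"
  shows "eval (free_frame (rels T)) (free_gen (rels T)) \<phi> \<in> carrier (free_frame (rels T))"
  using assms(1)
proof (induction \<phi> arbitrary: \<Gamma>)
  case (Atom R xs)
  then show ?case using assms(2) by (cases R) (auto simp: free_frame(9))
next
  case (Disj I f)
  then have "(\<lambda>i. eval (free_frame (rels T)) (free_gen (rels T)) (f i)) ` I \<subseteq> carrier (free_frame (rels T))"
    by auto
  then show ?case by (simp add: free_frame(5,7))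
qed (use assms(2) in \<open>auto simp: free_frame(3,4,6,8)\<close>)

locale propositional_theory =
  fixes T :: "('s, 'p, 'i) geo_theory"
  assumes propositional: "propositional T"
begin

definition F :: "'p set set gorder" where "F = free_frame (rels T)"
definition F' :: "'p set set set" where "F' = carrier F"
definition E :: "('s, 'p, 'i) fm \<Rightarrow> 'p set set" where "E = eval F (free_gen (rels T))"
definition S :: "'p set set set" where "S = carrier (classifying_frame T)"

lemma E_closed: "E \<phi> \<in> F'" "E \<psi> \<in> F'" if "(\<phi> \<turnstile>\<^bsub>\<Gamma>\<^esub> \<psi>) \<in> axioms T"
proof -
  have "wf_sequent T (\<phi> \<turnstile>\<^bsub>\<Gamma>\<^esub> \<psi>)" "sorts T = {}"
    using propositional that unfolding propositional_def geometric_theory_def by blast+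
  then show "E \<phi> \<in> F'" "E \<psi> \<in> F'"
    unfolding F_def F'_def E_def by (auto intro: eval_free_closed)
qed

lemma S_iff: "U \<in> S \<longleftrightarrow> U \<in> F' \<and>
    (\<forall>\<phi> \<Gamma> \<psi>. (\<phi> \<turnstile>\<^bsub>\<Gamma>\<^esub> \<psi>) \<in> axioms T \<longrightarrow> (\<forall>W\<in>F'. W \<inter> E \<psi> \<subseteq> U \<longrightarrow> W \<inter> E \<phi> \<subseteq> U))"
proof -
  have "(W \<sqinter>\<^bsub>F\<^esub> E \<psi> \<sqsubseteq>\<^bsub>F\<^esub> U \<longrightarrow> W \<sqinter>\<^bsub>F\<^esub> E \<phi> \<sqsubseteq>\<^bsub>F\<^esub> U) \<longleftrightarrow> (W \<inter> E \<psi> \<subseteq> U \<longrightarrow> W \<inter> E \<phi> \<subseteq> U)"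
    if "(\<phi> \<turnstile>\<^bsub>\<Gamma>\<^esub> \<psi>) \<in> axioms T" "W \<in> F'" for W \<phi> \<Gamma> \<psi>
    using E_closed[OF that(1)] that(2) by (simp add: free_frame(2,4) F_def F'_def)
  then have "(\<forall>W\<in>F'. W \<sqinter>\<^bsub>F\<^esub> E \<psi> \<sqsubseteq>\<^bsub>F\<^esub> U \<longrightarrow> W \<sqinter>\<^bsub>F\<^esub> E \<phi> \<sqsubseteq>\<^bsub>F\<^esub> U) \<longleftrightarrow>
      (\<forall>W\<in>F'. W \<inter> E \<psi> \<subseteq> U \<longrightarrow> W \<inter> E \<phi> \<subseteq> U)"
    if "(\<phi> \<turnstile>\<^bsub>\<Gamma>\<^esub> \<psi>) \<in> axioms T" for \<phi> \<Gamma> \<psi>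
    using that by (intro ball_cong) auto
  note eq = this
  have "U \<in> S \<longleftrightarrow> U \<in> F' \<and> (\<forall>\<phi> \<Gamma> \<psi>. (\<phi> \<turnstile>\<^bsub>\<Gamma>\<^esub> \<psi>) \<in> axioms T \<longrightarrow>
      (\<forall>W\<in>F'. W \<sqinter>\<^bsub>F\<^esub> E \<psi> \<sqsubseteq>\<^bsub>F\<^esub> U \<longrightarrow> W \<sqinter>\<^bsub>F\<^esub> E \<phi> \<sqsubseteq>\<^bsub>F\<^esub> U))"
    by (simp add: S_def classifying_frame_def Let_def F_def E_def F'_def)
  then show ?thesis by (simp only: eq cong: imp_cong)
qed

lemma classifying_frame_order: "classifying_frame T = subset_order S"
  by (simp add: S_def classifying_frame_def subset_order_def Let_def)

lemma S_sub: "U \<in> S \<Longrightarrow> U \<in> F'"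
  by (simp add: S_iff)

lemma F'_sub: "U \<in> F' \<Longrightarrow> U \<subseteq> Fpow (rels T)"
  by (simp add: F'_def F_def free_frame(1))

lemma S_Inter: "A \<subseteq> S \<Longrightarrow> Fpow (rels T) \<inter> \<Inter>A \<in> S"
proof -
  assume A: "A \<subseteq> S"
  then have A': "A \<subseteq> F'" using S_sub by blast
  have "Fpow (rels T) \<inter> \<Inter>A \<in> F'"
    using A' unfolding F'_def F_def subset_iff[of A] free_frame(1) by blast
  moreover have "W \<inter> E \<phi> \<subseteq> Fpow (rels T) \<inter> \<Inter>A"
    if "(\<phi> \<turnstile>\<^bsub>\<Gamma>\<^esub> \<psi>) \<in> axioms T" "W \<in> F'" "W \<inter> E \<psi> \<subseteq> Fpow (rels T) \<inter> \<Inter>A" for \<phi> \<Gamma> \<psi> W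
  proof -
    have "W \<inter> E \<phi> \<subseteq> U" if "U \<in> A" for U
    proof -
      have "U \<in> S" "W \<inter> E \<psi> \<subseteq> U" using A that \<open>W \<inter> E \<psi> \<subseteq> _\<close> by blast+
      then show ?thesis
        using \<open>(\<phi> \<turnstile>\<^bsub>\<Gamma>\<^esub> \<psi>) \<in> axioms T\<close> \<open>W \<in> F'\<close> unfolding S_iff by blast
    qed
    then show ?thesis using F'_sub[OF that(2)] by blast
  qed
  ultimately show ?thesis unfolding S_iff by blast
qed

lemma S_closure: "\<forall>U\<in>S. U \<subseteq> Fpow (rels T)" "\<forall>A\<subseteq>S. Fpow (rels T) \<inter> \<Inter>A \<in> S"
  using F'_sub S_sub S_Inter by blast+

lemmas so = subset_order[OF S_closure, folded classifying_frame_order]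

definition nuc :: "'p set set \<Rightarrow> 'p set set" where
  "nuc U = \<Inter>{V \<in> S. U \<subseteq> V}"

lemma nuc_closed: "U \<in> F' \<Longrightarrow> nuc U \<in> S"
proof -
  assume "U \<in> F'"
  then have "Fpow (rels T) \<in> {V \<in> S. U \<subseteq> V}"
    using S_Inter[of "{}"] F'_sub by auto
  then have "Fpow (rels T) \<inter> \<Inter>{V \<in> S. U \<subseteq> V} = nuc U"
    unfolding nuc_def by blast
  then show ?thesis using S_Inter[of "{V \<in> S. U \<subseteq> V}"] by auto
qed

lemma nuc_least: "U \<subseteq> nuc U" "V \<in> S \<Longrightarrow> nuc U \<subseteq> V \<longleftrightarrow> U \<subseteq> V"
  unfolding nuc_def by blast+

lemma nuc_id: "U \<in> S \<Longrightarrow> nuc U = U"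
  by (intro subset_antisym nuc_least(1)) (simp add: nuc_least(2))

lemma S_Sup: "A \<subseteq> S \<Longrightarrow> \<Squnion>\<^bsub>classifying_frame T\<^esub>A = nuc (\<Union>A)"
  by (simp add: so(4) nuc_def)

lemma gen_nuc: "p \<in> rels T \<Longrightarrow> gen T p = nuc (free_gen (rels T) p)"
proof -
  assume p: "p \<in> rels T"
  have "{p} \<in> U \<longleftrightarrow> free_gen (rels T) p \<subseteq> U" if "U \<in> S" for U
  proof -
    have up: "X' \<in> U" if "X \<in> U" "X' \<in> Fpow (rels T)" "X \<subseteq> X'" for X X'
      using S_sub[OF \<open>U \<in> S\<close>] that unfolding F'_def F_def free_frame(1) by blast
    show ?thesis
    proof
      assume "{p} \<in> U"
      then show "free_gen (rels T) p \<subseteq> U" by (auto simp: free_gen_def intro: up)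
    next
      assume "free_gen (rels T) p \<subseteq> U"
      moreover have "{p} \<in> free_gen (rels T) p" using p by (simp add: free_gen_def Fpow_def)
      ultimately show "{p} \<in> U" by blast
    qed
  qed
  then show ?thesis
    unfolding gen_def nuc_def S_def[symmetric] by (intro arg_cong[where f = Inter]) auto
qed

definition imp :: "'p set set \<Rightarrow> 'p set set \<Rightarrow> 'p set set" where
  "imp U V = {X \<in> Fpow (rels T). \<forall>Y\<in>U. X \<subseteq> Y \<longrightarrow> Y \<in> V}"

lemma imp_adj: "U \<in> F' \<Longrightarrow> W \<in> F' \<Longrightarrow> W \<subseteq> imp U V \<longleftrightarrow> W \<inter> U \<subseteq> V"
proof -
  assume U: "U \<in> F'" and W: "W \<in> F'"
  have "Y \<in> V" if "W \<subseteq> imp U V" "Y \<in> W" "Y \<in> U" for Y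
    using that unfolding imp_def by blast
  moreover have "X \<in> imp U V" if "W \<inter> U \<subseteq> V" "X \<in> W" for X
  proof -
    have "X \<in> Fpow (rels T)" using F'_sub[OF W] that(2) by blast
    moreover have "Y \<in> V" if "Y \<in> U" "X \<subseteq> Y" for Y
    proof -
      have "Y \<in> Fpow (rels T)" using F'_sub[OF U] that(1) by blast
      then have "Y \<in> W"
        using W \<open>X \<in> W\<close> that(2) unfolding F'_def F_def free_frame(1) by blast
      then show ?thesis using \<open>W \<inter> U \<subseteq> V\<close> that(1) by blast
    qed
    ultimately show ?thesis unfolding imp_def by blast
  qed
  ultimately show "W \<subseteq> imp U V \<longleftrightarrow> W \<inter> U \<subseteq> V" by blast
qed

lemma imp_closed: "U \<in> F' \<Longrightarrow> V \<in> S \<Longrightarrow> imp U V \<in> S"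
proof -
  assume U: "U \<in> F'" and V: "V \<in> S"
  have "imp U V \<in> F'"
    unfolding imp_def F'_def F_def free_frame(1) by blast
  moreover have "W \<inter> E \<phi> \<subseteq> imp U V"
    if a: "(\<phi> \<turnstile>\<^bsub>\<Gamma>\<^esub> \<psi>) \<in> axioms T" and W: "W \<in> F'" and s: "W \<inter> E \<psi> \<subseteq> imp U V" for \<phi> \<Gamma> \<psi> W
  proof -
    have Int: "A \<inter> B \<in> F'" if "A \<in> F'" "B \<in> F'" for A B
      using that by (simp add: F'_def F_def free_frame(6))
    have "(W \<inter> U) \<inter> E \<psi> \<subseteq> V"
      using s imp_adj[OF U Int[OF W E_closed(2)[OF a]]] by blast
    then have "(W \<inter> U) \<inter> E \<phi> \<subseteq> V"
      using V a Int[OF W U] unfolding S_iff by blast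
    then show ?thesis
      using imp_adj[OF U Int[OF W E_closed(1)[OF a]]] by blast
  qed
  ultimately show ?thesis unfolding S_iff by blast
qed

lemma nuc_Int_sub: "U \<in> F' \<Longrightarrow> V \<in> F' \<Longrightarrow> nuc V \<inter> U \<subseteq> nuc (V \<inter> U)"
proof -
  assume U: "U \<in> F'" and V: "V \<in> F'"
  have VU: "V \<inter> U \<in> F'" using U V by (simp add: F'_def F_def free_frame(6))
  have "V \<subseteq> imp U (nuc (V \<inter> U))"
    using imp_adj[OF U V] nuc_least(1) by blast
  then have "nuc V \<subseteq> imp U (nuc (V \<inter> U))"
    using imp_closed[OF U nuc_closed[OF VU]] nuc_least(2) by blast
  then show ?thesis
    using imp_adj[OF U S_sub[OF nuc_closed[OF V]]] by blast
qed

lemma nuc_Int: "U \<in> F' \<Longrightarrow> V \<in> F' \<Longrightarrow> nuc (V \<inter> U) = nuc V \<inter> nuc U"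
proof
  assume U: "U \<in> F'" and V: "V \<in> F'"
  have VU: "V \<inter> U \<in> F'" and jVU: "nuc V \<inter> U \<in> F'"
    using U V S_sub[OF nuc_closed[OF V]] by (simp_all add: F'_def F_def free_frame(6))
  have "nuc U \<inter> nuc V \<subseteq> nuc (U \<inter> nuc V)"
    using nuc_Int_sub[OF S_sub[OF nuc_closed[OF V]] U] .
  also have "\<dots> \<subseteq> nuc (V \<inter> U)"
    using nuc_Int_sub[OF U V] nuc_least(2)[OF nuc_closed[OF VU]] by (simp add: Int_commute)
  finally show "nuc V \<inter> nuc U \<subseteq> nuc (V \<inter> U)" by (simp add: Int_commute)
  show "nuc (V \<inter> U) \<subseteq> nuc V \<inter> nuc U"
    unfolding nuc_def by blast
qed

lemma frame_classifying_frame: "frame (classifying_frame T)"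
proof -
  interpret complete_lattice "classifying_frame T" by (rule so(1))
  have "U \<sqinter>\<^bsub>classifying_frame T\<^esub> \<Squnion>\<^bsub>classifying_frame T\<^esub>A =
      \<Squnion>\<^bsub>classifying_frame T\<^esub>((\<lambda>V. U \<sqinter>\<^bsub>classifying_frame T\<^esub> V) ` A)"
    if U: "U \<in> S" and A: "A \<subseteq> S" for U A
  proof -
    have Un: "\<Union>A \<in> F'"
      using A S_sub unfolding F'_def F_def by (intro free_frame(7)) blast
    have cl: "U \<inter> V \<in> S" if "V \<in> S" for V
    proof -
      have "Fpow (rels T) \<inter> \<Inter>{U, V} = U \<inter> V" using F'_sub[OF S_sub[OF U]] by blast
      then show ?thesis using S_Inter[of "{U, V}"] U that by simp
    qed
    have eq: "(\<lambda>V. U \<sqinter>\<^bsub>classifying_frame T\<^esub> V) ` A = (\<lambda>V. U \<inter> V) ` A"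
      using so(5)[OF U] A by (intro image_cong) auto
    have "U \<inter> nuc (\<Union>A) = nuc (U \<inter> \<Union>A)"
      using nuc_Int[OF Un S_sub[OF U]] nuc_id[OF U] by simp
    also have "\<dots> = \<Squnion>\<^bsub>classifying_frame T\<^esub>((\<lambda>V. U \<inter> V) ` A)"
      using A cl by (subst S_Sup) (auto simp: Int_UN_distrib)
    finally show ?thesis
      unfolding eq S_Sup[OF A] so(5)[OF U nuc_closed[OF Un]] .
  qed
  then show ?thesis
    by unfold_locales (simp add: S_def)
qed


lemma Inf_gen: "finite X \<Longrightarrow> X \<subseteq> rels T \<Longrightarrow>
    \<Sqinter>\<^bsub>classifying_frame T\<^esub>(gen T ` X) = nuc {Y \<in> Fpow (rels T). X \<subseteq> Y}"
proof (induction X rule: finite_induct)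
  case empty
  have "Fpow (rels T) \<in> S" using S_Inter[of "{}"] by simp
  then show ?case using nuc_id by (simp add: so(3))
next
  case (insert p X)
  have cl: "{Y \<in> Fpow (rels T). X \<subseteq> Y} \<in> F'" "free_gen (rels T) p \<in> F'"
    by (auto simp: F'_def F_def free_frame(1) free_gen_def)
  have sub: "gen T ` X \<subseteq> S" "gen T p \<in> S"
    using insert.prems nuc_closed by (auto simp: gen_nuc F'_def F_def free_frame(9))
  then have "\<Sqinter>\<^bsub>classifying_frame T\<^esub>(gen T ` insert p X) = gen T p \<inter> \<Sqinter>\<^bsub>classifying_frame T\<^esub>(gen T ` X)"
    by (simp add: so(3)) blast
  also have "\<dots> = nuc (free_gen (rels T) p) \<inter> nuc {Y \<in> Fpow (rels T). X \<subseteq> Y}"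
    using insert by (simp add: gen_nuc)
  also have "\<dots> = nuc (free_gen (rels T) p \<inter> {Y \<in> Fpow (rels T). X \<subseteq> Y})"
    using nuc_Int[OF cl] by simp
  also have "free_gen (rels T) p \<inter> {Y \<in> Fpow (rels T). X \<subseteq> Y} = {Y \<in> Fpow (rels T). insert p X \<subseteq> Y}"
    by (auto simp: free_gen_def)
  finally show ?case .
qed

lemma induced_hom_gen: "U \<in> S \<Longrightarrow> induced_hom (classifying_frame T) (gen T) U = U"
proof -
  assume U: "U \<in> S"
  have I: "\<Sqinter>\<^bsub>classifying_frame T\<^esub>(gen T ` X) = nuc {Y \<in> Fpow (rels T). X \<subseteq> Y}" if "X \<in> U" for X
    using F'_sub[OF S_sub[OF U]] that by (intro Inf_gen) (auto simp: Fpow_def)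
  have up: "nuc {Y \<in> Fpow (rels T). X \<subseteq> Y} \<subseteq> U" if "X \<in> U" for X
    unfolding nuc_least(2)[OF U] using S_sub[OF U] that unfolding F'_def F_def free_frame(1) by blast
  have "nuc {Y \<in> Fpow (rels T). X \<subseteq> Y} \<in> S" if "X \<in> U" for X
    by (intro nuc_closed) (auto simp: F'_def F_def free_frame(1))
  then have "induced_hom (classifying_frame T) (gen T) U = nuc (\<Union>X\<in>U. nuc {Y \<in> Fpow (rels T). X \<subseteq> Y})"
    unfolding induced_hom_def by (simp add: I S_Sup image_subset_iff cong: image_cong)
  also have "(\<Union>X\<in>U. nuc {Y \<in> Fpow (rels T). X \<subseteq> Y}) = U"
  proof
    show "(\<Union>X\<in>U. nuc {Y \<in> Fpow (rels T). X \<subseteq> Y}) \<subseteq> U"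
      by (intro UN_least up)
    show "U \<subseteq> (\<Union>X\<in>U. nuc {Y \<in> Fpow (rels T). X \<subseteq> Y})"
    proof
      fix X assume X: "X \<in> U"
      then have "X \<in> {Y \<in> Fpow (rels T). X \<subseteq> Y}" using F'_sub[OF S_sub[OF U]] by blast
      then show "X \<in> (\<Union>X\<in>U. nuc {Y \<in> Fpow (rels T). X \<subseteq> Y})"
        using nuc_least(1)[of "{Y \<in> Fpow (rels T). X \<subseteq> Y}"] X by (intro UN_I) auto
    qed
  qed
  finally show ?thesis using nuc_id[OF U] by simp
qed

lemma gen_closed: "p \<in> rels T \<Longrightarrow> gen T p \<in> S"
  by (simp add: gen_nuc nuc_closed F'_def F_def free_frame(9))

lemma eval_gen:
  assumes "wf_fm T \<phi> \<Gamma>"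
  shows "eval (classifying_frame T) (gen T) \<phi> = nuc (E \<phi>)"
  using assms
proof (induction \<phi> arbitrary: \<Gamma>)
  case (Atom R xs)
  then show ?case using propositional
    by (cases R) (auto simp: gen_nuc E_def propositional_def)
next
  case Top
  have "Fpow (rels T) \<in> S" using S_Inter[of "{}"] by simp
  then show ?case using nuc_id by (simp add: so(2) E_def F_def free_frame(3))
next
  case (And \<phi> \<psi>)
  have cl: "E \<phi> \<in> F'" "E \<psi> \<in> F'"
    using And.prems propositional unfolding E_def F'_def F_def propositional_def
    by (auto intro: eval_free_closed)
  then have "E (And \<phi> \<psi>) = E \<phi> \<inter> E \<psi>"
    by (simp add: E_def F'_def F_def free_frame(4))
  then show ?case
    using And.IH[of \<Gamma>] And.prems
    by (simp add: so(5)[OF nuc_closed[OF cl(1)] nuc_closed[OF cl(2)]] nuc_Int cl)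
next
  case (Disj I f)
  have cl: "E (f i) \<in> F'" if "i \<in> I" for i
    using Disj.prems that propositional unfolding E_def F'_def F_def propositional_def
    by (auto intro: eval_free_closed)
  have IH: "eval (classifying_frame T) (gen T) (f i) = nuc (E (f i))" if "i \<in> I" for i
    using Disj.IH[OF rangeI, of i \<Gamma>] Disj.prems that by simp
  have ED: "E (Disj I f) = (\<Union>i\<in>I. E (f i))"
    using cl by (simp add: E_def F'_def F_def free_frame(5) image_subset_iff)
  have UF: "(\<Union>i\<in>I. E (f i)) \<in> F'"
    using cl unfolding F'_def F_def by (intro free_frame(7)) auto
  have "eval (classifying_frame T) (gen T) (Disj I f) = nuc (\<Union>i\<in>I. nuc (E (f i)))"
    using cl nuc_closed by (simp add: IH S_Sup image_subset_iff cong: image_cong)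
  also have "\<dots> = nuc (\<Union>i\<in>I. E (f i))"
  proof
    have "nuc (E (f i)) \<subseteq> nuc (\<Union>i\<in>I. E (f i))" if "i \<in> I" for i
      unfolding nuc_least(2)[OF nuc_closed[OF UF]]
      using that nuc_least(1)[of "\<Union>i\<in>I. E (f i)"] by blast
    then show "nuc (\<Union>i\<in>I. nuc (E (f i))) \<subseteq> nuc (\<Union>i\<in>I. E (f i))"
      by (simp add: nuc_least(2)[OF nuc_closed[OF UF]] UN_subset_iff)
    have "(\<Union>i\<in>I. E (f i)) \<subseteq> (\<Union>i\<in>I. nuc (E (f i)))"
      by (intro UN_mono subset_refl nuc_least(1))
    then show "nuc (\<Union>i\<in>I. E (f i)) \<subseteq> nuc (\<Union>i\<in>I. nuc (E (f i)))"
      unfolding nuc_def by blast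
  qed
  finally show ?case using ED by simp
next
  case (Exists X \<phi>)
  then show ?case using propositional by (simp add: propositional_def)
qed

lemma model_gen: "model T (classifying_frame T) (gen T)"
  unfolding model_def
proof (intro conjI allI impI)
  show "gen T ` rels T \<subseteq> carrier (classifying_frame T)"
    using gen_closed by (auto simp: S_def)
  fix \<phi> \<Gamma> \<psi> assume a: "(\<phi> \<turnstile>\<^bsub>\<Gamma>\<^esub> \<psi>) \<in> axioms T"
  then have wf: "wf_fm T \<phi> \<Gamma>" "wf_fm T \<psi> \<Gamma>"
    using propositional by (auto simp: propositional_def geometric_theory_def)
  note E = E_closed[OF a]
  have "E \<psi> \<inter> E \<psi> \<subseteq> nuc (E \<psi>)" using nuc_least(1) by simp
  have top: "Fpow (rels T) \<in> F'" by (simp add: F'_def F_def free_frame(8))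
  have "Fpow (rels T) \<inter> E \<psi> \<subseteq> nuc (E \<psi>)" using nuc_least(1) by blast
  then have "Fpow (rels T) \<inter> E \<phi> \<subseteq> nuc (E \<psi>)"
    using nuc_closed[OF E(2)] a top unfolding S_iff by blast
  then have "E \<phi> \<subseteq> nuc (E \<psi>)" using F'_sub[OF E(1)] by blast
  then have "nuc (E \<phi>) \<subseteq> nuc (E \<psi>)" using nuc_least(2)[OF nuc_closed[OF E(2)]] by simp
  then show "eval (classifying_frame T) (gen T) \<phi> \<sqsubseteq>\<^bsub>classifying_frame T\<^esub> eval (classifying_frame T) (gen T) \<psi>"
    unfolding eval_gen[OF wf(1)] eval_gen[OF wf(2)] by (simp add: classifying_frame_order)
qed

end


locale frame_model = propositional_theory T + frame L
  for T :: "('s, 'p, 'i) geo_theory" and L :: "('a, 'c) gorder_scheme" (structure) and v :: "'p \<Rightarrow> 'a" +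
  assumes model: "model T L v"
begin

definition m :: "'p set \<Rightarrow> 'a" where "m X = \<Sqinter>(v ` X)"
abbreviation h :: "'p set set \<Rightarrow> 'a" where "h \<equiv> induced_hom L v"

lemma v_closed: "p \<in> rels T \<Longrightarrow> v p \<in> carrier L"
  using model by (auto simp: model_def)

lemma v_image: "X \<in> Fpow (rels T) \<Longrightarrow> v ` X \<subseteq> carrier L"
  by (auto simp: Fpow_def intro: v_closed)

lemma m_closed: "X \<in> Fpow (rels T) \<Longrightarrow> m X \<in> carrier L"
  by (simp add: m_def v_image)

lemma m_le: "X \<in> Fpow (rels T) \<Longrightarrow> p \<in> X \<Longrightarrow> m X \<sqsubseteq> v p"
  unfolding m_def by (rule inf_lower) (auto dest: v_image)

lemma m_greatest:
  "X \<in> Fpow (rels T) \<Longrightarrow> a \<in> carrier L \<Longrightarrow> (\<And>p. p \<in> X \<Longrightarrow> a \<sqsubseteq> v p) \<Longrightarrow> a \<sqsubseteq> m X"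
  unfolding m_def by (rule inf_greatest) (auto dest: v_image)

lemma m_mono: "X \<subseteq> Y \<Longrightarrow> Y \<in> Fpow (rels T) \<Longrightarrow> X \<in> Fpow (rels T) \<Longrightarrow> m Y \<sqsubseteq> m X"
  by (rule m_greatest) (auto intro: m_closed m_le)

lemma m_image: "U \<in> F' \<Longrightarrow> m ` U \<subseteq> carrier L"
  using F'_sub m_closed by auto

lemma h_eq: "h U = \<Squnion>(m ` U)"
  by (simp add: induced_hom_def m_def)

lemma h_closed: "U \<in> F' \<Longrightarrow> h U \<in> carrier L"
  unfolding h_eq by (rule sup_closed) (rule m_image)

lemma h_upper: "U \<in> F' \<Longrightarrow> X \<in> U \<Longrightarrow> m X \<sqsubseteq> h U"
  unfolding h_eq by (rule sup_upper) (auto dest: m_image)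

lemma h_least: "U \<in> F' \<Longrightarrow> a \<in> carrier L \<Longrightarrow> (\<And>X. X \<in> U \<Longrightarrow> m X \<sqsubseteq> a) \<Longrightarrow> h U \<sqsubseteq> a"
  unfolding h_eq by (rule sup_least) (auto dest: m_image)

lemma h_mono: "U \<in> F' \<Longrightarrow> V \<in> F' \<Longrightarrow> U \<subseteq> V \<Longrightarrow> h U \<sqsubseteq> h V"
  by (rule h_least) (auto intro: h_closed h_upper)

lemma Int_closed: "U \<in> F' \<Longrightarrow> V \<in> F' \<Longrightarrow> U \<inter> V \<in> F'"
  by (simp add: F'_def F_def free_frame(6))

lemma Un_closed: "A \<subseteq> F' \<Longrightarrow> \<Union>A \<in> F'"
  by (simp add: F'_def F_def free_frame(7))

lemma h_Un: "A \<subseteq> F' \<Longrightarrow> h (\<Union>A) = \<Squnion>(h ` A)"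
proof -
  assume A: "A \<subseteq> F'"
  have hA: "h ` A \<subseteq> carrier L" using A h_closed by auto
  show ?thesis
  proof (rule le_antisym)
    show "h (\<Union>A) \<sqsubseteq> \<Squnion>(h ` A)"
    proof (rule h_least[OF Un_closed[OF A]])
      fix X assume "X \<in> \<Union>A"
      then obtain U where U: "U \<in> A" "X \<in> U" by blast
      then have "U \<in> F'" using A by blast
      have "X \<in> Fpow (rels T)" using F'_sub[OF \<open>U \<in> F'\<close>] U by blast
      then show "m X \<sqsubseteq> \<Squnion>(h ` A)"
        using le_trans[OF h_upper[OF \<open>U \<in> F'\<close> U(2)] sup_upper[OF hA imageI[OF U(1)]]]
          m_closed h_closed[OF \<open>U \<in> F'\<close>] hA by simp
    qed (simp add: hA)
    show "\<Squnion>(h ` A) \<sqsubseteq> h (\<Union>A)"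
    proof (rule sup_least[OF hA])
      fix a assume "a \<in> h ` A"
      then obtain U where U: "U \<in> A" "a = h U" by blast
      then show "a \<sqsubseteq> h (\<Union>A)" using A h_mono[OF _ Un_closed[OF A], of U] by blast
    qed (rule h_closed[OF Un_closed[OF A]])
  qed (use hA h_closed[OF Un_closed[OF A]] in simp_all)
qed

lemma Inf2: "x \<in> carrier L \<Longrightarrow> y \<in> carrier L \<Longrightarrow> x \<sqinter> y \<in> carrier L \<and> x \<sqinter> y \<sqsubseteq> x \<and> x \<sqinter> y \<sqsubseteq> y"
  unfolding meet_def by (auto intro!: inf_closed inf_lower)

lemma Inf2_greatest:
  "x \<in> carrier L \<Longrightarrow> y \<in> carrier L \<Longrightarrow> z \<in> carrier L \<Longrightarrow> z \<sqsubseteq> x \<Longrightarrow> z \<sqsubseteq> y \<Longrightarrow> z \<sqsubseteq> x \<sqinter> y"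
  unfolding meet_def by (auto intro!: inf_greatest)

lemma meet_comm: "x \<sqinter> y = y \<sqinter> x"
  by (simp add: meet_def insert_commute)

lemma h_Int: "U \<in> F' \<Longrightarrow> V \<in> F' \<Longrightarrow> h (U \<inter> V) = h U \<sqinter> h V"
proof -
  assume U: "U \<in> F'" and V: "V \<in> F'"
  note UV = Int_closed[OF U V]
  have cl: "h U \<in> carrier L" "h V \<in> carrier L" "h (U \<inter> V) \<in> carrier L"
    by (simp_all add: h_closed U V UV)
  have mm: "m X \<sqinter> m Y \<sqsubseteq> h (U \<inter> V)" if X: "X \<in> U" and Y: "Y \<in> V" for X Y
  proof -
    have XY: "X \<in> Fpow (rels T)" "Y \<in> Fpow (rels T)"
      using F'_sub[OF U] F'_sub[OF V] X Y by blast+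
    then have un: "X \<union> Y \<in> Fpow (rels T)" by (auto simp: Fpow_def)
    have "X \<union> Y \<in> U" using U X un unfolding F'_def F_def free_frame(1) by blast
    moreover have "X \<union> Y \<in> V" using V Y un unfolding F'_def F_def free_frame(1) by blast
    ultimately have "m (X \<union> Y) \<sqsubseteq> h (U \<inter> V)" by (intro h_upper UV) simp
    moreover have "m X \<sqinter> m Y \<sqsubseteq> m (X \<union> Y)"
    proof (rule m_greatest[OF un])
      note i = Inf2[OF m_closed[OF XY(1)] m_closed[OF XY(2)]]
      show "m X \<sqinter> m Y \<in> carrier L" using i by simp
      fix p assume p: "p \<in> X \<union> Y"
      then have "p \<in> rels T" using un by (auto simp: Fpow_def)
      then show "m X \<sqinter> m Y \<sqsubseteq> v p"
        using p i m_le[OF XY(1)] m_le[OF XY(2)] m_closed[OF XY(1)] m_closed[OF XY(2)] v_closed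
        by (metis UnE le_trans)
    qed
    ultimately show ?thesis
      using Inf2[OF m_closed[OF XY(1)] m_closed[OF XY(2)]] m_closed[OF un] cl(3) le_trans by blast
  qed
  have mh: "h V \<sqinter> m X \<sqsubseteq> h (U \<inter> V)" if X: "X \<in> U" for X
  proof -
    have mX: "m X \<in> carrier L" using F'_sub[OF U] X m_closed by blast
    have "h V \<sqinter> m X = \<Squnion>((\<lambda>a. m X \<sqinter> a) ` m ` V)"
      unfolding h_eq using meet_Sup_distrib[OF mX m_image[OF V]] by (simp add: meet_comm)
    also have "\<dots> \<sqsubseteq> h (U \<inter> V)"
    proof (rule sup_least)
      show "(\<lambda>a. m X \<sqinter> a) ` m ` V \<subseteq> carrier L" using m_image[OF V] Inf2[OF mX] by blast
    qed (use mm X cl in auto)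
    finally show ?thesis .
  qed
  have "h U \<sqinter> h V = \<Squnion>((\<lambda>a. h V \<sqinter> a) ` m ` U)"
    using meet_Sup_distrib[OF cl(2) m_image[OF U]] by (simp add: meet_comm h_eq[of U])
  also have "\<dots> \<sqsubseteq> h (U \<inter> V)"
  proof (rule sup_least)
    show "(\<lambda>a. h V \<sqinter> a) ` m ` U \<subseteq> carrier L" using m_image[OF U] Inf2[OF cl(2)] by blast
  qed (use mh cl in auto)
  finally have le: "h U \<sqinter> h V \<sqsubseteq> h (U \<inter> V)" .
  have "h (U \<inter> V) \<sqsubseteq> h U \<sqinter> h V"
    by (rule Inf2_greatest) (auto intro: cl h_mono U V UV)
  then show ?thesis using le cl Inf2[OF cl(1,2)] by (auto intro: le_antisym)
qed

lemma h_top: "h (Fpow (rels T)) = \<top>"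
proof -
  have F: "Fpow (rels T) \<in> F'" by (simp add: F'_def F_def free_frame(8))
  have e: "{} \<in> Fpow (rels T)" by (simp add: Fpow_def)
  have "\<top> \<sqsubseteq> m {}" by (rule m_greatest[OF e]) auto
  then have "\<top> \<sqsubseteq> h (Fpow (rels T))"
    using h_upper[OF F e] h_closed[OF F] m_closed[OF e] le_trans top_closed by blast
  then show ?thesis using h_closed[OF F] by (auto intro: le_antisym)
qed

lemma h_free_gen: "p \<in> rels T \<Longrightarrow> h (free_gen (rels T) p) = v p"
proof -
  assume p: "p \<in> rels T"
  have F: "free_gen (rels T) p \<in> F'" by (simp add: F'_def F_def free_frame(9))
  have P: "{p} \<in> Fpow (rels T)" "{p} \<in> free_gen (rels T) p" using p by (auto simp: Fpow_def free_gen_def)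
  have "v p \<sqsubseteq> m {p}" by (rule m_greatest) (use p P v_closed in auto)
  then have "v p \<sqsubseteq> h (free_gen (rels T) p)"
    using h_upper[OF F P(2)] h_closed[OF F] m_closed[OF P(1)] v_closed[OF p] le_trans by blast
  moreover have "h (free_gen (rels T) p) \<sqsubseteq> v p"
    by (rule h_least[OF F v_closed[OF p]]) (auto simp: free_gen_def intro: m_le)
  ultimately show ?thesis using h_closed[OF F] v_closed[OF p] by (auto intro: le_antisym)
qed

lemma h_E: "wf_fm T \<phi> \<Gamma> \<Longrightarrow> h (E \<phi>) = eval L v \<phi>"
proof (induction \<phi> arbitrary: \<Gamma>)
  case (Atom R xs)
  then show ?case using propositional
    by (cases R) (auto simp: h_free_gen E_def propositional_def)
next
  case Top
  then show ?case by (simp add: E_def F_def free_frame(3) h_top)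
next
  case (And \<phi> \<psi>)
  have cl: "E \<phi> \<in> F'" "E \<psi> \<in> F'"
    using And.prems propositional unfolding E_def F'_def F_def propositional_def
    by (auto intro: eval_free_closed)
  then have "E (And \<phi> \<psi>) = E \<phi> \<inter> E \<psi>"
    by (simp add: E_def F'_def F_def free_frame(4))
  then show ?case using And.IH[of \<Gamma>] And.prems by (simp add: h_Int cl)
next
  case (Disj I f)
  have cl: "E (f i) \<in> F'" if "i \<in> I" for i
    using Disj.prems that propositional unfolding E_def F'_def F_def propositional_def
    by (auto intro: eval_free_closed)
  have IH: "h (E (f i)) = eval L v (f i)" if "i \<in> I" for i
    using Disj.IH[OF rangeI, of i \<Gamma>] Disj.prems that by simp
  have "E (Disj I f) = \<Union>((\<lambda>i. E (f i)) ` I)"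
    using cl by (simp add: E_def F'_def F_def free_frame(5) image_subset_iff)
  moreover have "h (\<Union>((\<lambda>i. E (f i)) ` I)) = \<Squnion>(h ` (\<lambda>i. E (f i)) ` I)"
    using cl by (intro h_Un) auto
  ultimately show ?case using IH by (simp add: image_image cong: image_cong)
next
  case (Exists X \<phi>)
  then show ?case using propositional by (simp add: propositional_def)
qed

lemma adj_closed: "a \<in> carrier L \<Longrightarrow> {X \<in> Fpow (rels T). m X \<sqsubseteq> a} \<in> S"
proof -
  assume a: "a \<in> carrier L"
  let ?W = "{X \<in> Fpow (rels T). m X \<sqsubseteq> a}"
  have iff: "U \<subseteq> ?W \<longleftrightarrow> h U \<sqsubseteq> a" if U: "U \<in> F'" for U
  proof
    assume "U \<subseteq> ?W"
    then show "h U \<sqsubseteq> a" by (intro h_least[OF U a]) auto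
  next
    assume hU: "h U \<sqsubseteq> a"
    show "U \<subseteq> ?W"
    proof
      fix X assume X: "X \<in> U"
      then have X': "X \<in> Fpow (rels T)" using F'_sub[OF U] by blast
      then show "X \<in> ?W"
        using le_trans[OF h_upper[OF U X] hU m_closed[OF X'] h_closed[OF U] a] by simp
    qed
  qed
  have "?W \<in> F'"
    unfolding F'_def F_def free_frame(1)
  proof (intro conjI ballI impI)
    fix X Y assume X: "X \<in> ?W" and Y: "Y \<in> Fpow (rels T)" "X \<subseteq> Y"
    then have X': "X \<in> Fpow (rels T)" by simp
    show "Y \<in> ?W"
      using X Y le_trans[OF m_mono[OF Y(2,1) X'] _ m_closed[OF Y(1)] m_closed[OF X'] a] by simp
  qed auto
  moreover have "W \<inter> E \<phi> \<subseteq> ?W"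
    if ax: "(\<phi> \<turnstile>\<^bsub>\<Gamma>\<^esub> \<psi>) \<in> axioms T" and W: "W \<in> F'" and s: "W \<inter> E \<psi> \<subseteq> ?W" for \<phi> \<Gamma> \<psi> W
  proof -
    have wf: "wf_fm T \<phi> \<Gamma>" "wf_fm T \<psi> \<Gamma>"
      using propositional ax by (auto simp: propositional_def geometric_theory_def)
    note E = E_closed[OF ax]
    have le: "h (E \<phi>) \<sqsubseteq> h (E \<psi>)"
      using model ax h_E[OF wf(1)] h_E[OF wf(2)] by (simp add: model_def)
    note c = h_closed[OF W] h_closed[OF E(1)] h_closed[OF E(2)]
    have "h W \<sqinter> h (E \<phi>) \<sqsubseteq> h W \<sqinter> h (E \<psi>)"
      using Inf2[OF c(1,2)] le c by (intro Inf2_greatest) (auto intro: le_trans)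
    also have "\<dots> \<sqsubseteq> a"
      using s iff[OF Int_closed[OF W E(2)]] by (simp add: h_Int[OF W E(2)])
    finally have "h (W \<inter> E \<phi>) \<sqsubseteq> a"
      using a Inf2[OF c(1,2)] Inf2[OF c(1,3)] by (simp add: h_Int[OF W E(1)])
    then show ?thesis using iff[OF Int_closed[OF W E(1)]] by simp
  qed
  ultimately show ?thesis unfolding S_iff by blast
qed

lemma h_nuc: "U \<in> F' \<Longrightarrow> h (nuc U) = h U"
proof -
  assume U: "U \<in> F'"
  note n = S_sub[OF nuc_closed[OF U]]
  have "U \<subseteq> {X \<in> Fpow (rels T). m X \<sqsubseteq> h U}"
    using F'_sub[OF U] h_upper[OF U] by blast
  then have "nuc U \<subseteq> {X \<in> Fpow (rels T). m X \<sqsubseteq> h U}"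
    by (simp only: nuc_least(2)[OF adj_closed[OF h_closed[OF U]]])
  then have "h (nuc U) \<sqsubseteq> h U"
    by (intro h_least[OF n h_closed[OF U]]) auto
  then show ?thesis
    using h_mono[OF U n nuc_least(1)] h_closed[OF U] h_closed[OF n] by (auto intro: le_antisym)
qed

lemma frame_hom_induced: "frame_hom (classifying_frame T) L h"
  unfolding frame_hom_def S_def[symmetric]
proof (intro conjI ballI allI impI)
  show "h \<in> S \<rightarrow> carrier L" using h_closed S_sub by blast
  show "h \<top>\<^bsub>classifying_frame T\<^esub> = \<top>" by (simp add: so(2) h_top)
  show "h (U \<sqinter>\<^bsub>classifying_frame T\<^esub> V) = h U \<sqinter> h V" if "U \<in> S" "V \<in> S" for U V
    using that by (simp add: so(5) h_Int S_sub)
  show "h (\<Squnion>\<^bsub>classifying_frame T\<^esub>A) = \<Squnion>(h ` A)" if "A \<subseteq> S" for A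
  proof -
    have "A \<subseteq> F'" using that S_sub by blast
    then show ?thesis by (simp add: S_Sup[OF that] h_nuc Un_closed h_Un)
  qed
qed

lemma induced_gen: "p \<in> rels T \<Longrightarrow> h (gen T p) = v p"
  by (simp add: gen_nuc h_nuc h_free_gen F'_def F_def free_frame(9))

lemma induced_unique:
  assumes g: "frame_hom (classifying_frame T) L g" "\<And>p. p \<in> rels T \<Longrightarrow> g (gen T p) = v p"
    and U: "U \<in> carrier (classifying_frame T)"
  shows "g U = h U"
proof -
  have U': "U \<in> S" using U by (simp add: S_def)
  have cl: "{Y \<in> Fpow (rels T). X \<subseteq> Y} \<in> F'" for X
    by (auto simp: F'_def F_def free_frame(1))
  have gm: "g (\<Sqinter>\<^bsub>classifying_frame T\<^esub>(gen T ` X)) = m X" if "finite X" "X \<subseteq> rels T" for X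
    using that
  proof (induction X rule: finite_induct)
    case empty
    have "\<top> = m {}"
      using m_greatest[of "{}" "\<top>"] m_closed[of "{}"] by (auto simp: Fpow_def intro: le_antisym)
    then show ?case using g(1) by (simp add: so(2,3) frame_hom_def)
  next
    case (insert p X)
    have "gen T ` X \<subseteq> S" "gen T p \<in> S" using insert.prems gen_closed by auto
    moreover have iS: "\<Sqinter>\<^bsub>classifying_frame T\<^esub>(gen T ` X) \<in> S"
      using insert by (simp add: Inf_gen nuc_closed cl)
    ultimately have "\<Sqinter>\<^bsub>classifying_frame T\<^esub>(gen T ` insert p X) =
        gen T p \<sqinter>\<^bsub>classifying_frame T\<^esub> \<Sqinter>\<^bsub>classifying_frame T\<^esub>(gen T ` X)"
      by (simp add: so(5)) (simp add: so(3), blast)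
    then have "g (\<Sqinter>\<^bsub>classifying_frame T\<^esub>(gen T ` insert p X)) = v p \<sqinter> m X"
      using g iS \<open>gen T p \<in> S\<close> insert unfolding frame_hom_def S_def[symmetric] by simp
    also have "v p \<sqinter> m X = m (insert p X)"
    proof (rule le_antisym)
      have F: "X \<in> Fpow (rels T)" "insert p X \<in> Fpow (rels T)" "p \<in> rels T"
        using insert by (auto simp: Fpow_def)
      note i = Inf2[OF v_closed[OF F(3)] m_closed[OF F(1)]]
      show "v p \<sqinter> m X \<sqsubseteq> m (insert p X)"
      proof (rule m_greatest[OF F(2)])
        fix q assume "q \<in> insert p X"
        then consider "q = p" | "q \<in> X" by blast
        then show "v p \<sqinter> m X \<sqsubseteq> v q"
        proof cases
          case 2
          then have "q \<in> rels T" using insert by auto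
          then show ?thesis using i le_trans[OF _ m_le[OF F(1) 2]] m_closed[OF F(1)] v_closed by blast
        qed (use i in simp)
      qed (use i in simp)
      show "m (insert p X) \<sqsubseteq> v p \<sqinter> m X"
        by (rule Inf2_greatest) (auto intro: v_closed m_closed m_le m_mono F)
      show "v p \<sqinter> m X \<in> carrier L" "m (insert p X) \<in> carrier L"
        using i m_closed[OF F(2)] by auto
    qed
    finally show ?case .
  qed
  have X: "finite X \<and> X \<subseteq> rels T" if "X \<in> U" for X
    using F'_sub[OF S_sub[OF U']] that by (auto simp: Fpow_def)
  have "(\<lambda>X. \<Sqinter>\<^bsub>classifying_frame T\<^esub>(gen T ` X)) ` U \<subseteq> S"
    using X by (auto simp: Inf_gen nuc_closed cl)
  then have "g (\<Squnion>\<^bsub>classifying_frame T\<^esub>((\<lambda>X. \<Sqinter>\<^bsub>classifying_frame T\<^esub>(gen T ` X)) ` U)) = \<Squnion>(m ` U)"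
    using g(1) gm X unfolding frame_hom_def S_def[symmetric] by (simp add: image_image cong: image_cong)
  then show ?thesis
    using induced_hom_gen[OF U'] by (simp add: induced_hom_def h_eq[symmetric])
qed

end


section \<open>The source map is a frame homomorphism with the prescribed values on generators\<close>

lemma eval_ground_map:
  "eval L v (ground (map_fm f g \<phi>) ns) = eval L (\<lambda>(R, ns). v (map_grel f g R, ns)) (ground \<phi> ns)"
proof (induction \<phi> arbitrary: ns)
  case (Disj I h)
  have "eval L v (ground (map_fm f g (h i)) ns) =
      eval L (\<lambda>(R, ns). v (map_grel f g R, ns)) (ground (h i) ns)" for i
    using Disj.IH[OF rangeI] .
  then show ?case by (simp add: image_image)
next
  case (Exists X \<phi>)
  then show ?case by (simp add: image_image)
qed simp_all

lemma eval_sims_map: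
  "eval L v (sims (map f Xs) ns ms :: (_, _, 'j) fm) =
   eval L (\<lambda>(R, ns). v (map_grel f g R, ns)) (sims Xs ns ms :: (_, _, 'j) fm)"
proof (induction Xs arbitrary: ns ms)
  case (Cons X Xs)
  then show ?case
    by (cases ns; cases ms) (simp_all add: sims_def conjs_def)
qed (simp add: sims_def conjs_def)

lemma model_source:
  assumes T: "geometric_theory T"
  shows "model (prop_theory T) (OG1 T) (\<lambda>(R, ns). gen1 T (map_grel S1 R1 R) ns)"
proof -
  let ?P = "prop_theory (iso_theory T)"
  let ?v = "\<lambda>(R, ns). gen ?P (map_grel S1 R1 R, ns)"
  interpret P: propositional_theory ?P
    by unfold_locales (rule geometric_prop_theory[OF geometric_iso_theory[OF T]])
  have m: "model ?P (OG1 T) (gen ?P)" unfolding OG1_def by (rule P.model_gen)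
  have ar: "rel_arity (iso_theory T) (map_grel S1 R1 R) = map S1 (rel_arity T R)" for R
    by (cases R; simp add: iso_theory_def)
  have ri: "rel_in T R \<Longrightarrow> rel_in (iso_theory T) (map_grel S1 R1 R)" for R
    by (cases R; auto simp: iso_theory_def)
  have "?v ` rels (prop_theory T) \<subseteq> carrier (OG1 T)"
  proof
    fix x assume "x \<in> ?v ` rels (prop_theory T)"
    then obtain R ns where x: "x = gen ?P (map_grel S1 R1 R, ns)"
      and R: "rel_in T R" "length ns = length (rel_arity T R)"
      by (auto simp: prop_theory_def)
    have "(map_grel S1 R1 R, ns) \<in> rels ?P"
      using R ar ri by (simp add: prop_theory_def)
    then show "x \<in> carrier (OG1 T)" using m x by (auto simp: model_def)
  qed
  moreover have "eval (OG1 T) ?v \<phi> \<sqsubseteq>\<^bsub>OG1 T\<^esub> eval (OG1 T) ?v \<psi>"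
    if ax: "(\<phi> \<turnstile>\<^bsub>\<Gamma>\<^esub> \<psi>) \<in> axioms (prop_theory T)" for \<phi> \<Gamma> \<psi>
  proof -
    have *: "eval (OG1 T) (gen ?P) \<phi>' \<sqsubseteq>\<^bsub>OG1 T\<^esub> eval (OG1 T) (gen ?P) \<psi>'"
      if "(\<phi>' \<turnstile>\<^bsub>[]\<^esub> \<psi>') \<in> axioms ?P" for \<phi>' \<psi>'
      using m that by (auto simp: model_def)
    note g = eval_ground_map[of _ "gen ?P" S1 R1] eval_sims_map[of _ "gen ?P" S1 _ _ _ R1]
    consider
      (sym) X n m where "\<phi> = bp (Eq X) [n, m]" "\<psi> = bp (Eq X) [m, n]" "X \<in> sorts T"
    | (trans) X n m l where "\<phi> = And (bp (Eq X) [n, m]) (bp (Eq X) [m, l])" "\<psi> = bp (Eq X) [n, l]"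
        "X \<in> sorts T"
    | (cong) R ns ms where "\<phi> = And (bp (Sym R) ns) (sims (arity T R) ns ms)" "\<psi> = bp (Sym R) ms"
        "R \<in> rels T" "length ns = length (arity T R)" "length ms = length (arity T R)"
    | (strict) R ns where "\<phi> = bp (Sym R) ns" "\<psi> = sims (arity T R) ns ns"
        "R \<in> rels T" "length ns = length (arity T R)"
    | (axm) \<alpha> \<Delta> \<beta> ns where "\<phi> = And (sims \<Delta> ns ns) (ground \<alpha> ns)" "\<psi> = ground \<beta> ns"
        "(\<alpha> \<turnstile>\<^bsub>\<Delta>\<^esub> \<beta>) \<in> axioms T" "length ns = length \<Delta>"
      using ax by (subst (asm) prop_theory_def) auto
    then show ?thesis
    proof cases
      case (sym X n m)
      have "S1 X \<in> sorts (iso_theory T)" using sym by (simp add: iso_theory_def)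
      then have "(bp (Eq (S1 X)) [n, m] \<turnstile>\<^bsub>[]\<^esub> bp (Eq (S1 X)) [m, n]) \<in> axioms ?P"
        by (auto simp: prop_theory_def)
      from *[OF this] show ?thesis using sym by simp
    next
      case (trans X n m l)
      have "S1 X \<in> sorts (iso_theory T)" using trans by (simp add: iso_theory_def)
      then have "(And (bp (Eq (S1 X)) [n, m]) (bp (Eq (S1 X)) [m, l]) \<turnstile>\<^bsub>[]\<^esub> bp (Eq (S1 X)) [n, l])
          \<in> axioms ?P"
        by (auto simp: prop_theory_def)
      from *[OF this] show ?thesis using trans by simp
    next
      case (cong R ns ms)
      have R: "R1 R \<in> rels (iso_theory T)" "arity (iso_theory T) (R1 R) = map S1 (arity T R)"
        using cong by (simp_all add: iso_theory_def)
      then have "(And (bp (Sym (R1 R)) ns) (sims (arity (iso_theory T) (R1 R)) ns ms) \<turnstile>\<^bsub>[]\<^esub>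
          bp (Sym (R1 R)) ms) \<in> axioms ?P"
        using cong by (auto simp: prop_theory_def)
      from *[OF this] show ?thesis using cong R by (simp add: g)
    next
      case (strict R ns)
      have R: "R1 R \<in> rels (iso_theory T)" "arity (iso_theory T) (R1 R) = map S1 (arity T R)"
        using strict by (simp_all add: iso_theory_def)
      then have "(bp (Sym (R1 R)) ns \<turnstile>\<^bsub>[]\<^esub> sims (arity (iso_theory T) (R1 R)) ns ns) \<in> axioms ?P"
        using strict by (auto simp: prop_theory_def)
      from *[OF this] show ?thesis using strict R by (simp add: g)
    next
      case (axm \<alpha> \<Delta> \<beta> ns)
      have "map_sequent S1 R1 (\<alpha> \<turnstile>\<^bsub>\<Delta>\<^esub> \<beta>) \<in> axioms (iso_theory T)"
        using axm(3) by (simp add: iso_theory_def imageI del: sequent.map)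
      then have a: "(map_fm S1 R1 \<alpha> \<turnstile>\<^bsub>map S1 \<Delta>\<^esub> map_fm S1 R1 \<beta>) \<in> axioms (iso_theory T)"
        by simp
      have "(And (sims (map S1 \<Delta>) ns ns) (ground (map_fm S1 R1 \<alpha>) ns) \<turnstile>\<^bsub>[]\<^esub>
          ground (map_fm S1 R1 \<beta>) ns) \<in> axioms ?P"
        unfolding prop_theory_def using a axm(4) by (auto intro!: exI)
      from *[OF this] show ?thesis using axm by (simp add: g)
    qed
  qed
  ultimately show ?thesis unfolding model_def gen1_def by blast
qed

theorem source_inv:
  assumes T: "geometric_theory T"
  shows frame_OG0: "frame (OG0 T)" and frame_OG1: "frame (OG1 T)"
    and frame_hom_source_inv: "frame_hom (OG0 T) (OG1 T) (source_inv T)"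
    and source_inv_gen: "(R, ns) \<in> rels (prop_theory T) \<Longrightarrow>
          source_inv T (gen0 T R ns) = gen1 T (map_grel S1 R1 R) ns"
proof -
  show f0: "frame (OG0 T)"
    unfolding OG0_def using geometric_prop_theory[OF T]
    by (intro propositional_theory.frame_classifying_frame propositional_theory.intro)
  show f1: "frame (OG1 T)"
    unfolding OG1_def using geometric_prop_theory[OF geometric_iso_theory[OF T]]
    by (intro propositional_theory.frame_classifying_frame propositional_theory.intro)
  interpret frame_model "prop_theory T" "OG1 T" "\<lambda>(R, ns). gen1 T (map_grel S1 R1 R) ns"
    using geometric_prop_theory[OF T] f1 model_source[OF T]
    by (intro frame_model.intro propositional_theory.intro frame_model_axioms.intro)
  show "frame_hom (OG0 T) (OG1 T) (source_inv T)"
    using frame_hom_induced by (simp add: source_inv_def OG0_def)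
  show "source_inv T (gen0 T R ns) = gen1 T (map_grel S1 R1 R) ns" if "(R, ns) \<in> rels (prop_theory T)"
    using induced_gen[OF that] by (simp add: source_inv_def gen0_def)
qed

end

theory Submission
  imports Defs
begin

text \<open>
  A point of \<open>G\<^sub>1\<close> over a model \<open>M\<close> with partially enumerated sorts is a second partially
  enumerated model with an isomorphism to \<open>M\<close>, that is, a second partial enumeration of the same sorts
  of \<open>M\<close>. Every total function \<open>y\<close> that is surjective on names at each sort gives one uniformly in
  \<open>M\<close>: let \<open>n\<close> name whatever \<open>y n\<close> named before. So \<open>y\<close> yields a section \<open>\<sigma>\<^sub>y: G\<^sub>0 \<rightarrow> G\<^sub>1\<close> of the source
  map (\<open>model_iso_theory_relabel\<close>, \<open>section_source\<close>), and the left adjoint is obtained by restricting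
  along all these sections at once: \<open>s\<^sub>! U\<close> is the join of the \<open>\<sigma>\<^sub>y\<^sup>* U\<close> over all \<open>y\<close>.

  As \<open>\<sigma>\<^sub>y\<^sup>* \<circ> s\<^sup>*\<close> is the identity for each \<open>y\<close>, the inequality \<open>s\<^sub>! (s\<^sup>* V) \<le> V\<close> is immediate.
  The inequality \<open>U \<le> s\<^sup>* (s\<^sub>! U)\<close> says that the sections are dense enough. A finite
  meet of generators mentions only finitely many names \<open>d\<close> from the second enumeration. On that open
  each of them denotes an element of the second model, so surjectivity of \<open>\<alpha>\<close> covers the open by pieces
  on which \<open>\<alpha>(y d) = d\<close> for some values \<open>y d\<close> (\<open>cover_by_preimages\<close>); and on such a piece everything
  said about the \<open>d\<close> is already true of the \<open>y d\<close> in the first model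
  (\<open>transport_to_source\<close>). The finitely many values \<open>y d\<close> extend to a surjection
  (\<open>surjections_extend\<close>), because infinitely many names remain unused.

  The formula drops out of the same description: \<open>\<sigma>\<^sub>y\<^sup>*\<close> preserves finite meets and sends
  \<open>[b \<in> R\<^sub>2]\<close> to \<open>[y b \<in> R]\<close> and \<open>[\<alpha>(c) = d]\<close> to \<open>[c \<sim> y d]\<close>, so that on a basic open it depends only on
  the values of \<open>y\<close> at the variables that occur, and these values are arbitrary. Finally, a
  join-preserving map is determined by its values on the basic opens, because they generate under joins.
\<close>

section \<open>Lattices, frames and frame homomorphisms\<close>

context complete_lattice begin

lemma le_meet_iff:
  "x \<in> carrier L \<Longrightarrow> y \<in> carrier L \<Longrightarrow> z \<in> carrier L \<Longrightarrow> z \<sqsubseteq> x \<sqinter> y \<longleftrightarrow> z \<sqsubseteq> x \<and> z \<sqsubseteq> y"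
  by (meson meet_le meet_left meet_right meet_closed le_trans)

lemma le_iff_meet_eq:
  assumes "x \<in> carrier L" "y \<in> carrier L"
  shows "x \<sqsubseteq> y \<longleftrightarrow> x \<sqinter> y = x"
proof
  assume "x \<sqsubseteq> y"
  then show "x \<sqinter> y = x" using assms by (intro le_antisym) (auto simp: le_meet_iff meet_left)
next
  assume "x \<sqinter> y = x"
  then show "x \<sqsubseteq> y" using meet_right[OF assms] by simp
qed

lemma Inf_empty: "\<Sqinter>{} = \<top>"
  by (rule le_antisym) (auto intro: inf_greatest)

lemma Inf_Un:
  assumes "A \<subseteq> carrier L" "B \<subseteq> carrier L"
  shows "\<Sqinter>(A \<union> B) = \<Sqinter>A \<sqinter> \<Sqinter>B"
proof (rule le_antisym)
  show "\<Sqinter>(A \<union> B) \<sqsubseteq> \<Sqinter>A \<sqinter> \<Sqinter>B"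
  proof -
    have "\<Sqinter>(A \<union> B) \<sqsubseteq> \<Sqinter>A" "\<Sqinter>(A \<union> B) \<sqsubseteq> \<Sqinter>B"
      using assms by (auto intro!: inf_greatest intro: inf_lower)
    then show ?thesis using assms by (simp add: le_meet_iff)
  qed
  have le: "\<Sqinter>A \<sqinter> \<Sqinter>B \<sqsubseteq> \<Sqinter>A" "\<Sqinter>A \<sqinter> \<Sqinter>B \<sqsubseteq> \<Sqinter>B"
    using assms by (simp_all add: meet_left meet_right)
  show "\<Sqinter>A \<sqinter> \<Sqinter>B \<sqsubseteq> \<Sqinter>(A \<union> B)"
  proof (rule inf_greatest)
    show "\<Sqinter>A \<sqinter> \<Sqinter>B \<sqsubseteq> x" if x: "x \<in> A \<union> B" for x
    proof (cases "x \<in> A")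
      case True
      then show ?thesis using assms le_trans[OF le(1) inf_lower[OF assms(1) True]] by auto
    next
      case False
      then have "x \<in> B" using x by blast
      then show ?thesis using assms le_trans[OF le(2) inf_lower[OF assms(2)]] by auto
    qed
  qed (use assms in auto)
qed (use assms in auto)

lemma Inf_singleton: "a \<in> carrier L \<Longrightarrow> \<Sqinter>{a} = a"
  by (rule le_antisym) (auto intro: inf_greatest inf_lower)

lemma le_Sup_witness:
  "A \<subseteq> carrier L \<Longrightarrow> a \<in> A \<Longrightarrow> z \<in> carrier L \<Longrightarrow> z \<sqsubseteq> a \<Longrightarrow> z \<sqsubseteq> \<Squnion>A"
  using le_trans[of z a "\<Squnion>A"] sup_upper[of A a] sup_closed[of A] by blast

end

lemma (in frame) le_Sup_cases:
  assumes z: "z \<in> carrier L" "u \<in> carrier L" and A: "A \<subseteq> carrier L" "z \<sqsubseteq> \<Squnion>A"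
    and le: "\<And>a. a \<in> A \<Longrightarrow> z \<sqinter> a \<sqsubseteq> u"
  shows "z \<sqsubseteq> u"
proof -
  have "z = z \<sqinter> \<Squnion>A" using z A le_iff_meet_eq[of z "\<Squnion>A"] by simp
  also have "\<dots> = \<Squnion>((\<lambda>a. z \<sqinter> a) ` A)" using meet_Sup_distrib z A by simp
  also have "\<dots> \<sqsubseteq> u" using z A le by (intro sup_least) auto
  finally show ?thesis .
qed

lemma frame_homD:
  assumes "frame_hom L M h"
  shows frame_hom_closed: "x \<in> carrier L \<Longrightarrow> h x \<in> carrier M"
    and frame_hom_Sup: "A \<subseteq> carrier L \<Longrightarrow> h (\<Squnion>\<^bsub>L\<^esub>A) = \<Squnion>\<^bsub>M\<^esub>(h ` A)"
  using assms by (auto simp: frame_hom_def)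

lemma frame_hom_comp:
  "frame_hom L M h \<Longrightarrow> frame_hom M N k \<Longrightarrow> frame_hom L N (k \<circ> h)"
proof -
  assume h: "frame_hom L M h" and k: "frame_hom M N k"
  have "k (h (\<Squnion>\<^bsub>L\<^esub>A)) = \<Squnion>\<^bsub>N\<^esub>((k \<circ> h) ` A)" if A: "A \<subseteq> carrier L" for A
  proof -
    have "h ` A \<subseteq> carrier M" using A frame_hom_closed[OF h] by blast
    then show ?thesis using frame_hom_Sup[OF h A] frame_hom_Sup[OF k] by (simp add: image_comp)
  qed
  then show ?thesis using h k unfolding frame_hom_def by (auto simp: Pi_iff)
qed

lemma frame_hom_mono:
  assumes "frame_hom L M h" "complete_lattice L" "complete_lattice M"
    and "x \<in> carrier L" "y \<in> carrier L" "x \<sqsubseteq>\<^bsub>L\<^esub> y"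
  shows "h x \<sqsubseteq>\<^bsub>M\<^esub> h y"
proof -
  interpret L: complete_lattice L by fact
  interpret M: complete_lattice M by fact
  have "h (x \<sqinter>\<^bsub>L\<^esub> y) = h x \<sqinter>\<^bsub>M\<^esub> h y" "h x \<in> carrier M" "h y \<in> carrier M"
    using assms by (auto simp: frame_hom_def)
  then show ?thesis using assms(4-) by (metis L.le_iff_meet_eq M.le_iff_meet_eq)
qed

lemma frame_hom_finite_Inf:
  assumes h: "frame_hom L M h" "complete_lattice L" "complete_lattice M"
    and A: "finite A" "A \<subseteq> carrier L"
  shows "h (\<Sqinter>\<^bsub>L\<^esub>A) = \<Sqinter>\<^bsub>M\<^esub>(h ` A)"
proof -
  interpret L: complete_lattice L by fact
  interpret M: complete_lattice M by fact
  show ?thesis using A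
  proof (induction A rule: finite_induct)
    case empty
    then show ?case using h(1) by (simp add: L.Inf_empty M.Inf_empty frame_hom_def)
  next
    case (insert a A)
    then have "\<Sqinter>\<^bsub>L\<^esub>(insert a A) = a \<sqinter>\<^bsub>L\<^esub> \<Sqinter>\<^bsub>L\<^esub>A"
      using L.Inf_Un[of "{a}" A] L.Inf_singleton by simp
    moreover have "\<Sqinter>\<^bsub>M\<^esub>(h ` insert a A) = h a \<sqinter>\<^bsub>M\<^esub> \<Sqinter>\<^bsub>M\<^esub>(h ` A)"
      using insert.prems frame_hom_closed[OF h(1)] M.Inf_Un[of "{h a}" "h ` A"] M.Inf_singleton
      by (simp add: image_subset_iff subset_eq)
    ultimately show ?case
      using insert h(1) unfolding frame_hom_def by simp
  qed
qed

section \<open>Models of the propositional theory, stage by stage\<close>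

lemma in_rels_iff:
  "(R, ns) \<in> rels (prop_theory T) \<longleftrightarrow> rel_in T R \<and> length ns = length (rel_arity T R)"
  by (simp add: prop_theory_def)

lemma prop_theory_axioms:
  shows "X \<in> sorts T \<Longrightarrow> (bp (Eq X) [n, m] \<turnstile>\<^bsub>[]\<^esub> bp (Eq X) [m, n]) \<in> axioms (prop_theory T)"
    and "X \<in> sorts T \<Longrightarrow>
      (And (bp (Eq X) [n, m]) (bp (Eq X) [m, l]) \<turnstile>\<^bsub>[]\<^esub> bp (Eq X) [n, l]) \<in> axioms (prop_theory T)"
    and "R \<in> rels T \<Longrightarrow> length ns = length (arity T R) \<Longrightarrow> length ms = length (arity T R) \<Longrightarrow>
      (And (bp (Sym R) ns) (sims (arity T R) ns ms) \<turnstile>\<^bsub>[]\<^esub> bp (Sym R) ms) \<in> axioms (prop_theory T)"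
    and "R \<in> rels T \<Longrightarrow> length ns = length (arity T R) \<Longrightarrow>
      (bp (Sym R) ns \<turnstile>\<^bsub>[]\<^esub> sims (arity T R) ns ns) \<in> axioms (prop_theory T)"
    and "(\<phi> \<turnstile>\<^bsub>\<Gamma>\<^esub> \<psi>) \<in> axioms T \<Longrightarrow> length ns = length \<Gamma> \<Longrightarrow>
      (And (sims \<Gamma> ns ns) (ground \<phi> ns) \<turnstile>\<^bsub>[]\<^esub> ground \<psi> ns) \<in> axioms (prop_theory T)"
  unfolding prop_theory_def by auto

text \<open>
  What it means that the propositions which hold at the stage \<open>z\<close>, namely those \<open>p\<close> with
  \<open>z \<sqsubseteq> v p\<close>, satisfy the axioms of the propositional theory. Working with a fixed lower bound \<open>z\<close> turns
  inequalities between meets into plain deductions. Equality is treated like any other relation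
  symbol in the conditions of congruence and strictness; transitivity is then a case of congruence.
\<close>

definition models_below :: "('s, 'r, 'g) geo_theory \<Rightarrow> ('a, 'c) gorder_scheme \<Rightarrow>
    (('s, 'r) bprop \<Rightarrow> 'a) \<Rightarrow> 'a \<Rightarrow> bool" where
  "models_below T L v z \<longleftrightarrow>
    (\<forall>X n m. X \<in> sorts T \<longrightarrow> z \<sqsubseteq>\<^bsub>L\<^esub> v (Eq X, [n, m]) \<longrightarrow> z \<sqsubseteq>\<^bsub>L\<^esub> v (Eq X, [m, n])) \<and>
    (\<forall>R ns ms. rel_in T R \<longrightarrow> length ns = length (rel_arity T R) \<longrightarrow> length ms = length ns \<longrightarrow>
       z \<sqsubseteq>\<^bsub>L\<^esub> v (R, ns) \<longrightarrow> (\<forall>i<length ns. z \<sqsubseteq>\<^bsub>L\<^esub> v (Eq (rel_arity T R ! i), [ns ! i, ms ! i])) \<longrightarrow>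
       z \<sqsubseteq>\<^bsub>L\<^esub> v (R, ms)) \<and>
    (\<forall>R ns i. rel_in T R \<longrightarrow> length ns = length (rel_arity T R) \<longrightarrow> z \<sqsubseteq>\<^bsub>L\<^esub> v (R, ns) \<longrightarrow>
       i < length ns \<longrightarrow> z \<sqsubseteq>\<^bsub>L\<^esub> v (Eq (rel_arity T R ! i), [ns ! i, ns ! i])) \<and>
    (\<forall>\<phi> \<Gamma> \<psi> ns. (\<phi> \<turnstile>\<^bsub>\<Gamma>\<^esub> \<psi>) \<in> axioms T \<longrightarrow> length ns = length \<Gamma> \<longrightarrow>
       (\<forall>i<length ns. z \<sqsubseteq>\<^bsub>L\<^esub> v (Eq (\<Gamma> ! i), [ns ! i, ns ! i])) \<longrightarrow>
       z \<sqsubseteq>\<^bsub>L\<^esub> eval L v (ground \<phi> ns) \<longrightarrow> z \<sqsubseteq>\<^bsub>L\<^esub> eval L v (ground \<psi> ns))"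

lemma models_belowI:
  assumes "\<And>X n m. X \<in> sorts T \<Longrightarrow> z \<sqsubseteq>\<^bsub>L\<^esub> v (Eq X, [n, m]) \<Longrightarrow> z \<sqsubseteq>\<^bsub>L\<^esub> v (Eq X, [m, n])"
    and "\<And>R ns ms. rel_in T R \<Longrightarrow> length ns = length (rel_arity T R) \<Longrightarrow> length ms = length ns \<Longrightarrow>
       z \<sqsubseteq>\<^bsub>L\<^esub> v (R, ns) \<Longrightarrow> \<forall>i<length ns. z \<sqsubseteq>\<^bsub>L\<^esub> v (Eq (rel_arity T R ! i), [ns ! i, ms ! i]) \<Longrightarrow>
       z \<sqsubseteq>\<^bsub>L\<^esub> v (R, ms)"
    and "\<And>R ns i. rel_in T R \<Longrightarrow> length ns = length (rel_arity T R) \<Longrightarrow> z \<sqsubseteq>\<^bsub>L\<^esub> v (R, ns) \<Longrightarrow>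
       i < length ns \<Longrightarrow> z \<sqsubseteq>\<^bsub>L\<^esub> v (Eq (rel_arity T R ! i), [ns ! i, ns ! i])"
    and "\<And>\<phi> \<Gamma> \<psi> ns. (\<phi> \<turnstile>\<^bsub>\<Gamma>\<^esub> \<psi>) \<in> axioms T \<Longrightarrow> length ns = length \<Gamma> \<Longrightarrow>
       \<forall>i<length ns. z \<sqsubseteq>\<^bsub>L\<^esub> v (Eq (\<Gamma> ! i), [ns ! i, ns ! i]) \<Longrightarrow>
       z \<sqsubseteq>\<^bsub>L\<^esub> eval L v (ground \<phi> ns) \<Longrightarrow> z \<sqsubseteq>\<^bsub>L\<^esub> eval L v (ground \<psi> ns)"
  shows "models_below T L v z"
  unfolding models_below_def using assms by (intro conjI allI impI) blast+

lemma models_belowD: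
  assumes "models_below T L v z"
  shows models_below_sym:
      "X \<in> sorts T \<Longrightarrow> z \<sqsubseteq>\<^bsub>L\<^esub> v (Eq X, [n, m]) \<Longrightarrow> z \<sqsubseteq>\<^bsub>L\<^esub> v (Eq X, [m, n])"
    and models_below_cong:
      "rel_in T R \<Longrightarrow> length ns = length (rel_arity T R) \<Longrightarrow> length ms = length (rel_arity T R) \<Longrightarrow>
       z \<sqsubseteq>\<^bsub>L\<^esub> v (R, ns) \<Longrightarrow>
       (\<And>i. i < length (rel_arity T R) \<Longrightarrow> z \<sqsubseteq>\<^bsub>L\<^esub> v (Eq (rel_arity T R ! i), [ns ! i, ms ! i])) \<Longrightarrow>
       z \<sqsubseteq>\<^bsub>L\<^esub> v (R, ms)"
    and models_below_strict:
      "rel_in T R \<Longrightarrow> length ns = length (rel_arity T R) \<Longrightarrow> z \<sqsubseteq>\<^bsub>L\<^esub> v (R, ns) \<Longrightarrow>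
       i < length (rel_arity T R) \<Longrightarrow> z \<sqsubseteq>\<^bsub>L\<^esub> v (Eq (rel_arity T R ! i), [ns ! i, ns ! i])"
    and models_below_axiom:
      "(\<phi> \<turnstile>\<^bsub>\<Gamma>\<^esub> \<psi>) \<in> axioms T \<Longrightarrow> length ns = length \<Gamma> \<Longrightarrow>
       (\<And>i. i < length \<Gamma> \<Longrightarrow> z \<sqsubseteq>\<^bsub>L\<^esub> v (Eq (\<Gamma> ! i), [ns ! i, ns ! i])) \<Longrightarrow>
       z \<sqsubseteq>\<^bsub>L\<^esub> eval L v (ground \<phi> ns) \<Longrightarrow> z \<sqsubseteq>\<^bsub>L\<^esub> eval L v (ground \<psi> ns)"
proof -
  note m = assms[unfolded models_below_def]
  show "z \<sqsubseteq>\<^bsub>L\<^esub> v (Eq X, [m, n])" if "X \<in> sorts T" "z \<sqsubseteq>\<^bsub>L\<^esub> v (Eq X, [n, m])"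
    using m[THEN conjunct1] that by blast
  show "z \<sqsubseteq>\<^bsub>L\<^esub> v (R, ms)"
    if "rel_in T R" "length ns = length (rel_arity T R)" "length ms = length (rel_arity T R)"
      "z \<sqsubseteq>\<^bsub>L\<^esub> v (R, ns)"
      "\<And>i. i < length (rel_arity T R) \<Longrightarrow> z \<sqsubseteq>\<^bsub>L\<^esub> v (Eq (rel_arity T R ! i), [ns ! i, ms ! i])"
    using m[THEN conjunct2, THEN conjunct1, rule_format, of R ns ms] that by simp
  show "z \<sqsubseteq>\<^bsub>L\<^esub> v (Eq (rel_arity T R ! i), [ns ! i, ns ! i])"
    if "rel_in T R" "length ns = length (rel_arity T R)" "z \<sqsubseteq>\<^bsub>L\<^esub> v (R, ns)" "i < length (rel_arity T R)"
    using m[THEN conjunct2, THEN conjunct2, THEN conjunct1, rule_format, of R ns i] that by simp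
  show "z \<sqsubseteq>\<^bsub>L\<^esub> eval L v (ground \<psi> ns)"
    if "(\<phi> \<turnstile>\<^bsub>\<Gamma>\<^esub> \<psi>) \<in> axioms T" "length ns = length \<Gamma>"
      "\<And>i. i < length \<Gamma> \<Longrightarrow> z \<sqsubseteq>\<^bsub>L\<^esub> v (Eq (\<Gamma> ! i), [ns ! i, ns ! i])" "z \<sqsubseteq>\<^bsub>L\<^esub> eval L v (ground \<phi> ns)"
    using m[THEN conjunct2, THEN conjunct2, THEN conjunct2, rule_format, of \<phi> \<Gamma> \<psi> ns] that by simp
qed

lemma models_below_trans:
  assumes "models_below T L v z" "X \<in> sorts T"
    and "z \<sqsubseteq>\<^bsub>L\<^esub> v (Eq X, [n, m])" "z \<sqsubseteq>\<^bsub>L\<^esub> v (Eq X, [m, l])"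
  shows "z \<sqsubseteq>\<^bsub>L\<^esub> v (Eq X, [n, l])"
proof (rule models_below_cong[OF assms(1), of "Eq X" "[n, m]"])
  fix i assume "i < length (rel_arity T (Eq X))"
  then show "z \<sqsubseteq>\<^bsub>L\<^esub> v (Eq (rel_arity T (Eq X) ! i), [[n, m] ! i, [n, l] ! i])"
    using assms models_below_strict[OF assms(1), of "Eq X" "[n, m]" 0] by (auto simp: less_Suc_eq)
qed (use assms in auto)

context complete_lattice begin

lemma le_eval_conjs_iff:
  assumes "\<And>\<phi>. \<phi> \<in> set \<phi>s \<Longrightarrow> eval L v \<phi> \<in> carrier L"
  shows "eval L v (conjs \<phi>s) \<in> carrier L"
    and "z \<in> carrier L \<Longrightarrow> z \<sqsubseteq> eval L v (conjs \<phi>s) \<longleftrightarrow> (\<forall>\<phi>\<in>set \<phi>s. z \<sqsubseteq> eval L v \<phi>)"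
proof -
  have "eval L v (conjs \<phi>s) \<in> carrier L \<and>
      (z \<in> carrier L \<longrightarrow> (z \<sqsubseteq> eval L v (conjs \<phi>s) \<longleftrightarrow> (\<forall>\<phi>\<in>set \<phi>s. z \<sqsubseteq> eval L v \<phi>)))"
    using assms by (induction \<phi>s) (auto simp: conjs_def le_meet_iff)
  then show "eval L v (conjs \<phi>s) \<in> carrier L"
    "z \<in> carrier L \<Longrightarrow> z \<sqsubseteq> eval L v (conjs \<phi>s) \<longleftrightarrow> (\<forall>\<phi>\<in>set \<phi>s. z \<sqsubseteq> eval L v \<phi>)"
    by blast+
qed

lemma le_eval_sims_iff:
  assumes "length ns = length Xs" "length ms = length Xs"
    and "\<And>i. i < length Xs \<Longrightarrow> v (Eq (Xs ! i), [ns ! i, ms ! i]) \<in> carrier L"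
  shows "eval L v (sims Xs ns ms) \<in> carrier L"
    and "z \<in> carrier L \<Longrightarrow> z \<sqsubseteq> eval L v (sims Xs ns ms) \<longleftrightarrow>
           (\<forall>i<length Xs. z \<sqsubseteq> v (Eq (Xs ! i), [ns ! i, ms ! i]))"
proof -
  have set: "set (zip Xs (zip ns ms)) = (\<lambda>i. (Xs ! i, ns ! i, ms ! i)) ` {..<length Xs}"
    using assms by (auto simp: set_zip)
  show "eval L v (sims Xs ns ms) \<in> carrier L"
    unfolding sims_def using assms(3) by (intro le_eval_conjs_iff) (auto simp: set)
  show "z \<sqsubseteq> eval L v (sims Xs ns ms) \<longleftrightarrow> (\<forall>i<length Xs. z \<sqsubseteq> v (Eq (Xs ! i), [ns ! i, ms ! i]))"
    if "z \<in> carrier L"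
    unfolding sims_def using assms(3) that
    by (subst le_eval_conjs_iff) (auto simp: set)
qed

lemma eval_ground_closed:
  assumes "v ` rels (prop_theory T) \<subseteq> carrier L" and "wf_fm T \<phi> \<Gamma>"
  shows "eval L v (ground \<phi> ns) \<in> carrier L"
  using assms(2)
proof (induction \<phi> arbitrary: ns \<Gamma>)
  case (Atom R xs)
  then have "(R, map (\<lambda>x. ns ! x) xs) \<in> rels (prop_theory T)"
    by (auto simp: prop_theory_def list_all2_lengthD)
  then show ?case using assms(1) by auto
next
  case (Disj I f)
  have "eval L v (ground (f i) ns) \<in> carrier L" if "i \<in> I" for i
    using Disj.IH[OF rangeI] Disj.prems that by auto
  then show ?case by (auto simp: image_image intro!: sup_closed)
next
  case (Exists X \<phi>)
  have "v (Eq X, [n, n]) \<in> carrier L" for n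
    using assms(1) Exists.prems by (auto simp: prop_theory_def image_subset_iff)
  moreover have "eval L v (ground \<phi> (n # ns)) \<in> carrier L" for n
    using Exists.IH Exists.prems by auto
  ultimately show ?case by (auto simp: image_image intro!: sup_closed)
qed auto

text \<open>
  An inequality \<open>a \<sqsubseteq> b\<close> says that \<open>b\<close> holds at every stage where \<open>a\<close> does, so a model is a valuation
  whose stages all satisfy the axioms.
\<close>

lemma model_iff_models_below:
  fixes T :: "('s, 'r, 'g) geo_theory"
  assumes T: "geometric_theory T"
  shows "model (prop_theory T) L v \<longleftrightarrow>
    v ` rels (prop_theory T) \<subseteq> carrier L \<and> (\<forall>z\<in>carrier L. models_below T L v z)"
proof (cases "v ` rels (prop_theory T) \<subseteq> carrier L")
  case True
  have v: "v (R, ns) \<in> carrier L" if "rel_in T R" "length ns = length (rel_arity T R)" for R ns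
    using True that by (auto simp: prop_theory_def image_subset_iff)
  have Eq: "v (Eq X, [n, m]) \<in> carrier L" if "X \<in> sorts T" for X n m
    using v[of "Eq X"] that by simp
  have Sym: "v (Sym R, ns) \<in> carrier L" if "R \<in> rels T" "length ns = length (arity T R)" for R ns
    using v[of "Sym R"] that by simp
  have ar: "arity T R ! i \<in> sorts T" if "R \<in> rels T" "i < length (arity T R)" for R i
    using T that unfolding geometric_theory_def by (meson nth_mem subsetD)
  have ax: "wf_fm T \<phi> \<Gamma>" "wf_fm T \<psi> \<Gamma>" "i < length \<Gamma> \<Longrightarrow> \<Gamma> ! i \<in> sorts T"
    if "(\<phi> \<turnstile>\<^bsub>\<Gamma>\<^esub> \<psi>) \<in> axioms T" for \<phi> \<Gamma> \<psi> i
    using T that unfolding geometric_theory_def by (fastforce)+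
  note ground = eval_ground_closed[OF True]
  have sims: "eval L v (sims Xs ns ms :: (unit, _, 'g + nat) fm) \<in> carrier L"
    "z \<in> carrier L \<Longrightarrow> z \<sqsubseteq> eval L v (sims Xs ns ms :: (unit, _, 'g + nat) fm) \<longleftrightarrow>
       (\<forall>i<length Xs. z \<sqsubseteq> v (Eq (Xs ! i), [ns ! i, ms ! i]))"
    if "length ns = length Xs" "length ms = length Xs" "\<And>i. i < length Xs \<Longrightarrow> Xs ! i \<in> sorts T"
    for Xs ns ms z
    by (rule le_eval_sims_iff; simp add: that Eq)+
  show ?thesis
  proof
    assume "model (prop_theory T) L v"
    then have ax_le: "z \<sqsubseteq> eval L v \<psi>"
      if "(\<phi> \<turnstile>\<^bsub>\<Gamma>\<^esub> \<psi>) \<in> axioms (prop_theory T)" "z \<sqsubseteq> eval L v \<phi>" "z \<in> carrier L"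
        "eval L v \<phi> \<in> carrier L" "eval L v \<psi> \<in> carrier L" for \<phi> \<Gamma> \<psi> z
    proof -
      have "eval L v \<phi> \<sqsubseteq> eval L v \<psi>"
        using \<open>model _ L v\<close> that(1) unfolding model_def by blast
      then show ?thesis using le_trans[OF that(2) _ that(3-5)] by blast
    qed
    note ax_in = prop_theory_axioms[where T = T]
    have "models_below T L v z" if z: "z \<in> carrier L" for z
    proof -
      have sym: "z \<sqsubseteq> v (Eq X, [m, n])" if "X \<in> sorts T" "z \<sqsubseteq> v (Eq X, [n, m])" for X n m
        using ax_le[OF ax_in(1)] that z Eq by simp
      have trans: "z \<sqsubseteq> v (Eq X, [n, l])"
        if "X \<in> sorts T" "z \<sqsubseteq> v (Eq X, [n, m])" "z \<sqsubseteq> v (Eq X, [m, l])" for X n m l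
        using ax_le[OF ax_in(2), of X z n m l] that z Eq by (simp add: le_meet_iff)
      have cong: "z \<sqsubseteq> v (R, ms)"
        if len: "rel_in T R" "length ns = length (rel_arity T R)" "length ms = length ns"
          and that: "z \<sqsubseteq> v (R, ns)" "\<forall>i<length ns. z \<sqsubseteq> v (Eq (rel_arity T R ! i), [ns ! i, ms ! i])" for R ns ms
      proof (cases R)
        case R: (Eq X)
        then obtain n n' m m' where nm: "ns = [n, n']" "ms = [m, m']"
          using len(2,3) R by (auto simp: length_Suc_conv)
        have X: "X \<in> sorts T" using len(1) R by simp
        have f: "z \<sqsubseteq> v (Eq X, [n, n'])" "z \<sqsubseteq> v (Eq X, [n, m])" "z \<sqsubseteq> v (Eq X, [n', m'])"
          using that(1) spec[OF that(2), of 0] spec[OF that(2), of 1] R nm by simp_all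
        show ?thesis using trans[OF X sym[OF X f(2)] trans[OF X f(1,3)]] R nm by simp
      next
        case R: (Sym R')
        then show ?thesis
          using ax_le[OF ax_in(3), of R' ns ms z] len that z Sym sims ar by (simp add: le_meet_iff)
      qed
      have strict: "z \<sqsubseteq> v (Eq (rel_arity T R ! i), [ns ! i, ns ! i])"
        if len: "rel_in T R" "length ns = length (rel_arity T R)" and that: "z \<sqsubseteq> v (R, ns)" "i < length ns"
        for R ns i
      proof (cases R)
        case R: (Eq X)
        then obtain n n' where ns: "ns = [n, n']"
          using len(2) R by (auto simp: length_Suc_conv)
        have X: "X \<in> sorts T" using len(1) R by simp
        have f: "z \<sqsubseteq> v (Eq X, [n, n'])" using that(1) R ns by simp
        show ?thesis
          using trans[OF X f sym[OF X f]] trans[OF X sym[OF X f] f] that(2) R ns by (auto simp: less_Suc_eq)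
      next
        case R: (Sym R')
        then have "z \<sqsubseteq> eval L v (sims (arity T R') ns ns :: (unit, _, 'g + nat) fm)"
          using ax_le[OF ax_in(4), of R' ns z] len that z Sym sims ar by simp
        then show ?thesis using R len that z sims ar by simp
      qed
      have "z \<sqsubseteq> eval L v (ground \<psi> ns)"
        if "(\<phi> \<turnstile>\<^bsub>\<Gamma>\<^esub> \<psi>) \<in> axioms T" "length ns = length \<Gamma>"
          "\<forall>i<length ns. z \<sqsubseteq> v (Eq (\<Gamma> ! i), [ns ! i, ns ! i])" "z \<sqsubseteq> eval L v (ground \<phi> ns)" for \<phi> \<Gamma> \<psi> ns
      proof -
        note g = ground[OF ax(1)[OF that(1)], of ns] ground[OF ax(2)[OF that(1)], of ns]
        show ?thesis
          using ax_le[OF ax_in(5)[OF that(1,2)], of z] that(2-) z g sims[OF that(2,2) ax(3)[OF that(1)]]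
          by (simp add: le_meet_iff)
      qed
      then show ?thesis
        unfolding models_below_def using sym cong strict by blast
    qed
    then show "v ` rels (prop_theory T) \<subseteq> carrier L \<and> (\<forall>z\<in>carrier L. models_below T L v z)"
      using True by blast
  next
    assume "v ` rels (prop_theory T) \<subseteq> carrier L \<and> (\<forall>z\<in>carrier L. models_below T L v z)"
    then have m: "models_below T L v z" if "z \<in> carrier L" for z using that by blast
    have "eval L v \<phi> \<sqsubseteq> eval L v \<psi>" if in_P: "(\<phi> \<turnstile>\<^bsub>\<Gamma>\<^esub> \<psi>) \<in> axioms (prop_theory T)" for \<phi> \<Gamma> \<psi>
    proof -
      consider
        (sym) X n m where "\<phi> = bp (Eq X) [n, m]" "\<psi> = bp (Eq X) [m, n]" "X \<in> sorts T"
      | (trans) X n m l where "\<phi> = And (bp (Eq X) [n, m]) (bp (Eq X) [m, l])" "\<psi> = bp (Eq X) [n, l]"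
          "X \<in> sorts T"
      | (cong) R ns ms where "\<phi> = And (bp (Sym R) ns) (sims (arity T R) ns ms)" "\<psi> = bp (Sym R) ms"
          "R \<in> rels T" "length ns = length (arity T R)" "length ms = length (arity T R)"
      | (strict) R ns where "\<phi> = bp (Sym R) ns" "\<psi> = sims (arity T R) ns ns"
          "R \<in> rels T" "length ns = length (arity T R)"
      | (axm) \<alpha> \<Delta> \<beta> ns where "\<phi> = And (sims \<Delta> ns ns) (ground \<alpha> ns)" "\<psi> = ground \<beta> ns"
          "(\<alpha> \<turnstile>\<^bsub>\<Delta>\<^esub> \<beta>) \<in> axioms T" "length ns = length \<Delta>"
        using in_P by (subst (asm) prop_theory_def) auto
      then show ?thesis
      proof cases
        case (sym X n m)
        then show ?thesis
          using Eq[of X n m] models_below_sym[OF m, of "v (Eq X, [n, m])" X n m] by simp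
      next
        case (trans X n m l)
        define z where "z = v (Eq X, [n, m]) \<sqinter> v (Eq X, [m, l])"
        have z: "z \<in> carrier L" using Eq trans(3) by (simp add: z_def)
        then have "z \<sqsubseteq> v (Eq X, [n, m])" "z \<sqsubseteq> v (Eq X, [m, l])"
          using Eq trans(3) by (simp_all add: z_def meet_left meet_right)
        then show ?thesis
          using models_below_trans[OF m[OF z] trans(3)] trans z_def by simp
      next
        case (cong R ns ms)
        define z where "z = v (Sym R, ns) \<sqinter> eval L v (sims (arity T R) ns ms :: (unit, _, 'g + nat) fm)"
        note s = sims[OF cong(4,5) ar[OF cong(3)]]
        have z: "z \<in> carrier L" using Sym s(1) cong(3,4) by (simp add: z_def)
        then have "z \<sqsubseteq> v (Sym R, ns)"
          "z \<sqsubseteq> eval L v (sims (arity T R) ns ms :: (unit, _, 'g + nat) fm)"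
          using Sym s(1) cong(3,4) by (simp_all add: z_def meet_left meet_right)
        then have "z \<sqsubseteq> v (Sym R, ms)"
          using cong s(2) z by (intro models_below_cong[OF m[OF z], of "Sym R" ns ms]) auto
        then show ?thesis using cong z_def by simp
      next
        case (strict R ns)
        note s = sims[OF strict(4,4) ar[OF strict(3)]]
        have z: "v (Sym R, ns) \<in> carrier L" using Sym strict(3,4) .
        then show ?thesis
          using models_below_strict[OF m[OF z], of "Sym R" ns] strict s(2) by simp
      next
        case (axm \<alpha> \<Delta> \<beta> ns)
        define z where "z = eval L v (sims \<Delta> ns ns :: (unit, _, 'g + nat) fm) \<sqinter> eval L v (ground \<alpha> ns)"
        note s = sims[OF axm(4,4) ax(3)[OF axm(3)]] ground[OF ax(1)[OF axm(3)], of ns]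
        have z: "z \<in> carrier L" using s(1,3) by (simp add: z_def)
        then have "z \<sqsubseteq> eval L v (sims \<Delta> ns ns :: (unit, _, 'g + nat) fm)"
          "z \<sqsubseteq> eval L v (ground \<alpha> ns)"
          using s(1,3) by (simp_all add: z_def meet_left meet_right)
        then show ?thesis
          using models_below_axiom[OF m[OF z] axm(3,4)] s(2) z axm(1,2) z_def by simp
      qed
    qed
    then show "model (prop_theory T) L v" using True by (auto simp: model_def)
  qed
qed (auto simp: model_def)

end

section \<open>Renaming a model along surjections\<close>

fun relabel ::
  "('s, 'r, 'g) geo_theory \<Rightarrow> (nat \<times> 's \<Rightarrow> nat) \<Rightarrow> ('s, 'r) bprop \<Rightarrow> ('s, 'r) bprop" where
  "relabel T y (R, ns) = (R, map y (zip ns (rel_arity T R)))"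

text \<open>
  The generators of \<open>\<O>G\<^sub>1\<close> read in the arrow that renaming along \<open>y\<close> produces: the first model is
  the given one, the second is the same model with its elements renamed, and the isomorphism is the
  identity, so that \<open>\<alpha>(c) = d\<close> means that \<open>c\<close> and \<open>y d\<close> denote the same element.
\<close>

fun relabel_iso :: "('s, 'r, 'g) geo_theory \<Rightarrow> (nat \<times> 's \<Rightarrow> nat) \<Rightarrow>
    ('s iso_sort, ('s, 'r) iso_rel) bprop \<Rightarrow> ('s, 'r) bprop" where
  "relabel_iso T y (Eq (S1 X), ns) = (Eq X, ns)"
| "relabel_iso T y (Sym (R1 R), ns) = (Sym R, ns)"
| "relabel_iso T y (Eq (S2 X), ns) = relabel T y (Eq X, ns)"
| "relabel_iso T y (Sym (R2 R), ns) = relabel T y (Sym R, ns)"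
| "relabel_iso T y (Sym (Alpha X), ns) = (Eq X, [ns ! 0, y (ns ! 1, X)])"

lemma relabel_iso_first: "relabel_iso T y (map_grel S1 R1 R, ns) = (R, ns)"
  by (cases R) simp_all

lemma relabel_iso_second: "relabel_iso T y (map_grel S2 R2 R, ns) = relabel T y (R, ns)"
  by (cases R) simp_all

lemma rel_arity_iso:
  "rel_arity (iso_theory T) (map_grel S1 R1 R) = map S1 (rel_arity T R)"
  "rel_arity (iso_theory T) (map_grel S2 R2 R) = map S2 (rel_arity T R)"
  "arity (iso_theory T) (Alpha X) = [S1 X, S2 X]"
  by (cases R; simp add: iso_theory_def)+

lemma rel_in_iso_cases:
  assumes "rel_in (iso_theory T) R"
  obtains R' where "R = map_grel S1 R1 R'" "rel_in T R'"
  | R' where "R = map_grel S2 R2 R'" "rel_in T R'"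
  | X where "R = Sym (Alpha X)" "X \<in> sorts T"
proof (cases R)
  case (Eq Y)
  then show thesis
    using assms that(1)[of "Eq (case Y of S1 X \<Rightarrow> X | S2 X \<Rightarrow> X)"]
      that(2)[of "Eq (case Y of S1 X \<Rightarrow> X | S2 X \<Rightarrow> X)"]
    by (cases Y) (auto simp: iso_theory_def)
next
  case (Sym Q)
  show thesis
  proof (cases Q)
    case (R1 r)
    then show thesis using Sym assms that(1)[of "Sym r"] by (auto simp: iso_theory_def)
  next
    case (R2 r)
    then show thesis using Sym assms that(2)[of "Sym r"] by (auto simp: iso_theory_def)
  next
    case (Alpha X)
    then show thesis using Sym assms that(3)[of X] by (auto simp: iso_theory_def)
  qed
qed

lemma relabel_iso_in_rels:
  "p \<in> rels (prop_theory (iso_theory T)) \<Longrightarrow> relabel_iso T y p \<in> rels (prop_theory T)"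
proof -
  assume "p \<in> rels (prop_theory (iso_theory T))"
  then obtain R ns where p: "p = (R, ns)" "rel_in (iso_theory T) R"
    "length ns = length (rel_arity (iso_theory T) R)"
    by (auto simp: prop_theory_def)
  from p(2) show ?thesis
    using p(1,3)
    by (cases rule: rel_in_iso_cases)
      (auto simp: prop_theory_def rel_arity_iso relabel_iso_first relabel_iso_second)
qed

lemma iso_theory_axiom_cases:
  assumes "\<sigma> \<in> axioms (iso_theory T)"
  obtains (first) \<phi> \<Gamma> \<psi> where "(\<phi> \<turnstile>\<^bsub>\<Gamma>\<^esub> \<psi>) \<in> axioms T"
      "\<sigma> = (map_fm S1 R1 \<phi> \<turnstile>\<^bsub>map S1 \<Gamma>\<^esub> map_fm S1 R1 \<psi>)"
  | (second) \<phi> \<Gamma> \<psi> where "(\<phi> \<turnstile>\<^bsub>\<Gamma>\<^esub> \<psi>) \<in> axioms T"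
      "\<sigma> = (map_fm S2 R2 \<phi> \<turnstile>\<^bsub>map S2 \<Gamma>\<^esub> map_fm S2 R2 \<psi>)"
  | (bij) X where "X \<in> sorts T" "\<sigma> \<in> bij_axioms X"
  | (rel) R where "R \<in> rels T" "\<sigma> \<in> rel_axioms R (arity T R)"
proof -
  consider (1) \<tau> where "\<tau> \<in> axioms T" "\<sigma> = map_sequent S1 R1 \<tau>"
    | (2) \<tau> where "\<tau> \<in> axioms T" "\<sigma> = map_sequent S2 R2 \<tau>"
    | (3) X where "X \<in> sorts T" "\<sigma> \<in> bij_axioms X"
    | (4) R where "R \<in> rels T" "\<sigma> \<in> rel_axioms R (arity T R)"
    using assms unfolding iso_theory_def by auto
  then show thesis
  proof cases
    case (1 \<tau>)
    then show thesis using first by (cases \<tau>) simp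
  next
    case (2 \<tau>)
    then show thesis using second by (cases \<tau>) simp
  qed (use bij rel in auto)
qed

lemma ground_conjs: "ground (conjs \<phi>s) ns = conjs (map (\<lambda>\<phi>. ground \<phi> ns) \<phi>s)"
  by (induction \<phi>s) (simp_all add: conjs_def)

text \<open>
  Surjectivity is what makes the quantifiers agree: every name of a witness in the original model is
  \<open>y n\<close> for some \<open>n\<close>, so \<open>n\<close> names this witness in the renamed model.
\<close>

lemma eval_ground_relabel:
  assumes surj: "\<And>X. X \<in> sorts T \<Longrightarrow> surj (\<lambda>n. y (n, X))"
    and wf: "wf_fm T \<phi> \<Gamma>" and len: "length ns = length \<Gamma>"
  shows "eval L (\<lambda>p. v (relabel T y p)) (ground \<phi> ns) = eval L v (ground \<phi> (map y (zip ns \<Gamma>)))"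
  using wf len
proof (induction \<phi> arbitrary: ns \<Gamma>)
  case (Atom R xs)
  have "map y (zip (map ((!) ns) xs) (rel_arity T R)) = map ((!) (map y (zip ns \<Gamma>))) xs"
    using Atom by (auto simp: list_all2_conv_all_nth intro!: nth_equalityI)
  then show ?case by simp
next
  case (Disj I f)
  have "eval L (\<lambda>p. v (relabel T y p)) (ground (f i) ns) = eval L v (ground (f i) (map y (zip ns \<Gamma>)))"
    if "i \<in> I" for i
    using Disj.IH[OF rangeI, of i \<Gamma> ns] Disj.prems that by simp
  then show ?case by (simp add: image_image cong: image_cong)
next
  case (Exists X \<phi>)
  let ?b = "\<lambda>m. v (Eq X, [m, m]) \<sqinter>\<^bsub>L\<^esub> eval L v (ground \<phi> (m # map y (zip ns \<Gamma>)))"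
  have "eval L (\<lambda>p. v (relabel T y p)) (ground (Exists X \<phi>) ns) = \<Squnion>\<^bsub>L\<^esub>(?b ` range (\<lambda>n. y (n, X)))"
    using Exists.IH[of "X # \<Gamma>"] Exists.prems by (simp add: image_image)
  also have "range (\<lambda>n. y (n, X)) = UNIV" using surj Exists.prems(1) by simp
  finally show ?case by (simp add: image_image)
next
  case (And \<phi> \<psi>)
  show ?case using And.IH(1)[of \<Gamma> ns] And.IH(2)[of \<Gamma> ns] And.prems by simp
qed simp

text \<open>
  The second copy of an axiom of the theory holds because it is the original axiom at renamed
  arguments. Since \<open>\<alpha>\<close> is equality in the given model, it is functional, injective and compatible with
  the relations by congruence; \<open>d\<close> has the preimage \<open>y d\<close>, and \<open>\<alpha>\<close> is total because \<open>y\<close> is surjective.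
\<close>

theorem (in frame) model_iso_theory_relabel:
  fixes T :: "('s, 'r, 'g) geo_theory"
  assumes T: "geometric_theory T" and v: "model (prop_theory T) L v"
    and surj: "\<And>X. X \<in> sorts T \<Longrightarrow> surj (\<lambda>n. y (n, X))"
  shows "model (prop_theory (iso_theory T)) L (\<lambda>p. v (relabel_iso T y p))"
proof -
  let ?I = "iso_theory T" and ?u = "\<lambda>p. v (relabel_iso T y p)"
  have vcl: "v ` rels (prop_theory T) \<subseteq> carrier L"
    and m: "\<And>z. z \<in> carrier L \<Longrightarrow> models_below T L v z"
    using v unfolding model_iff_models_below[OF T] by blast+
  have ucl: "?u ` rels (prop_theory ?I) \<subseteq> carrier L"
    using vcl relabel_iso_in_rels[of _ T y] by auto
  have "models_below ?I L ?u z" if z: "z \<in> carrier L" for z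
  proof -
    note sym = models_below_sym[OF m[OF z]] and trans = models_below_trans[OF m[OF z]]
      and cong = models_below_cong[OF m[OF z]] and strict = models_below_strict[OF m[OF z]]
    have u1: "?u (map_grel S1 R1 R, ns) = v (R, ns)" for R ns by (simp add: relabel_iso_first)
    have u2: "?u (map_grel S2 R2 R, ns) = v (R, map y (zip ns (rel_arity T R)))" for R ns
      by (simp add: relabel_iso_second)
    have c1: "z \<sqsubseteq> ?u (Eq X, [m, n])" if "X \<in> sorts ?I" "z \<sqsubseteq> ?u (Eq X, [n, m])" for X n m
      using that sym by (cases X) (auto simp: iso_theory_def)
    have c2: "z \<sqsubseteq> ?u (R, ms)"
      if R: "rel_in ?I R" and len: "length ns = length (rel_arity ?I R)" "length ms = length ns"
        and ns: "z \<sqsubseteq> ?u (R, ns)"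
        and eq: "\<forall>i<length ns. z \<sqsubseteq> ?u (Eq (rel_arity ?I R ! i), [ns ! i, ms ! i])" for R ns ms
      using R
    proof (cases rule: rel_in_iso_cases)
      case (1 R')
      have "z \<sqsubseteq> v (R', ms)"
      proof (rule cong[OF 1(2)])
        show "z \<sqsubseteq> v (R', ns)" using ns 1 by (simp only: u1)
        show "z \<sqsubseteq> v (Eq (rel_arity T R' ! i), [ns ! i, ms ! i])" if "i < length (rel_arity T R')" for i
          using eq len 1(1) that by (simp add: rel_arity_iso)
      qed (use len 1(1) in \<open>simp_all add: rel_arity_iso\<close>)
      then show ?thesis using 1(1) by (simp only: u1)
    next
      case (2 R')
      let ?y = "\<lambda>ns. map y (zip ns (rel_arity T R'))"
      have "z \<sqsubseteq> v (R', ?y ms)"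
      proof (rule cong[OF 2(2)])
        show "z \<sqsubseteq> v (R', ?y ns)" using ns 2 by (simp only: u2)
        show "z \<sqsubseteq> v (Eq (rel_arity T R' ! i), [?y ns ! i, ?y ms ! i])" if "i < length (rel_arity T R')" for i
          using eq len 2(1) that by (simp add: rel_arity_iso)
      qed (use len 2(1) in \<open>simp_all add: rel_arity_iso\<close>)
      then show ?thesis using 2(1) by (simp only: u2)
    next
      case (3 X)
      then obtain a b a' b' where nm: "ns = [a, b]" "ms = [a', b']"
        using len by (auto simp: rel_arity_iso length_Suc_conv)
      have f: "z \<sqsubseteq> v (Eq X, [a, y (b, X)])" "z \<sqsubseteq> v (Eq X, [a, a'])" "z \<sqsubseteq> v (Eq X, [y (b, X), y (b', X)])"
        using ns spec[OF eq, of 0] spec[OF eq, of 1] 3(1) nm by (simp_all add: rel_arity_iso)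
      have "z \<sqsubseteq> v (Eq X, [a', y (b', X)])"
        by (rule trans[OF 3(2) sym[OF 3(2) f(2)] trans[OF 3(2) f(1,3)]])
      then show ?thesis using 3(1) nm by simp
    qed
    have c3: "z \<sqsubseteq> ?u (Eq (rel_arity ?I R ! i), [ns ! i, ns ! i])"
      if R: "rel_in ?I R" and len: "length ns = length (rel_arity ?I R)"
        and ns: "z \<sqsubseteq> ?u (R, ns)" and i: "i < length ns" for R ns i
      using R
    proof (cases rule: rel_in_iso_cases)
      case (1 R')
      have "z \<sqsubseteq> v (R', ns)" using ns 1 by (simp only: u1)
      then show ?thesis using strict[OF 1(2), of ns i] len i 1(1) by (simp add: rel_arity_iso)
    next
      case (2 R')
      have "z \<sqsubseteq> v (R', map y (zip ns (rel_arity T R')))" using ns 2 by (simp only: u2)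
      then show ?thesis
        using strict[OF 2(2), of "map y (zip ns (rel_arity T R'))" i] len i 2(1)
        by (simp add: rel_arity_iso)
    next
      case (3 X)
      then obtain a b where nm: "ns = [a, b]"
        using len by (auto simp: rel_arity_iso length_Suc_conv)
      have "z \<sqsubseteq> v (Eq X, [a, y (b, X)])" using ns 3(1) nm by simp
      then have "z \<sqsubseteq> v (Eq X, [a, a])" "z \<sqsubseteq> v (Eq X, [y (b, X), y (b, X)])"
        using strict[of "Eq X" "[a, y (b, X)]" 0] strict[of "Eq X" "[a, y (b, X)]" 1] 3(2) by simp_all
      then show ?thesis using 3(1) nm i by (auto simp: rel_arity_iso less_Suc_eq)
    qed
    have c4: "z \<sqsubseteq> eval L ?u (ground \<psi> ns)"
      if ax: "(\<phi> \<turnstile>\<^bsub>\<Gamma>\<^esub> \<psi>) \<in> axioms ?I" and len: "length ns = length \<Gamma>"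
        and ex: "\<forall>i<length ns. z \<sqsubseteq> ?u (Eq (\<Gamma> ! i), [ns ! i, ns ! i])"
        and \<phi>: "z \<sqsubseteq> eval L ?u (ground \<phi> ns)" for \<phi> \<Gamma> \<psi> ns
    proof -
      have copy1: "eval L ?u (ground (map_fm S1 R1 \<chi>) ms) = eval L v (ground \<chi> ms)" for \<chi> ms
      proof -
        have "(\<lambda>(R, ns). ?u (map_grel S1 R1 R, ns)) = v" using u1 by auto
        then show ?thesis by (simp only: eval_ground_map)
      qed
      have copy2: "eval L ?u (ground (map_fm S2 R2 \<chi>) ms) = eval L v (ground \<chi> (map y (zip ms \<Delta>)))"
        if "wf_fm T \<chi> \<Delta>" "length ms = length \<Delta>" for \<chi> ms \<Delta>
      proof -
        have "(\<lambda>(R, ns). ?u (map_grel S2 R2 R, ns)) = (\<lambda>p. v (relabel T y p))"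
          by (auto simp: relabel_iso_second)
        then have "eval L ?u (ground (map_fm S2 R2 \<chi>) ms) =
            eval L (\<lambda>p. v (relabel T y p)) (ground \<chi> ms)"
          by (simp only: eval_ground_map)
        then show ?thesis using eval_ground_relabel[OF surj that] by simp
      qed
      have Eqcl: "v (Eq X, [n, m]) \<in> carrier L" if "X \<in> sorts T" for X n m
        using vcl that by (auto simp: prop_theory_def image_subset_iff)
      from ax show ?thesis
      proof (cases rule: iso_theory_axiom_cases)
        case (first \<phi>' \<Gamma>' \<psi>')
        then show ?thesis
          using models_below_axiom[OF m[OF z] first(1), of ns] len ex \<phi> by (simp add: copy1)
      next
        case (second \<phi>' \<Gamma>' \<psi>')
        then have wf: "wf_fm T \<phi>' \<Gamma>'" "wf_fm T \<psi>' \<Gamma>'"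
          using T by (auto simp: geometric_theory_def)
        have len': "length ns = length \<Gamma>'" using len second by simp
        then show ?thesis
          using models_below_axiom[OF m[OF z] second(1), of "map y (zip ns \<Gamma>')"] ex \<phi>
            copy2[OF wf(1) len'] copy2[OF wf(2) len'] second by simp
      next
        case (bij X)
        let ?\<phi> = "conjs [alpha X 0 2, alpha X 1 3, Atom (Eq (S1 X)) [0, 1]]"
        let ?\<psi> = "conjs [alpha X 0 2, alpha X 1 3, Atom (Eq (S2 X)) [2, 3]]"
        note X = bij(1)
        from bij(2) consider "\<phi> = ?\<phi>" "\<psi> = ?\<psi>" "\<Gamma> = [S1 X, S1 X, S2 X, S2 X]"
          | "\<phi> = ?\<psi>" "\<psi> = ?\<phi>" "\<Gamma> = [S1 X, S1 X, S2 X, S2 X]"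
          | "\<psi> = Exists (S1 X) (alpha X 0 1)" "\<Gamma> = [S2 X]"
          | "\<psi> = Exists (S2 X) (alpha X 1 0)" "\<Gamma> = [S1 X]"
          unfolding bij_axioms_def biseq_def by auto
        then show ?thesis
        proof cases
          case 1
          then obtain a b c d where ns: "ns = [a, b, c, d]"
            using len by (auto simp: length_Suc_conv)
          have f: "z \<sqsubseteq> v (Eq X, [a, y (c, X)])" "z \<sqsubseteq> v (Eq X, [b, y (d, X)])" "z \<sqsubseteq> v (Eq X, [a, b])"
            using \<phi> z Eqcl[OF X] 1 ns by (simp_all add: conjs_def le_meet_iff)
          moreover have "z \<sqsubseteq> v (Eq X, [y (c, X), y (d, X)])"
            by (rule trans[OF X sym[OF X f(1)] trans[OF X f(3,2)]])
          ultimately show ?thesis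
            using z Eqcl[OF X] 1 ns by (simp add: conjs_def le_meet_iff)
        next
          case 2
          then obtain a b c d where ns: "ns = [a, b, c, d]"
            using len by (auto simp: length_Suc_conv)
          have f: "z \<sqsubseteq> v (Eq X, [a, y (c, X)])" "z \<sqsubseteq> v (Eq X, [b, y (d, X)])"
              "z \<sqsubseteq> v (Eq X, [y (c, X), y (d, X)])"
            using \<phi> z Eqcl[OF X] 2 ns by (simp_all add: conjs_def le_meet_iff)
          moreover have "z \<sqsubseteq> v (Eq X, [a, b])"
            by (rule trans[OF X trans[OF X f(1,3)] sym[OF X f(2)]])
          ultimately show ?thesis
            using z Eqcl[OF X] 2 ns by (simp add: conjs_def le_meet_iff)
        next
          case 3
          then obtain d where ns: "ns = [d]" using len by (auto simp: length_Suc_conv)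
          have "z \<sqsubseteq> v (Eq X, [y (d, X), y (d, X)])"
            using ex 3 ns by simp
          then show ?thesis
            using z Eqcl[OF X] 3 ns
            by (auto simp: image_image le_meet_iff intro!: le_Sup_witness[OF _ rangeI[of _ "y (d, X)"]])
        next
          case 4
          then obtain c where ns: "ns = [c]" using len by (auto simp: length_Suc_conv)
          obtain n where n: "y (n, X) = c" using surjD[OF surj[OF X], of c] by auto
          have "z \<sqsubseteq> v (Eq X, [c, c])" using ex 4 ns by simp
          then show ?thesis
            using z Eqcl[OF X] 4 ns n
            by (auto simp: image_image le_meet_iff intro!: le_Sup_witness[OF _ rangeI[of _ n]])
        qed
      next
        case (rel R)
        define k where "k = length (arity T R)"
        let ?\<alpha> = "conjs (map (\<lambda>i. alpha (arity T R ! i) i (k + i)) [0..<k]) ::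
          ('s iso_sort, ('s, 'r) iso_rel, 'g) fm"
        let ?xs = "map ((!) ns) [0..<k]" and ?ys = "map y (zip (map ((!) ns) [k..<2 * k]) (arity T R))"
        have ar: "arity T R ! i \<in> sorts T" if "i < k" for i
          using T rel(1) that unfolding geometric_theory_def k_def by (meson nth_mem subsetD)
        have \<alpha>: "eval L ?u (ground ?\<alpha> ns) \<in> carrier L"
          "z \<sqsubseteq> eval L ?u (ground ?\<alpha> ns) \<longleftrightarrow>
             (\<forall>i<k. z \<sqsubseteq> v (Eq (arity T R ! i), [ns ! i, y (ns ! (k + i), arity T R ! i)]))"
          unfolding ground_conjs using z ar Eqcl
          by (subst le_eval_conjs_iff; auto)+
        have cl: "v (Sym R, ?xs) \<in> carrier L" "v (Sym R, ?ys) \<in> carrier L"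
          using vcl rel(1) by (auto simp: prop_theory_def image_subset_iff k_def)
        have fwd: "z \<sqsubseteq> v (Sym R, ?ys)" if "z \<sqsubseteq> v (Sym R, ?xs)" "z \<sqsubseteq> eval L ?u (ground ?\<alpha> ns)"
          by (rule cong[of "Sym R" ?xs]) (use that rel(1) \<alpha>(2) in \<open>auto simp: k_def\<close>)
        have bwd: "z \<sqsubseteq> v (Sym R, ?xs)" if "z \<sqsubseteq> v (Sym R, ?ys)" "z \<sqsubseteq> eval L ?u (ground ?\<alpha> ns)"
          by (rule cong[of "Sym R" ?ys]) (use that rel(1) \<alpha>(2) sym[OF ar] in \<open>auto simp: k_def\<close>)
        from rel(2) consider
          "\<phi> = And ?\<alpha> (Atom (Sym (R1 R)) [0..<k])" "\<psi> = And ?\<alpha> (Atom (Sym (R2 R)) [k..<2 * k])"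
        | "\<phi> = And ?\<alpha> (Atom (Sym (R2 R)) [k..<2 * k])" "\<psi> = And ?\<alpha> (Atom (Sym (R1 R)) [0..<k])"
          unfolding rel_axioms_def biseq_def Let_def k_def by auto
        then show ?thesis
        proof cases
          case 1
          then show ?thesis
            using \<phi> \<alpha>(1) cl z fwd by (simp add: le_meet_iff)
        next
          case 2
          then show ?thesis
            using \<phi> \<alpha>(1) cl z bwd by (simp add: le_meet_iff)
        qed
      qed
    qed
    show ?thesis
      by (rule models_belowI) (fact c1 c2 c3 c4)+
  qed
  then show ?thesis
    unfolding model_iff_models_below[OF geometric_iso_theory[OF T]] using ucl by blast
qed

section \<open>Reasoning in a model of the theory of isomorphisms\<close>

text \<open>
  The names from the second enumeration in a generator, with their sorts: exactly those
  whose values under a renaming \<open>y\<close> enter \<open>relabel_iso T y\<close>.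
\<close>

definition iso_vars :: "('s, 'r, 'g) geo_theory \<Rightarrow> ('s iso_sort, ('s, 'r) iso_rel) bprop \<Rightarrow> (nat \<times> 's) set" where
  "iso_vars T = (\<lambda>(R, ns). {(n, X). (n, S2 X) \<in> set (zip ns (rel_arity (iso_theory T) R))})"

lemma finite_iso_vars: "finite (iso_vars T p)"
proof -
  have "iso_vars T p = (\<lambda>(n, X). (n, S2 X)) -` set (zip (snd p) (rel_arity (iso_theory T) (fst p)))"
    by (auto simp: iso_vars_def split: prod.splits)
  then show ?thesis by (auto intro!: finite_vimageI injI)
qed

context frame begin

context
  fixes T :: "('s, 'r, 'g) geo_theory" and w
  assumes T: "geometric_theory T" and w: "model (prop_theory (iso_theory T)) L w"
begin

lemma rels_closed: "rel_in (iso_theory T) R \<Longrightarrow> length ns = length (rel_arity (iso_theory T) R) \<Longrightarrow>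
    w (R, ns) \<in> carrier L"
  using w by (auto simp: prop_theory_def image_subset_iff model_def)

lemma gens_closed:
  "X \<in> sorts T \<Longrightarrow> w (Eq (S1 X), [n, m]) \<in> carrier L"
  "X \<in> sorts T \<Longrightarrow> w (Eq (S2 X), [n, m]) \<in> carrier L"
  "X \<in> sorts T \<Longrightarrow> w (Sym (Alpha X), [n, m]) \<in> carrier L"
  "R \<in> rels T \<Longrightarrow> length ns = length (arity T R) \<Longrightarrow> w (Sym (R1 R), ns) \<in> carrier L"
  "R \<in> rels T \<Longrightarrow> length ns = length (arity T R) \<Longrightarrow> w (Sym (R2 R), ns) \<in> carrier L"
  by (rule rels_closed; simp add: iso_theory_def)+

lemma models_below_iso: "z \<in> carrier L \<Longrightarrow> models_below (iso_theory T) L w z"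
  using w model_iff_models_below[OF geometric_iso_theory[OF T]] by blast

lemma alpha_strict:
  assumes "X \<in> sorts T" "z \<in> carrier L" "z \<sqsubseteq> w (Sym (Alpha X), [n, m])"
  shows "z \<sqsubseteq> w (Eq (S1 X), [n, n])" "z \<sqsubseteq> w (Eq (S2 X), [m, m])"
  using models_below_strict[OF models_below_iso[OF assms(2)], of "Sym (Alpha X)" "[n, m]" 0]
    models_below_strict[OF models_below_iso[OF assms(2)], of "Sym (Alpha X)" "[n, m]" 1] assms
  by (simp_all add: iso_theory_def)

lemma alpha_injective:
  assumes X: "X \<in> sorts T" and z: "z \<in> carrier L"
    and \<alpha>: "z \<sqsubseteq> w (Sym (Alpha X), [a, c])" "z \<sqsubseteq> w (Sym (Alpha X), [b, d])"
    and eq: "z \<sqsubseteq> w (Eq (S2 X), [c, d])"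
  shows "z \<sqsubseteq> w (Eq (S1 X), [a, b])"
proof -
  let ?\<phi> = "conjs [alpha X 0 2, alpha X 1 3, Atom (Eq (S1 X)) [0, 1]] :: ('s iso_sort, ('s, 'r) iso_rel, 'g) fm"
  let ?\<psi> = "conjs [alpha X 0 2, alpha X 1 3, Atom (Eq (S2 X)) [2, 3]] :: ('s iso_sort, ('s, 'r) iso_rel, 'g) fm"
  have ax: "(?\<psi> \<turnstile>\<^bsub>[S1 X, S1 X, S2 X, S2 X]\<^esub> ?\<phi>) \<in> axioms (iso_theory T)"
    using X by (auto simp: iso_theory_def bij_axioms_def biseq_def)
  have "z \<sqsubseteq> eval L w (ground ?\<phi> [a, b, c, d])"
  proof (rule models_below_axiom[OF models_below_iso[OF z] ax])
    show "z \<sqsubseteq> eval L w (ground ?\<psi> [a, b, c, d])"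
      using z \<alpha> eq X by (simp add: conjs_def le_meet_iff gens_closed)
  qed (use alpha_strict[OF X z] \<alpha> in \<open>auto simp: less_Suc_eq\<close>)
  then show ?thesis using z X by (simp add: conjs_def le_meet_iff gens_closed)
qed

lemma alpha_reflects_rel:
  assumes R: "R \<in> rels T" and len: "length ns = length (arity T R)" "length ms = length (arity T R)"
    and z: "z \<in> carrier L" and Rm: "z \<sqsubseteq> w (Sym (R2 R), ms)"
    and \<alpha>: "\<And>i. i < length ns \<Longrightarrow> z \<sqsubseteq> w (Sym (Alpha (arity T R ! i)), [ns ! i, ms ! i])"
  shows "z \<sqsubseteq> w (Sym (R1 R), ns)"
proof -
  define k where "k = length (arity T R)"
  let ?\<alpha> = "conjs (map (\<lambda>i. alpha (arity T R ! i) i (k + i)) [0..<k]) :: ('s iso_sort, ('s, 'r) iso_rel, 'g) fm"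
  let ?\<phi> = "And ?\<alpha> (Atom (Sym (R1 R)) [0..<k])" and ?\<psi> = "And ?\<alpha> (Atom (Sym (R2 R)) [k..<2 * k])"
  have ax: "(?\<psi> \<turnstile>\<^bsub>map S1 (arity T R) @ map S2 (arity T R)\<^esub> ?\<phi>) \<in> axioms (iso_theory T)"
    using R by (auto simp: iso_theory_def rel_axioms_def biseq_def Let_def k_def)
  have ar: "arity T R ! i \<in> sorts T" if "i < k" for i
    using T R that unfolding geometric_theory_def k_def by (meson nth_mem subsetD)
  have m: "map ((!) (ns @ ms)) [0..<k] = ns" "map ((!) (ns @ ms)) [k..<2 * k] = ms"
    using len by (auto simp: k_def nth_append intro!: nth_equalityI)
  have c: "eval L w (ground ?\<alpha> (ns @ ms)) \<in> carrier L"
    "z \<sqsubseteq> eval L w (ground ?\<alpha> (ns @ ms)) \<longleftrightarrow>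
       (\<forall>i<k. z \<sqsubseteq> w (Sym (Alpha (arity T R ! i)), [ns ! i, ms ! i]))"
    unfolding ground_conjs using z ar len
    by (subst le_eval_conjs_iff; auto simp: gens_closed nth_append k_def)+
  have "z \<sqsubseteq> eval L w (ground ?\<phi> (ns @ ms))"
  proof (rule models_below_axiom[OF models_below_iso[OF z] ax])
    show "z \<sqsubseteq> eval L w (ground ?\<psi> (ns @ ms))"
      using z c \<alpha> Rm R len m by (simp add: le_meet_iff gens_closed k_def)
    fix i assume i: "i < length (map S1 (arity T R) @ map S2 (arity T R))"
    show "z \<sqsubseteq> w (Eq ((map S1 (arity T R) @ map S2 (arity T R)) ! i), [(ns @ ms) ! i, (ns @ ms) ! i])"
    proof (cases "i < k")
      case True
      then show ?thesis
        using alpha_strict(1)[OF ar z \<alpha>] len by (simp add: k_def nth_append)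
    next
      case False
      then have "i - k < k" using i by (simp add: k_def)
      then show ?thesis
        using alpha_strict(2)[OF ar z \<alpha>] len False by (simp add: k_def nth_append)
    qed
  qed (use len in simp)
  then show ?thesis using z c R len m by (simp add: le_meet_iff gens_closed k_def)
qed

text \<open>
  If \<open>\<alpha>(y d) = d\<close> for all names \<open>d\<close> in a generator, then the isomorphism carries what the generator
  says back to the first model. For a relation symbol this is invariance under \<open>\<alpha>\<close>; for an equality
  \<open>[c \<sim> d]\<close> of the second copy it is injectivity, and so it is for \<open>[\<alpha>(c) = d]\<close>, where \<open>c\<close> and \<open>y d\<close> have the
  same image.
\<close>

lemma transport_to_source:
  assumes z: "z \<in> carrier L" and p: "p \<in> rels (prop_theory (iso_theory T))" "z \<sqsubseteq> w p"
    and \<alpha>: "\<And>n X. (n, X) \<in> iso_vars T p \<Longrightarrow> z \<sqsubseteq> w (Sym (Alpha X), [y (n, X), n])"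
    and q: "relabel_iso T y p = (Q, ms)"
  shows "z \<sqsubseteq> w (map_grel S1 R1 Q, ms)"
proof -
  obtain R ns where R: "p = (R, ns)" "rel_in (iso_theory T) R" "length ns = length (rel_arity (iso_theory T) R)"
    using p(1) by (auto simp: prop_theory_def)
  from R(2) show ?thesis
  proof (cases rule: rel_in_iso_cases)
    case (1 R')
    then show ?thesis using R q p(2) by (simp add: relabel_iso_first)
  next
    case (2 R')
    have Q: "Q = R'" "ms = map y (zip ns (rel_arity T R'))"
      using q unfolding R(1) 2(1) by (auto simp: relabel_iso_second)
    have len: "length ns = length (rel_arity T R')"
      using R(3) 2(1) by (simp add: rel_arity_iso)
    have v: "(ns ! i, rel_arity T R' ! i) \<in> iso_vars T p" if "i < length ns" for i
      using R(1) 2(1) that len by (auto simp: iso_vars_def rel_arity_iso set_zip)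
    show ?thesis
    proof (cases R')
      case (Eq X)
      then obtain c d where ns: "ns = [c, d]" using len by (auto simp: length_Suc_conv)
      then show ?thesis
        using Q Eq 2 R(1) p(2) \<alpha>[OF v, of 0] \<alpha>[OF v, of 1]
          alpha_injective[of X z "y (c, X)" c "y (d, X)" d] z by simp
    next
      case (Sym R'')
      then show ?thesis
        using Q 2 R(1) p(2) \<alpha>[OF v] len z by (auto intro!: alpha_reflects_rel[where ms = ns])
    qed
  next
    case (3 X)
    then obtain c d where ns: "ns = [c, d]" using R(3) by (auto simp: length_Suc_conv rel_arity_iso)
    have "(d, X) \<in> iso_vars T p" using R(1) 3(1) ns by (simp add: iso_vars_def rel_arity_iso)
    then show ?thesis
      using q R(1) 3 ns p(2) \<alpha> alpha_injective[of X z c d "y (d, X)" d] alpha_strict[of X z c d] z by auto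
  qed
qed

lemma vars_defined:
  assumes z: "z \<in> carrier L" and p: "p \<in> rels (prop_theory (iso_theory T))" "z \<sqsubseteq> w p"
    and x: "(n, X) \<in> iso_vars T p"
  shows "X \<in> sorts T" "z \<sqsubseteq> w (Eq (S2 X), [n, n])"
proof -
  obtain R ns where R: "p = (R, ns)" "rel_in (iso_theory T) R" "length ns = length (rel_arity (iso_theory T) R)"
    using p(1) by (auto simp: prop_theory_def)
  obtain i where i: "i < length ns" "ns ! i = n" "rel_arity (iso_theory T) R ! i = S2 X"
    using x R(1) by (auto simp: iso_vars_def set_zip)
  have "set (rel_arity (iso_theory T) R) \<subseteq> sorts (iso_theory T)"
    using geometric_iso_theory[OF T] R(2) unfolding geometric_theory_def by (cases R) auto
  moreover have "S2 X \<in> set (rel_arity (iso_theory T) R)"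
    using i R(3) nth_mem[of i "rel_arity (iso_theory T) R"] by simp
  ultimately show "X \<in> sorts T" by (auto simp: iso_theory_def)
  show "z \<sqsubseteq> w (Eq (S2 X), [n, n])"
    using models_below_strict[OF models_below_iso[OF z] R(2,3), of i] p(2) R(1,3) i by simp
qed

lemma alpha_surjective:
  assumes X: "X \<in> sorts T" and z: "z \<in> carrier L" "z \<sqsubseteq> w (Eq (S2 X), [d, d])"
  shows "z \<sqsubseteq> \<Squnion>(range (\<lambda>n. w (Eq (S1 X), [n, n]) \<sqinter> w (Sym (Alpha X), [n, d])))"
proof -
  have ax: "(Top \<turnstile>\<^bsub>[S2 X]\<^esub> Exists (S1 X) (alpha X 0 1)) \<in> axioms (iso_theory T)"
    using X by (auto simp: iso_theory_def bij_axioms_def)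
  show ?thesis
    using models_below_axiom[OF models_below_iso[OF z(1)] ax, of "[d]"] z by (simp add: image_image)
qed

text \<open>
  Local existence of preimages: to prove something at the stage \<open>z\<close> one may choose a preimage
  under \<open>\<alpha>\<close> for each of finitely many names in the second model. Choosing them one at a time refines the
  stage at each step.
\<close>

lemma cover_by_preimages:
  assumes V: "finite V" and u: "u \<in> carrier L" and z: "z \<in> carrier L"
    and d: "\<And>n X. (n, X) \<in> V \<Longrightarrow> X \<in> sorts T \<and> z \<sqsubseteq> w (Eq (S2 X), [n, n])"
    and le: "\<And>y z'. z' \<in> carrier L \<Longrightarrow> z' \<sqsubseteq> z \<Longrightarrow>
      (\<And>n X. (n, X) \<in> V \<Longrightarrow> z' \<sqsubseteq> w (Sym (Alpha X), [y (n, X), n])) \<Longrightarrow> z' \<sqsubseteq> u"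
  shows "z \<sqsubseteq> u"
  using V z d le
proof (induction V arbitrary: z rule: finite_induct)
  case empty
  show ?case using empty.prems(3)[OF empty.prems(1)] empty.prems(1) by simp
next
  case (insert x V)
  obtain d X where x: "x = (d, X)" by (cases x)
  have X: "X \<in> sorts T" "z \<sqsubseteq> w (Eq (S2 X), [d, d])" using insert.prems(2) x by auto
  let ?a = "\<lambda>n. w (Eq (S1 X), [n, n]) \<sqinter> w (Sym (Alpha X), [n, d])"
  have acl: "?a n \<in> carrier L" for n using X(1) by (simp add: gens_closed)
  show ?case
  proof (rule le_Sup_cases[OF insert.prems(1) u _ alpha_surjective[OF X(1) insert.prems(1) X(2)]])
    show "range ?a \<subseteq> carrier L" using acl by auto
    fix a assume "a \<in> range ?a"
    then obtain n where a: "a = ?a n" by blast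
    have za: "z \<sqinter> a \<in> carrier L" "z \<sqinter> a \<sqsubseteq> z" "z \<sqinter> a \<sqsubseteq> a"
      using insert.prems(1) acl a by (auto intro: meet_left meet_right)
    then have "z \<sqinter> a \<sqsubseteq> w (Sym (Alpha X), [n, d])"
      using a X(1) le_meet_iff[of "w (Eq (S1 X), [n, n])" "w (Sym (Alpha X), [n, d])" "z \<sqinter> a"]
      by (simp add: gens_closed)
    note \<alpha> = this
    show "z \<sqinter> a \<sqsubseteq> u"
    proof (rule insert.IH[OF za(1)])
      show "Y \<in> sorts T \<and> z \<sqinter> a \<sqsubseteq> w (Eq (S2 Y), [m, m])" if "(m, Y) \<in> V" for m Y
        using insert.prems(2)[of m Y] that le_trans[OF za(2) _ za(1) insert.prems(1)]
        by (auto simp: gens_closed)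
      fix y z' assume z': "z' \<in> carrier L" "z' \<sqsubseteq> z \<sqinter> a"
        "\<And>n X. (n, X) \<in> V \<Longrightarrow> z' \<sqsubseteq> w (Sym (Alpha X), [y (n, X), n])"
      show "z' \<sqsubseteq> u"
      proof (rule insert.prems(3)[OF z'(1)])
        show "z' \<sqsubseteq> z" using le_trans[OF z'(2) za(2) z'(1) za(1)] insert.prems(1) by blast
        show "z' \<sqsubseteq> w (Sym (Alpha Y), [(y(x := n)) (m, Y), m])" if "(m, Y) \<in> insert x V" for m Y
        proof (cases "(m, Y) = x")
          case True
          then show ?thesis
            using x le_trans[OF z'(2) \<alpha> z'(1) za(1)] X(1) by (simp add: gens_closed)
        next
          case False
          then show ?thesis using that z'(3) by simp
        qed
      qed
    qed
  qed
qed

end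

end

section \<open>The left adjoint of the source map\<close>

definition surjections :: "(nat \<times> 's \<Rightarrow> nat) set" where
  "surjections = {y. \<forall>X. surj (\<lambda>n. y (n, X))}"

text \<open>
  The inverse image map of the section of the source map given by renaming along \<open>y\<close>.
\<close>

definition section_inv :: "('s, 'r, 'g) geo_theory \<Rightarrow> (nat \<times> 's \<Rightarrow> nat) \<Rightarrow>
    ('s iso_sort, ('s, 'r) iso_rel) bprop set set \<Rightarrow> ('s, 'r) bprop set set" where
  "section_inv T y = induced_hom (OG0 T) (\<lambda>p. gen (prop_theory T) (relabel_iso T y p))"

definition shriek :: "('s, 'r, 'g) geo_theory \<Rightarrow>
    ('s iso_sort, ('s, 'r) iso_rel) bprop set set \<Rightarrow> ('s, 'r) bprop set set" where
  "shriek T U = \<Squnion>\<^bsub>OG0 T\<^esub>((\<lambda>y. section_inv T y U) ` surjections)"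

text \<open>
  Names above a bound \<open>N\<close> for \<open>V\<close> are free to enumerate everything: let \<open>m + N\<close> go to \<open>m\<close>.
\<close>

lemma surjections_extend:
  fixes y :: "nat \<times> 's \<Rightarrow> nat"
  assumes "finite V"
  obtains y' where "y' \<in> surjections" "\<And>x. x \<in> V \<Longrightarrow> y' x = y x"
proof -
  obtain N where N: "\<And>n X. (n, X) \<in> V \<Longrightarrow> n < N"
    using finite_nat_set_iff_bounded[of "fst ` V"] assms by fastforce
  let ?y = "\<lambda>(n, X). if (n, X) \<in> V then y (n, X) else n - N"
  have "?y (m + N, X) = m" for m X using N[of "m + N" X] by auto
  then have "surj (\<lambda>n. ?y (n, X))" for X
    by (intro surjI[where f = "\<lambda>m. m + N"])
  then have "?y \<in> surjections" by (simp add: surjections_def)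
  then show thesis by (rule that) auto
qed

locale geometric =
  fixes T :: "('s, 'r, 'g) geo_theory"
  assumes geometric: "geometric_theory T"
begin

sublocale P0: propositional_theory "prop_theory T"
  by unfold_locales (rule geometric_prop_theory[OF geometric])

sublocale P1: propositional_theory "prop_theory (iso_theory T)"
  by unfold_locales (rule geometric_prop_theory[OF geometric_iso_theory[OF geometric]])

sublocale G0: frame "OG0 T" by (rule frame_OG0[OF geometric])
sublocale G1: frame "OG1 T" by (rule frame_OG1[OF geometric])

lemma complete: "complete_lattice (OG0 T)" "complete_lattice (OG1 T)"
  by unfold_locales

abbreviation g0 where "g0 \<equiv> gen (prop_theory T)"
abbreviation g1 where "g1 \<equiv> gen (prop_theory (iso_theory T))"

lemma model0: "model (prop_theory T) (OG0 T) g0"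
  unfolding OG0_def by (rule P0.model_gen)

lemma model1: "model (prop_theory (iso_theory T)) (OG1 T) g1"
  unfolding OG1_def by (rule P1.model_gen)

lemma g0_closed: "p \<in> rels (prop_theory T) \<Longrightarrow> g0 p \<in> carrier (OG0 T)"
  using model0 by (auto simp: model_def)

lemma g1_closed: "p \<in> rels (prop_theory (iso_theory T)) \<Longrightarrow> g1 p \<in> carrier (OG1 T)"
  using model1 by (auto simp: model_def)

lemma frame_model_section:
  assumes "y \<in> surjections"
  shows "frame_model (prop_theory (iso_theory T)) (OG0 T) (\<lambda>p. g0 (relabel_iso T y p))"
  using G0.model_iso_theory_relabel[OF geometric model0, of y] assms
    P1.propositional_theory_axioms G0.frame_axioms
  by (intro frame_model.intro frame_model_axioms.intro) (auto simp: surjections_def)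

lemma section_hom: "y \<in> surjections \<Longrightarrow> frame_hom (OG1 T) (OG0 T) (section_inv T y)"
  using frame_model.frame_hom_induced[OF frame_model_section] by (simp add: section_inv_def OG1_def)

lemma section_gen:
  "y \<in> surjections \<Longrightarrow> p \<in> rels (prop_theory (iso_theory T)) \<Longrightarrow>
   section_inv T y (g1 p) = g0 (relabel_iso T y p)"
  using frame_model.induced_gen[OF frame_model_section] by (simp add: section_inv_def)

lemmas source_hom = frame_hom_source_inv[OF geometric]

lemma first_copy_in_rels:
  "(R, ns) \<in> rels (prop_theory T) \<Longrightarrow> (map_grel S1 R1 R, ns) \<in> rels (prop_theory (iso_theory T))"
  by (cases R) (auto simp: prop_theory_def iso_theory_def)

text \<open>
  Renaming leaves the first model of the arrow as it was, so both sides agree on generators.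
\<close>

lemma section_source:
  assumes y: "y \<in> surjections" and V: "V \<in> carrier (OG0 T)"
  shows "section_inv T y (source_inv T V) = V"
proof -
  interpret m: frame_model "prop_theory T" "OG0 T" g0
    using model0 P0.propositional_theory_axioms G0.frame_axioms
    by (intro frame_model.intro frame_model_axioms.intro)
  have hom: "frame_hom (classifying_frame (prop_theory T)) (OG0 T) (section_inv T y \<circ> source_inv T)"
    using frame_hom_comp[OF source_hom section_hom[OF y]] by (simp add: OG0_def)
  have gens: "(section_inv T y \<circ> source_inv T) (g0 p) = g0 p" if p: "p \<in> rels (prop_theory T)" for p
  proof (cases p)
    case (Pair R ns)
    then show ?thesis
      using p source_inv_gen[OF geometric, of R ns] section_gen[OF y first_copy_in_rels]
      by (simp add: gen0_def gen1_def relabel_iso_first)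
  qed
  have "(section_inv T y \<circ> source_inv T) V = induced_hom (OG0 T) g0 V"
    by (rule m.induced_unique[OF hom gens]) (use V in \<open>auto simp: OG0_def\<close>)
  also have "\<dots> = V" using V P0.induced_hom_gen[of V] by (simp add: OG0_def P0.S_def)
  finally show ?thesis by simp
qed

lemma section_Inf:
  assumes "y \<in> surjections" "F \<in> Fpow (rels (prop_theory (iso_theory T)))"
  shows "section_inv T y (\<Sqinter>\<^bsub>OG1 T\<^esub>(g1 ` F)) = \<Sqinter>\<^bsub>OG0 T\<^esub>((\<lambda>p. g0 (relabel_iso T y p)) ` F)"
proof -
  have "finite (g1 ` F)" "g1 ` F \<subseteq> carrier (OG1 T)"
    using assms(2) g1_closed by (auto simp: Fpow_def)
  then have "section_inv T y (\<Sqinter>\<^bsub>OG1 T\<^esub>(g1 ` F)) = \<Sqinter>\<^bsub>OG0 T\<^esub>((\<lambda>p. section_inv T y (g1 p)) ` F)"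
    using frame_hom_finite_Inf[OF section_hom[OF assms(1)] complete(2,1)] by (simp add: image_image)
  also have "(\<lambda>p. section_inv T y (g1 p)) ` F = (\<lambda>p. g0 (relabel_iso T y p)) ` F"
    using assms section_gen by (intro image_cong) (auto simp: Fpow_def)
  finally show ?thesis .
qed

lemma sections_closed:
  "U \<in> carrier (OG1 T) \<Longrightarrow> (\<lambda>y. section_inv T y U) ` surjections \<subseteq> carrier (OG0 T)"
  using frame_hom_closed[OF section_hom] by auto

lemma shriek_closed: "U \<in> carrier (OG1 T) \<Longrightarrow> shriek T U \<in> carrier (OG0 T)"
  unfolding shriek_def by (intro G0.sup_closed sections_closed)

lemma section_le_shriek:
  "U \<in> carrier (OG1 T) \<Longrightarrow> y \<in> surjections \<Longrightarrow> section_inv T y U \<sqsubseteq>\<^bsub>OG0 T\<^esub> shriek T U"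
  unfolding shriek_def by (intro G0.sup_upper sections_closed) auto

lemma shriek_least:
  "U \<in> carrier (OG1 T) \<Longrightarrow> V \<in> carrier (OG0 T) \<Longrightarrow>
   (\<And>y. y \<in> surjections \<Longrightarrow> section_inv T y U \<sqsubseteq>\<^bsub>OG0 T\<^esub> V) \<Longrightarrow> shriek T U \<sqsubseteq>\<^bsub>OG0 T\<^esub> V"
  unfolding shriek_def by (intro G0.sup_least sections_closed) auto

lemma finite_meet_closed:
  "F \<in> Fpow (rels (prop_theory (iso_theory T))) \<Longrightarrow> \<Sqinter>\<^bsub>OG1 T\<^esub>(g1 ` F) \<in> carrier (OG1 T)"
  by (intro G1.inf_closed) (auto simp: Fpow_def g1_closed)

text \<open>
  An element of a presented frame is itself a set of finite sets of generators, and it is the join of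
  the meets of these.
\<close>

lemma join_of_finite_meets:
  assumes "U \<in> carrier (OG1 T)"
  shows "U \<subseteq> Fpow (rels (prop_theory (iso_theory T)))"
    and "U = \<Squnion>\<^bsub>OG1 T\<^esub>((\<lambda>F. \<Sqinter>\<^bsub>OG1 T\<^esub>(g1 ` F)) ` U)"
proof -
  have U: "U \<in> P1.S" using assms by (simp add: OG1_def P1.S_def)
  show "U \<subseteq> Fpow (rels (prop_theory (iso_theory T)))"
    by (rule P1.F'_sub[OF P1.S_sub[OF U]])
  show "U = \<Squnion>\<^bsub>OG1 T\<^esub>((\<lambda>F. \<Sqinter>\<^bsub>OG1 T\<^esub>(g1 ` F)) ` U)"
    using P1.induced_hom_gen[OF U] by (simp add: induced_hom_def OG1_def)
qed

text \<open>
  The unit of the adjunction on a basic open \<open>B\<close>. Locally the names of the second model that occur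
  have preimages \<open>y d\<close>, and then all the generators in \<open>B\<close> hold of these preimages in the first model.
  There the section of any surjection that extends \<open>y\<close> takes its value in \<open>B\<close>, and its contribution to
  the join suffices.
\<close>

lemma finite_meet_le_source_shriek:
  assumes F: "F \<in> Fpow (rels (prop_theory (iso_theory T)))"
  defines "B \<equiv> \<Sqinter>\<^bsub>OG1 T\<^esub>(g1 ` F)"
  shows "B \<sqsubseteq>\<^bsub>OG1 T\<^esub> source_inv T (shriek T B)"
proof -
  let ?V = "\<Union>p\<in>F. iso_vars T p"
  have F_rels: "p \<in> rels (prop_theory (iso_theory T))" if "p \<in> F" for p
    using F that by (auto simp: Fpow_def)
  have finF: "finite F" using F by (auto simp: Fpow_def)
  have B: "B \<in> carrier (OG1 T)" unfolding B_def by (rule finite_meet_closed[OF F])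
  have B_le: "B \<sqsubseteq>\<^bsub>OG1 T\<^esub> g1 p" if "p \<in> F" for p
    unfolding B_def using that F_rels g1_closed by (intro G1.inf_lower) auto
  show ?thesis
  proof (rule G1.cover_by_preimages[OF geometric model1, of ?V])
    show "finite ?V" using finF finite_iso_vars by blast
    show "source_inv T (shriek T B) \<in> carrier (OG1 T)"
      by (rule frame_hom_closed[OF source_hom shriek_closed[OF B]])
    show "X \<in> sorts T \<and> B \<sqsubseteq>\<^bsub>OG1 T\<^esub> g1 (Eq (S2 X), [n, n])" if "(n, X) \<in> ?V" for n X
      using that G1.vars_defined[OF geometric model1 B F_rels B_le] by blast
    fix y z assume z: "z \<in> carrier (OG1 T)" "z \<sqsubseteq>\<^bsub>OG1 T\<^esub> B"
      and \<alpha>: "\<And>n X. (n, X) \<in> ?V \<Longrightarrow> z \<sqsubseteq>\<^bsub>OG1 T\<^esub> g1 (Sym (Alpha X), [y (n, X), n])"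
    obtain y' where y': "y' \<in> surjections" "\<And>x. x \<in> ?V \<Longrightarrow> y' x = y x"
      using surjections_extend[OF \<open>finite ?V\<close>, of y] by blast
    have le: "z \<sqsubseteq>\<^bsub>OG1 T\<^esub> source_inv T (g0 (relabel_iso T y' p))" if p: "p \<in> F" for p
    proof -
      obtain Q ms where q: "relabel_iso T y' p = (Q, ms)" by (cases "relabel_iso T y' p")
      have "z \<sqsubseteq>\<^bsub>OG1 T\<^esub> g1 p"
        using G1.le_trans[OF z(2) B_le[OF p] z(1) B g1_closed[OF F_rels[OF p]]] .
      moreover have "z \<sqsubseteq>\<^bsub>OG1 T\<^esub> g1 (Sym (Alpha X), [y' (n, X), n])" if "(n, X) \<in> iso_vars T p" for n X
      proof -
        have V: "(n, X) \<in> ?V" using that p by blast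
        show ?thesis using \<alpha>[OF V] y'(2)[OF V] by simp
      qed
      ultimately have "z \<sqsubseteq>\<^bsub>OG1 T\<^esub> g1 (map_grel S1 R1 Q, ms)"
        using G1.transport_to_source[OF geometric model1 z(1) F_rels[OF p] _ _ q] by blast
      then show ?thesis
        using source_inv_gen[OF geometric, of Q ms] relabel_iso_in_rels[OF F_rels[OF p], of y'] q
        by (simp add: gen0_def gen1_def)
    qed
    let ?G = "(\<lambda>p. g0 (relabel_iso T y' p)) ` F"
    have G: "finite ?G" "?G \<subseteq> carrier (OG0 T)"
      using finF g0_closed[OF relabel_iso_in_rels[OF F_rels]] by (auto simp del: split_paired_All)
    have "z \<sqsubseteq>\<^bsub>OG1 T\<^esub> \<Sqinter>\<^bsub>OG1 T\<^esub>(source_inv T ` ?G)"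
      using le z(1) G(2) frame_hom_closed[OF source_hom] by (intro G1.inf_greatest) auto
    also have "\<Sqinter>\<^bsub>OG1 T\<^esub>(source_inv T ` ?G) = source_inv T (section_inv T y' B)"
      using frame_hom_finite_Inf[OF source_hom complete G] section_Inf[OF y'(1) F] by (simp add: B_def)
    also have "\<dots> \<sqsubseteq>\<^bsub>OG1 T\<^esub> source_inv T (shriek T B)"
      by (rule frame_hom_mono[OF source_hom complete frame_hom_closed[OF section_hom[OF y'(1)] B]
            shriek_closed[OF B] section_le_shriek[OF B y'(1)]])
    finally show "z \<sqsubseteq>\<^bsub>OG1 T\<^esub> source_inv T (shriek T B)"
      using z(1) frame_hom_closed[OF source_hom] shriek_closed[OF B]
        frame_hom_closed[OF section_hom[OF y'(1)] B] by blast
  qed (rule B)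
qed

lemma shriek_mono:
  assumes "U \<in> carrier (OG1 T)" "U' \<in> carrier (OG1 T)" "U \<sqsubseteq>\<^bsub>OG1 T\<^esub> U'"
  shows "shriek T U \<sqsubseteq>\<^bsub>OG0 T\<^esub> shriek T U'"
proof (rule shriek_least[OF assms(1) shriek_closed[OF assms(2)]])
  fix y :: "nat \<times> 's \<Rightarrow> nat" assume y: "y \<in> surjections"
  note c = frame_hom_closed[OF section_hom[OF y]]
  show "section_inv T y U \<sqsubseteq>\<^bsub>OG0 T\<^esub> shriek T U'"
    using G0.le_trans[OF frame_hom_mono[OF section_hom[OF y] complete(2,1) assms]
        section_le_shriek[OF assms(2) y] c[OF assms(1)] c[OF assms(2)] shriek_closed[OF assms(2)]] .
qed

lemma le_source_shriek:
  assumes U: "U \<in> carrier (OG1 T)"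
  shows "U \<sqsubseteq>\<^bsub>OG1 T\<^esub> source_inv T (shriek T U)"
proof -
  let ?B = "\<lambda>F. \<Sqinter>\<^bsub>OG1 T\<^esub>(g1 ` F)"
  note F = subsetD[OF join_of_finite_meets(1)[OF U]]
  note s = frame_hom_closed[OF source_hom shriek_closed]
  have B: "?B ` U \<subseteq> carrier (OG1 T)" using finite_meet_closed F by blast
  have "\<Squnion>\<^bsub>OG1 T\<^esub>(?B ` U) \<sqsubseteq>\<^bsub>OG1 T\<^esub> source_inv T (shriek T U)"
  proof (rule G1.sup_least[OF B s[OF U]])
    fix b assume "b \<in> ?B ` U"
    then obtain F where b: "F \<in> U" "b = ?B F" by blast
    have bc: "b \<in> carrier (OG1 T)" using B b by blast
    have "b \<sqsubseteq>\<^bsub>OG1 T\<^esub> U"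
      using G1.sup_upper[OF B, of b] b join_of_finite_meets(2)[OF U] by auto
    then have "source_inv T (shriek T b) \<sqsubseteq>\<^bsub>OG1 T\<^esub> source_inv T (shriek T U)"
      by (intro frame_hom_mono[OF source_hom complete] shriek_closed shriek_mono bc U)
    then show "b \<sqsubseteq>\<^bsub>OG1 T\<^esub> source_inv T (shriek T U)"
      using G1.le_trans[OF finite_meet_le_source_shriek[OF F[OF b(1)]]] bc s U b by simp
  qed
  then show ?thesis using join_of_finite_meets(2)[OF U] by simp
qed

text \<open>
  From left to right this is the unit; from right to left, each section turns \<open>U \<le> s\<^sup>* V\<close> into an
  inequality \<open>\<dots> \<le> V\<close>, because it splits \<open>s\<close>.
\<close>

lemma shriek_adjunction:
  assumes U: "U \<in> carrier (OG1 T)" and V: "V \<in> carrier (OG0 T)"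
  shows "shriek T U \<sqsubseteq>\<^bsub>OG0 T\<^esub> V \<longleftrightarrow> U \<sqsubseteq>\<^bsub>OG1 T\<^esub> source_inv T V"
proof
  note s = frame_hom_closed[OF source_hom]
  assume "shriek T U \<sqsubseteq>\<^bsub>OG0 T\<^esub> V"
  then have "source_inv T (shriek T U) \<sqsubseteq>\<^bsub>OG1 T\<^esub> source_inv T V"
    by (intro frame_hom_mono[OF source_hom complete] shriek_closed U V)
  then show "U \<sqsubseteq>\<^bsub>OG1 T\<^esub> source_inv T V"
    using G1.le_trans[OF le_source_shriek[OF U]] U s shriek_closed[OF U] s[OF V] by blast
next
  assume le: "U \<sqsubseteq>\<^bsub>OG1 T\<^esub> source_inv T V"
  show "shriek T U \<sqsubseteq>\<^bsub>OG0 T\<^esub> V"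
  proof (rule shriek_least[OF U V])
    fix y :: "nat \<times> 's \<Rightarrow> nat" assume y: "y \<in> surjections"
    show "section_inv T y U \<sqsubseteq>\<^bsub>OG0 T\<^esub> V"
      using frame_hom_mono[OF section_hom[OF y] complete(2,1) U frame_hom_closed[OF source_hom V] le]
        section_source[OF y V] by simp
  qed
qed

lemma galois_shriek:
  "galois_connection \<lparr>orderA = OG1 T, orderB = OG0 T, lower = shriek T, upper = source_inv T\<rparr>"
  unfolding galois_connection_def connection_def galois_connection_axioms_def
  using G0.partial_order_axioms G1.partial_order_axioms shriek_closed shriek_adjunction
    frame_hom_closed[OF source_hom] by simp

lemma sup_pres_shriek: "sup_pres (OG1 T) (OG0 T) (shriek T)"
proof -
  have "shriek T (\<Squnion>\<^bsub>OG1 T\<^esub>A) = \<Squnion>\<^bsub>OG0 T\<^esub>(shriek T ` A)" if A: "A \<subseteq> carrier (OG1 T)" for A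
  proof -
    note c = G1.sup_closed[OF A]
    have sA: "shriek T ` A \<subseteq> carrier (OG0 T)" using A shriek_closed by blast
    show ?thesis
    proof (rule G0.le_antisym)
      note d = G0.sup_closed[OF sA]
      have "\<Squnion>\<^bsub>OG1 T\<^esub>A \<sqsubseteq>\<^bsub>OG1 T\<^esub> source_inv T (\<Squnion>\<^bsub>OG0 T\<^esub>(shriek T ` A))"
      proof (rule G1.sup_least[OF A frame_hom_closed[OF source_hom d]])
        fix a assume a: "a \<in> A"
        then show "a \<sqsubseteq>\<^bsub>OG1 T\<^esub> source_inv T (\<Squnion>\<^bsub>OG0 T\<^esub>(shriek T ` A))"
          using shriek_adjunction[of a, OF _ d] G0.sup_upper[OF sA] A by blast
      qed
      then show "shriek T (\<Squnion>\<^bsub>OG1 T\<^esub>A) \<sqsubseteq>\<^bsub>OG0 T\<^esub> \<Squnion>\<^bsub>OG0 T\<^esub>(shriek T ` A)"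
        by (simp add: shriek_adjunction[OF c d])
      show "\<Squnion>\<^bsub>OG0 T\<^esub>(shriek T ` A) \<sqsubseteq>\<^bsub>OG0 T\<^esub> shriek T (\<Squnion>\<^bsub>OG1 T\<^esub>A)"
        using shriek_mono[OF subsetD[OF A] c G1.sup_upper[OF A]] shriek_closed[OF c]
        by (intro G0.sup_least[OF sA]) auto
    qed (use shriek_closed[OF c] G0.sup_closed[OF sA] in auto)
  qed
  then show ?thesis using complete by (simp add: sup_pres_def)
qed

section \<open>The formula on basic opens\<close>

definition basic_gens where
  "basic_gens I J K = (\<lambda>(R, as). (map_grel S1 R1 R, as)) ` set I \<union>
     (\<lambda>(R, bs). (map_grel S2 R2 R, bs)) ` set J \<union> (\<lambda>(X, c, d). (Sym (Alpha X), [c, d])) ` set K"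

definition well_typed where
  "well_typed I J K \<longleftrightarrow> set I \<subseteq> rels (prop_theory T) \<and> set J \<subseteq> rels (prop_theory T) \<and> fst ` set K \<subseteq> sorts T"

lemma basic_gens_Fpow:
  assumes "well_typed I J K"
  shows "basic_gens I J K \<in> Fpow (rels (prop_theory (iso_theory T)))"
proof -
  have "(map_grel S2 R2 R, ns) \<in> rels (prop_theory (iso_theory T))"
    if "(R, ns) \<in> rels (prop_theory T)" for R ns
    using that by (cases R) (auto simp: prop_theory_def iso_theory_def)
  moreover have "(Sym (Alpha X), [c, d]) \<in> rels (prop_theory (iso_theory T))" if "X \<in> sorts T" for X c d
    using that by (auto simp: prop_theory_def iso_theory_def)
  ultimately show ?thesis
    using assms first_copy_in_rels unfolding well_typed_def basic_gens_def Fpow_def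
    by fastforce
qed

lemma basic_open_Inf:
  assumes "well_typed I J K"
  shows "basic_open T I J K = \<Sqinter>\<^bsub>OG1 T\<^esub>(g1 ` basic_gens I J K)"
proof -
  have "g1 ` basic_gens I J K \<subseteq> carrier (OG1 T)"
    using basic_gens_Fpow[OF assms] g1_closed by (auto simp: Fpow_def)
  then show ?thesis
    unfolding basic_open_def basic_gens_def gen1_def
    by (simp add: image_Un G1.Inf_Un image_image case_prod_unfold)
qed

lemma Fpow_basic_gens:
  assumes "F \<in> Fpow (rels (prop_theory (iso_theory T)))"
  obtains I J K where "well_typed I J K" "F = basic_gens I J K"
proof -
  have "finite F" "F \<subseteq> rels (prop_theory (iso_theory T))" using assms by (auto simp: Fpow_def)
  then have "\<exists>I J K. well_typed I J K \<and> F = basic_gens I J K"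
  proof (induction F rule: finite_induct)
    case empty
    have "well_typed [] [] [] \<and> {} = basic_gens [] [] []" by (simp add: well_typed_def basic_gens_def)
    then show ?case by blast
  next
    case (insert p F)
    then obtain I J K where IJK: "well_typed I J K" "F = basic_gens I J K" by auto
    obtain R ns where p: "p = (R, ns)" "rel_in (iso_theory T) R" "length ns = length (rel_arity (iso_theory T) R)"
      using insert.prems by (auto simp: prop_theory_def)
    from p(2) show ?case
    proof (cases rule: rel_in_iso_cases)
      case (1 R')
      then have "well_typed ((R', ns) # I) J K \<and> insert p F = basic_gens ((R', ns) # I) J K"
        using IJK p by (auto simp: well_typed_def basic_gens_def prop_theory_def rel_arity_iso)
      then show ?thesis by blast
    next
      case (2 R')
      then have "well_typed I ((R', ns) # J) K \<and> insert p F = basic_gens I ((R', ns) # J) K"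
        using IJK p by (auto simp: well_typed_def basic_gens_def prop_theory_def rel_arity_iso)
      then show ?thesis by blast
    next
      case (3 X)
      then obtain c d where "ns = [c, d]" using p(3) by (auto simp: length_Suc_conv rel_arity_iso)
      then have "well_typed I J ((X, c, d) # K) \<and> insert p F = basic_gens I J ((X, c, d) # K)"
        using IJK p 3 by (auto simp: well_typed_def basic_gens_def)
      then show ?thesis by blast
    qed
  qed
  then show thesis using that by blast
qed

text \<open>
  Each section turns the basic open into \<open>A \<sqinter> B y\<close> with \<open>A\<close> independent of \<open>y\<close>, and distributivity moves \<open>A\<close>
  out of the join. The join of the \<open>B y\<close> over all surjections is the join over all assignments on
  the finite set of variables, because \<open>B y\<close> depends only on \<open>y\<close> at these and each assignment extends.
\<close>

lemma shriek_basic_open: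
  assumes IJK: "well_typed I J K"
  shows "shriek T (basic_open T I J K) = basic_image T I J K"
proof -
  let ?F = "basic_gens I J K" and ?V = "typed_vars T J K"
  let ?A = "\<Sqinter>\<^bsub>OG0 T\<^esub>((\<lambda>(R, as). gen0 T R as) ` set I)"
  let ?J = "\<lambda>y. (\<lambda>(R, bs). gen0 T R (map y (zip bs (rel_arity T R)))) ` set J"
  let ?K = "\<lambda>y. (\<lambda>(X, c, d). gen0 T (Eq X) [c, y (d, X)]) ` set K"
  let ?B = "\<lambda>y. \<Sqinter>\<^bsub>OG0 T\<^esub>(?J y) \<sqinter>\<^bsub>OG0 T\<^esub> \<Sqinter>\<^bsub>OG0 T\<^esub>(?K y)"
  have I_cl: "(\<lambda>(R, as). gen0 T R as) ` set I \<subseteq> carrier (OG0 T)"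
    using IJK g0_closed by (auto simp: well_typed_def gen0_def)
  have J_cl: "?J y \<subseteq> carrier (OG0 T)" for y
    using IJK by (fastforce simp: well_typed_def gen0_def in_rels_iff intro!: g0_closed)
  have K_cl: "?K y \<subseteq> carrier (OG0 T)" for y
    using IJK by (fastforce simp: well_typed_def gen0_def in_rels_iff intro!: g0_closed)
  have B_cl: "?B y \<in> carrier (OG0 T)" for y using J_cl[of y] K_cl[of y] by simp
  have "section_inv T y (basic_open T I J K) = ?A \<sqinter>\<^bsub>OG0 T\<^esub> ?B y" if y: "y \<in> surjections" for y
  proof -
    have "(\<lambda>p. g0 (relabel_iso T y p)) ` ?F = (\<lambda>(R, as). gen0 T R as) ` set I \<union> (?J y \<union> ?K y)"
    proof -
      have "relabel T y p = (fst p, map y (zip (snd p) (rel_arity T (fst p))))" for p by (cases p) simp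
      then show ?thesis
        unfolding basic_gens_def
        by (simp add: image_Un image_image case_prod_unfold relabel_iso_first relabel_iso_second
            gen0_def Un_assoc)
    qed
    then show ?thesis
      unfolding basic_open_Inf[OF IJK] section_Inf[OF y basic_gens_Fpow[OF IJK]]
      using G0.Inf_Un[OF I_cl Un_least[OF J_cl K_cl]] G0.Inf_Un[OF J_cl K_cl] by simp
  qed
  then have "shriek T (basic_open T I J K) = \<Squnion>\<^bsub>OG0 T\<^esub>((\<lambda>b. ?A \<sqinter>\<^bsub>OG0 T\<^esub> b) ` ?B ` surjections)"
    unfolding shriek_def by (simp add: image_image cong: image_cong)
  also have "\<dots> = ?A \<sqinter>\<^bsub>OG0 T\<^esub> \<Squnion>\<^bsub>OG0 T\<^esub>(?B ` surjections)"
    using G0.meet_Sup_distrib[of ?A "?B ` surjections"] I_cl B_cl by (simp add: image_subset_iff)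
  also have "?B ` surjections = ?B ` (?V \<rightarrow>\<^sub>E UNIV)"
  proof -
    have B_cong: "?B y = ?B y'" if agree: "\<And>x. x \<in> ?V \<Longrightarrow> y x = y' x" for y y'
    proof -
      have "map y (zip bs (rel_arity T R)) = map y' (zip bs (rel_arity T R))" if "(R, bs) \<in> set J" for R bs
      proof (intro map_cong refl agree)
        show "x \<in> ?V" if "x \<in> set (zip bs (rel_arity T R))" for x
          using \<open>(R, bs) \<in> set J\<close> that unfolding typed_vars_def by blast
      qed
      then have "?J y = ?J y'"
        by (intro image_cong refl) (auto simp del: map_eq_conv)
      moreover have "y (d, X) = y' (d, X)" if "(X, c, d) \<in> set K" for X c d
      proof (rule agree)
        have "(d, X) = (\<lambda>(X, c, d). (d, X)) (X, c, d)" by simp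
        then show "(d, X) \<in> ?V" using that unfolding typed_vars_def by blast
      qed
      then have "?K y = ?K y'" by (intro image_cong refl) auto
      ultimately show ?thesis by simp
    qed
    have fin: "finite ?V" by (auto simp: typed_vars_def)
    show ?thesis
    proof (intro equalityI image_subsetI)
      fix y :: "nat \<times> 's \<Rightarrow> nat"
      have "?B y = ?B (restrict y ?V)" by (rule B_cong) simp
      then show "?B y \<in> ?B ` (?V \<rightarrow>\<^sub>E UNIV)"
        by (rule image_eqI[where f = ?B and x = "restrict y ?V"]) simp
    next
      fix y :: "nat \<times> 's \<Rightarrow> nat"
      obtain y' where y': "y' \<in> surjections" "\<And>x. x \<in> ?V \<Longrightarrow> y' x = y x"
        using surjections_extend[OF fin, of y] by blast
      then have "?B y = ?B y'" by (intro B_cong) simp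
      then show "?B y \<in> ?B ` surjections" using y'(1) by (rule image_eqI[where f = ?B])
    qed
  qed
  finally show ?thesis by (simp add: basic_image_def)
qed

lemma shriek_formula_shriek: "shriek_formula T (shriek T)"
  unfolding shriek_formula_def using shriek_basic_open by (simp add: well_typed_def)

lemma sup_pres_formula_unique:
  assumes f: "sup_pres (OG1 T) (OG0 T) f" "shriek_formula T f"
    and g: "sup_pres (OG1 T) (OG0 T) g" "shriek_formula T g"
    and U: "U \<in> carrier (OG1 T)"
  shows "f U = g U"
proof -
  let ?B = "\<lambda>F. \<Sqinter>\<^bsub>OG1 T\<^esub>(g1 ` F)"
  note F = subsetD[OF join_of_finite_meets(1)[OF U]]
  have eq: "f (?B F) = g (?B F)" if "F \<in> U" for F
  proof -
    obtain I J K where IJK: "well_typed I J K" "F = basic_gens I J K"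
      using Fpow_basic_gens[OF F[OF \<open>F \<in> U\<close>]] .
    then have "f (basic_open T I J K) = g (basic_open T I J K)"
      using f(2) g(2) by (simp add: shriek_formula_def well_typed_def)
    then show ?thesis by (simp only: basic_open_Inf[OF IJK(1)] IJK(2))
  qed
  have B: "?B ` U \<subseteq> carrier (OG1 T)" using finite_meet_closed F by blast
  have join: "h U = \<Squnion>\<^bsub>OG0 T\<^esub>((\<lambda>F. h (?B F)) ` U)" if "sup_pres (OG1 T) (OG0 T) h" for h
  proof -
    have "h (\<Squnion>\<^bsub>OG1 T\<^esub>(?B ` U)) = \<Squnion>\<^bsub>OG0 T\<^esub>(h ` ?B ` U)"
      using that B by (simp add: sup_pres_def)
    then show ?thesis using join_of_finite_meets(2)[OF U] by (simp add: image_image)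
  qed
  have "(\<lambda>F. f (?B F)) ` U = (\<lambda>F. g (?B F)) ` U"
    by (intro image_cong refl eq)
  then show ?thesis by (simp only: join[OF f(1)] join[OF g(1)])
qed

end

theorem lemma4p4:
  fixes T :: "('s, 'r, 'i) geo_theory"
  assumes "geometric_theory T"
  shows "\<exists>s_shriek.
    galois_connection
      \<lparr>orderA = OG1 T, orderB = OG0 T, lower = s_shriek, upper = source_inv T\<rparr> \<and>
    sup_pres (OG1 T) (OG0 T) s_shriek \<and> shriek_formula T s_shriek \<and>
    (\<forall>f. f \<in> carrier (OG1 T) \<rightarrow> carrier (OG0 T) \<and> sup_pres (OG1 T) (OG0 T) f \<and>
         shriek_formula T f \<longrightarrow> (\<forall>U\<in>carrier (OG1 T). f U = s_shriek U))"
proof -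
  interpret geometric T by unfold_locales (rule assms)
  show ?thesis
    using galois_shriek sup_pres_shriek shriek_formula_shriek
      sup_pres_formula_unique[OF _ _ sup_pres_shriek shriek_formula_shriek]
    by (intro exI[of _ "shriek T"]) blast
qed
end
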